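(* Let $K$ be a convex body in $\mathbb{R}^d$, let $F$ be a linear subspace of $\mathbb{R}^d$ of dimension $s\in\{0,1,\dots,d-1\}$, and let $E$ be an origin-centered ellipsoid of revolution with axis $F$ contained in $K$ which has maximal volume among all ellipsoids of revolution with axis $F$ contained in $K$. Then (1) $\operatorname{inrad}(K\cap F^\perp)\le \frac{d}{d-s}\cdot \mathrm{radius}(E\cap F^\perp)$; (2) $\Big(\frac{\mathrm{vol}_s(K\cap F)}{\mathrm{vol}_s(E\cap F)}\Big)^{1/s}\le \frac{1}{(s+1)^{\frac{d-s}{2s(d+1)}}}\sqrt{\frac{d(d+1)}{s(s+1)}}\Big(\frac{\mathrm{vol}_s(\Delta_J^s)}{\mathrm{vol}_s(B^s)}\Big)^{1/s}$; (3) $E\cap F\subset K\cap F\subset d\,(E\cap F)$. If, additionally, $K$ is centrally symmetric, then (S1) $\operatorname{inrad}(K\cap F^\perp)\le \sqrt{\frac{d}{d-s}}\cdot \mathrm{radius}(E\cap F^\perp)$; (S2) $\Big(\frac{\mathrm{vol}_s(K\cap F)}{\mathrm{vol}_s(E\cap F)}\Big)^{1/s}\le \sqrt{\frac{d}{s}}\Big(\frac{\mathrm{vol}_s([-1,1]^s)}{\mathrm{vol}_s(B^s)}\Big)^{1/s}$; (S3) $E\cap F\subset K\cap F\subset \sqrt{d}\,(E\cap F)$.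
   Context: A convex body is a compact convex set with nonempty interior; $B^d$ is the closed Euclidean unit ball centered at the origin. For a linear subspace $F$, an $F$-operator is an invertible linear operator $A$ on $\mathbb{R}^d$ such that $F$ and $F^\perp$ are invariant under $A$ and $A|_{F^\perp}$ is a nonzero multiple of the identity on $F^\perp$. An ellipsoid of revolution with axis $F$ is a set $AB^d+z$ with $A$ an $F$-operator and $z\in\mathbb{R}^d$; for such an origin-centered $E$, $E\cap F^\perp$ is a $(d-s)$-dimensional Euclidean ball whose radius is denoted $\mathrm{radius}(E\cap F^\perp)$. The inradius $\operatorname{inrad}(A)$ of a compact convex set $A$ is the largest radius of a ball within the affine hull of $A$ that is contained in $A$. $\Delta_J^s$ denotes the $s$-dimensional regular simplex circumscribed around $B^s$, and $\mathrm{vol}_s$ is $s$-dimensional volume. *)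

theory Defs
  imports "HOL-Analysis.Analysis"
begin

definition convex_body :: "'a::euclidean_space set \<Rightarrow> bool" where
  "convex_body K \<longleftrightarrow> compact K \<and> convex K \<and> interior K \<noteq> {}"

definition F_operator :: "'a::euclidean_space set \<Rightarrow> ('a \<Rightarrow> 'a) \<Rightarrow> bool" where
  "F_operator F A \<longleftrightarrow> linear A \<and> bij A \<and> A ` F \<subseteq> F \<and>
     A ` (orthogonal_comp F) \<subseteq> orthogonal_comp F \<and>
     (\<exists>c::real. c \<noteq> 0 \<and> (\<forall>x\<in>orthogonal_comp F. A x = c *\<^sub>R x))"

definition rev_ellipsoid :: "'a::euclidean_space set \<Rightarrow> 'a set \<Rightarrow> bool" where
  "rev_ellipsoid F E \<longleftrightarrow> (\<exists>A z. F_operator F A \<and> E = (\<lambda>x. A x + z) ` cball 0 1)"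

definition ball_radius :: "'a::euclidean_space set \<Rightarrow> real" where
  "ball_radius S = (SUP x\<in>S. norm x)"

definition inrad :: "'a::euclidean_space set \<Rightarrow> real" where
  "inrad A = Sup {r. \<exists>x\<in>affine hull A. cball x r \<inter> affine hull A \<subseteq> A}"

text \<open>s-dimensional Lebesgue measure on the model space R^s, realised as functions
  {..<s} \<Rightarrow> real (extensional), with the product Lebesgue measure.\<close>
definition volS :: "nat \<Rightarrow> (nat \<Rightarrow> real) set \<Rightarrow> real" where
  "volS s S = measure (Pi\<^sub>M {..<s} (\<lambda>_. lborel)) S"

definition onb :: "'a::euclidean_space set \<Rightarrow> nat \<Rightarrow> 'a" where
  "onb F = (SOME b. (\<forall>i<dim F. \<forall>j<dim F. b i \<bullet> b j = (if i = j then 1 else 0))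
                    \<and> span (b ` {..<dim F}) = F)"

text \<open>s-dimensional volume (s = dim F) of a subset S of the subspace F, computed
  through the isometry R^s \<rightarrow> F given by an orthonormal basis.\<close>
definition subvol :: "'a::euclidean_space set \<Rightarrow> 'a set \<Rightarrow> real" where
  "subvol F S = volS (dim F)
     {c \<in> PiE {..<dim F} (\<lambda>_. UNIV). (\<Sum>i<dim F. c i *\<^sub>R onb F i) \<in> S}"

definition unit_ballS :: "nat \<Rightarrow> (nat \<Rightarrow> real) set" where
  "unit_ballS s = {x \<in> PiE {..<s} (\<lambda>_. UNIV). (\<Sum>k<s. (x k)\<^sup>2) \<le> 1}"

definition cubeS :: "nat \<Rightarrow> (nat \<Rightarrow> real) set" where
  "cubeS s = {x \<in> PiE {..<s} (\<lambda>_. UNIV). \<forall>k<s. \<bar>x k\<bar> \<le> 1}"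

text \<open>Regular simplex circumscribed around B^s: intersection of the s+1 half-spaces
  <u_i, x> \<le> 1, where u_0..u_s are unit vectors with pairwise inner products -1/s
  (the outer facet normals of a regular simplex).\<close>
definition regular_simplex_normals :: "nat \<Rightarrow> (nat \<Rightarrow> nat \<Rightarrow> real) \<Rightarrow> bool" where
  "regular_simplex_normals s u \<longleftrightarrow>
     (\<forall>i\<le>s. \<forall>j\<le>s. (\<Sum>k<s. u i k * u j k) = (if i = j then 1 else - 1 / real s))"

definition simplexS :: "nat \<Rightarrow> (nat \<Rightarrow> real) set" where
  "simplexS s = (let u = (SOME u. regular_simplex_normals s u) in
     {x \<in> PiE {..<s} (\<lambda>_. UNIV). \<forall>i\<le>s. (\<Sum>k<s. u i k * x k) \<le> 1})"

end

theory Submission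
  imports Defs "HOL-Probability.Probability"
begin

text \<open>After a linear map the ellipsoid is the unit ball and \<open>F\<close> is a coordinate subspace. Maximality
  among the ellipsoids of revolution forces a John type decomposition: contact unit vectors \<open>u\<close> and
  weights \<open>\<mu>\<close> of total mass \<open>d\<close> with \<open>\<Sum>\<mu> u = 0\<close>, whose \<open>F\<close>-parts resolve the identity of \<open>F\<close> while the
  orthogonal parts have total squared length \<open>d - s\<close>. Testing points of the body against these vectors gives
  the inclusions and the inradius bounds. The volume bounds are Ball's: the section lies in the polytope
  \<open>{x. \<forall>u. \<langle>v\<^sub>u, x\<rangle> \<le> 1}\<close>, \<open>v\<^sub>u\<close> the \<open>F\<close>-part of \<open>u\<close>, and the rank one Brascamp--Lieb inequality bounds its
  volume, directly in the symmetric case and through a cone in dimension \<open>s + 1\<close> otherwise. As the \<open>v\<^sub>u\<close>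
  are not unit vectors, in the second case the exponential densities on the cone need scales that depend
  on \<open>u\<close>.\<close>

section \<open>Determinants of frame operators\<close>

text \<open>The obstacle is (2). For the \<open>F\<close>-part \<open>v\<close> of a contact vector
  put \<open>t = d * |v|^2\<close>. The decomposition fixes the mean of \<open>t\<close>, not its
  values, so the lift of \<open>v\<close> has squared length \<open>(1 + t) / d\<close>, which
  depends on \<open>u\<close>. With scales equal to these lengths (\<open>b = 1\<close>) the
  Brascamp--Lieb bound costs the mean of \<open>(1 + t) ln (1 + t)\<close>. If every contact vector
  lies in \<open>F\<close> or in its orthogonal complement, then \<open>t\<close> is
  \<open>d\<close> or \<open>0\<close> and that mean is \<open>s * gfun d\<close>, which exceeds
  what (2) permits by \<open>s * (gfun d - gfun s) / (d + 1)\<close>. Tilting the scales by weights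
  \<open>b\<close> that respect the two linear conditions recovers this excess, and it has to do so
  for every distribution of \<open>t\<close> that can occur. The bound obtained contains
  \<open>(s + 1) / (d + 1) * ln (s + 1)\<close>. Half of it, set against the half power of
  \<open>s + 1\<close> left over from the volume of the regular simplex, is the origin of the factor
  \<open>(s + 1) powr ...\<close> in (2).\<close>

lemma selfadjoint_eigenvector_exists:
  fixes f :: "'a::euclidean_space \<Rightarrow> 'a"
  assumes "linear f" and sym: "\<And>x y. f x \<bullet> y = x \<bullet> f y"
    and V: "subspace V" "f ` V \<subseteq> V" "V \<noteq> {0}"
  obtains x a where "x \<in> V" "norm x = 1" "f x = a *\<^sub>R x"
proof -
  interpret linear f by fact
  let ?S = "V \<inter> sphere 0 1"
  obtain v where v: "v \<in> V" "v \<noteq> 0" using V(1,3) subspace_0 by blast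
  have "(inverse (norm v)) *\<^sub>R v \<in> ?S"
    using v V(1) by (simp add: subspace_scale)
  then have ne: "?S \<noteq> {}" by blast
  have comp: "compact ?S"
    using closed_subspace[OF V(1)] compact_sphere by blast
  have "continuous_on ?S (\<lambda>x. f x \<bullet> x)"
    by (intro continuous_intros linear_continuous_on linear_conv_bounded_linear[THEN iffD1] \<open>linear f\<close>)
  then obtain x where x: "x \<in> ?S" and max: "\<And>y. y \<in> ?S \<Longrightarrow> f y \<bullet> y \<le> f x \<bullet> x"
    using continuous_attains_sup[OF comp ne] by blast
  define a where "a = f x \<bullet> x"
  have xx: "x \<bullet> x = 1" "x \<in> V" using x by (auto simp: norm_eq_1)
  have le: "f y \<bullet> y \<le> a * (y \<bullet> y)" if "y \<in> V" for y
  proof (cases "y = 0")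
    case True then show ?thesis by simp
  next
    case False
    let ?z = "(1 / norm y) *\<^sub>R y"
    have "?z \<in> ?S" using that False V(1) by (simp add: subspace_scale)
    from max[OF this] have "(f y \<bullet> y) / (norm y)^2 \<le> a"
      by (simp add: a_def scale power2_eq_square)
    then show ?thesis using False by (simp add: field_simps power2_norm_eq_inner)
  qed
  \<comment> \<open>First variation at the maximiser \<open>x\<close> of the Rayleigh quotient: a
    move along \<open>y\<close> changes the form by \<open>2 t c\<close> to first order.
    \<open>C\<close> dominates the second-order coefficient, and \<open>t = c / C\<close> lets the
    linear term win unless \<open>c = 0\<close>.\<close>
  have orth: "f x \<bullet> y = 0" if y: "y \<in> V" "x \<bullet> y = 0" for y
  proof (rule ccontr)
    assume "f x \<bullet> y \<noteq> 0"
    define c where "c = f x \<bullet> y"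
    define C where "C = \<bar>a * (y \<bullet> y) - f y \<bullet> y\<bar> + 1"
    define t where "t = c / C"
    have C: "C > 0" "a * (y \<bullet> y) - f y \<bullet> y < C" by (auto simp: C_def)
    have "x + t *\<^sub>R y \<in> V" using V(1) xx(2) y(1) by (simp add: subspace_add subspace_scale)
    from le[OF this]
    moreover have "f (x + t *\<^sub>R y) \<bullet> (x + t *\<^sub>R y) = a + 2 * t * c + t^2 * (f y \<bullet> y)"
    proof -
      have "f y \<bullet> x = c" using sym[of y x] by (simp add: c_def inner_commute)
      then show ?thesis
        by (simp add: add scale inner_add_left inner_add_right a_def[symmetric] c_def[symmetric]
            power2_eq_square algebra_simps)
    qed
    moreover have "(x + t *\<^sub>R y) \<bullet> (x + t *\<^sub>R y) = 1 + t^2 * (y \<bullet> y)"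
      using xx y(2) by (simp add: inner_add_left inner_add_right inner_commute power2_eq_square)
    ultimately have "a + 2 * t * c + t^2 * (f y \<bullet> y) \<le> a * (1 + t^2 * (y \<bullet> y))" by simp
    then have "2 * t * c \<le> t^2 * (a * (y \<bullet> y) - f y \<bullet> y)" by (simp add: algebra_simps)
    also have "\<dots> \<le> t^2 * C" using C by (intro mult_left_mono) auto
    also have "\<dots> = t * c" using C by (simp add: t_def power2_eq_square)
    finally have "t * c \<le> 0" by (simp add: mult.commute)
    moreover have "t * c > 0" using C \<open>f x \<bullet> y \<noteq> 0\<close> by (auto simp: t_def c_def[symmetric] zero_less_mult_iff zero_less_divide_iff linorder_neq_iff)
    ultimately show False by simp
  qed
  define w where "w = f x - a *\<^sub>R x"
  have "w \<in> V" using V xx(2) by (auto simp: w_def intro!: subspace_diff subspace_scale)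
  moreover have xw: "x \<bullet> w = 0" using xx by (simp add: w_def inner_diff_right a_def inner_commute)
  ultimately have "f x \<bullet> w = 0" using orth by blast
  then have "w \<bullet> w = 0" using xw by (simp add: w_def inner_diff_left inner_commute inner_diff_right)
  then have "f x = a *\<^sub>R x" by (simp add: w_def)
  with that xx show ?thesis by (metis norm_eq_1)
qed

text \<open>Phrased for an invariant subspace so that the induction can pass to the orthogonal
  complement of an eigenvector inside \<open>V\<close>, which is again invariant by
  symmetry.\<close>

lemma selfadjoint_eigenbasis:
  fixes f :: "'a::euclidean_space \<Rightarrow> 'a"
  assumes "linear f" and sym: "\<And>x y. f x \<bullet> y = x \<bullet> f y"
    and "subspace V" "f ` V \<subseteq> V"
  shows "\<exists>B. B \<subseteq> V \<and> pairwise orthogonal B \<and> (\<forall>x\<in>B. norm x = 1 \<and> (\<exists>a. f x = a *\<^sub>R x)) \<and> span B = V"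
  using assms(3,4)
proof (induction "dim V" arbitrary: V rule: less_induct)
  case less
  interpret linear f by fact
  show ?case
  proof (cases "V = {0}")
    case True then show ?thesis by (intro exI[of _ "{}"]) auto
  next
    case False
    obtain x a where x: "x \<in> V" "norm x = 1" "f x = a *\<^sub>R x"
      using selfadjoint_eigenvector_exists[OF \<open>linear f\<close> sym less.prems False] by blast
    have xx: "x \<bullet> x = 1" using x(2) by (simp add: norm_eq_1)
    define W where "W = {y \<in> V. x \<bullet> y = 0}"
    have W: "subspace W" "W \<subseteq> V" using less.prems(1)
      by (auto simp: W_def subspace_def inner_add_right)
    have "x \<notin> W" using xx by (simp add: W_def)
    then have "W \<subset> V" using W(2) x(1) by blast
    then have "dim W < dim V"
      by (metis W(1) dim_psubset less.prems(1) span_eq_iff)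
    moreover have "f ` W \<subseteq> W" using less.prems(2) x(3) sym[of x]
      by (auto simp: W_def) (metis inner_scaleR_left mult_zero_right)
    ultimately obtain B where B: "B \<subseteq> W" "pairwise orthogonal B"
      "\<forall>x\<in>B. norm x = 1 \<and> (\<exists>a. f x = a *\<^sub>R x)" "span B = W"
      using less.hyps[of W] W(1) by blast
    have "span (insert x B) = V"
    proof
      show "span (insert x B) \<subseteq> V"
        using B(1) W(2) x(1) less.prems(1) by (intro span_minimal) auto
      show "V \<subseteq> span (insert x B)"
      proof
        fix v assume v: "v \<in> V"
        have "v - (x \<bullet> v) *\<^sub>R x \<in> W"
          using v x(1) less.prems(1) xx by (auto simp: W_def inner_diff_right intro!: subspace_diff subspace_scale)
        then show "v \<in> span (insert x B)" using B(4) by (auto simp: span_insert)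
      qed
    qed
    moreover have "pairwise orthogonal (insert x B)"
      using B(1,2) by (auto simp: pairwise_insert W_def orthogonal_def inner_commute)
    ultimately show ?thesis
      using B x W(2) by (intro exI[of _ "insert x B"]) auto
  qed
qed

lemma symmetric_matrix_eigenbasis:
  fixes m :: "real^'n^'n"
  assumes sym: "transpose m = m"
  obtains f :: "'n \<Rightarrow> real^'n" and a :: "'n \<Rightarrow> real" where
    "\<And>i j. f i \<bullet> f j = (if i = j then 1 else 0)" "\<And>i. m *v f i = a i *\<^sub>R f i"
    "det m = (\<Prod>i\<in>UNIV. a i)" "trace m = (\<Sum>i\<in>UNIV. a i)"
    "\<And>x. (\<Sum>i\<in>UNIV. (x \<bullet> f i)^2) = x \<bullet> x"
proof -
  have mvt: "m *v x = x v* m" for x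
    using transpose_matrix_vector[of m x] sym by simp
  have adj: "(m *v x) \<bullet> y = x \<bullet> (m *v y)" for x y
    unfolding mvt[of x] by (rule dot_lmul_matrix)
  obtain B where B: "pairwise orthogonal B" "\<forall>x\<in>B. norm x = 1 \<and> (\<exists>a. m *v x = a *\<^sub>R x)" "span B = UNIV"
    using selfadjoint_eigenbasis[of "(*v) m" UNIV] adj by auto
  have "0 \<notin> B" using B(2) by force
  then have ind: "independent B" using B(1) pairwise_orthogonal_independent by blast
  then have "finite B" by (rule independent_imp_finite)
  have "dim (span B) = card B" using ind by (simp add: dim_eq_card_independent)
  then have card: "card B = CARD('n)" using B(3) by simp
  then obtain f where f: "bij_betw f (UNIV::'n set) B"
    using finite_same_card_bij[of "UNIV::'n set" B] \<open>finite B\<close> by auto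
  have fB: "f i \<in> B" for i using f by (auto simp: bij_betw_def)
  have on: "f i \<bullet> f j = (if i = j then 1 else 0)" for i j
  proof (cases "i = j")
    case True then show ?thesis using B(2) fB[of j] by (auto simp: norm_eq_1)
  next
    case False
    then have "f i \<noteq> f j" using f by (auto simp: bij_betw_def inj_on_def)
    then show ?thesis using B(1) fB[of i] fB[of j] False by (auto simp: pairwise_def orthogonal_def)
  qed
  have "\<forall>i. \<exists>c. m *v f i = c *\<^sub>R f i" using B(2) fB by blast
  then obtain a where a: "\<And>i. m *v f i = a i *\<^sub>R f i" using choice[of "\<lambda>i c. m *v f i = c *\<^sub>R f i"] by blast
  define O' :: "real^'n^'n" where "O' = (\<chi> i j. f i $ j)"
  have row: "row i O' = f i" for i by (simp add: row_def O'_def vec_eq_iff)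
  have "orthogonal_matrix O'"
    unfolding orthogonal_matrix_orthonormal_rows row using on by (auto simp: norm_eq_1 orthogonal_def)
  then have O1: "transpose O' ** O' = mat 1" "O' ** transpose O' = mat 1"
    by (auto simp: orthogonal_matrix_def)
  define D :: "real^'n^'n" where "D = (\<chi> i j. if i = j then a i else 0)"
  have D: "O' ** m ** transpose O' = D"
  proof -
    have "(O' ** m ** transpose O') $ i $ j = f i \<bullet> (m *v f j)" for i j
    proof -
      have "(O' ** m ** transpose O') $ i $ j = (\<Sum>l\<in>UNIV. (\<Sum>k\<in>UNIV. f i $ k * m $ k $ l) * f j $ l)"
        by (simp add: matrix_matrix_mult_def O'_def transpose_def)
      also have "\<dots> = (\<Sum>k\<in>UNIV. \<Sum>l\<in>UNIV. f i $ k * m $ k $ l * f j $ l)"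
        unfolding sum_distrib_right by (rule sum.swap)
      also have "\<dots> = f i \<bullet> (m *v f j)"
        by (simp add: inner_vec_def matrix_vector_mult_def sum_distrib_left mult.assoc)
      finally show ?thesis .
    qed
    then show ?thesis by (auto simp: vec_eq_iff a on D_def)
  qed
  have "det D = (\<Prod>i\<in>UNIV. a i)"
    by (subst det_diagonal) (auto simp: D_def)
  moreover have "det D = det m"
  proof -
    have "det (O' ** transpose O') = 1" using O1(2) by simp
    then have "det O' * det (transpose O') = 1" by (simp add: det_mul)
    then show ?thesis unfolding D[symmetric] det_mul by (simp add: algebra_simps)
  qed
  moreover have "trace D = (\<Sum>i\<in>UNIV. a i)" by (simp add: trace_def D_def)
  moreover have "trace D = trace m"
    unfolding D[symmetric] by (subst trace_mul_sym) (simp add: matrix_mul_assoc O1)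
  moreover have "(\<Sum>i\<in>UNIV. (x \<bullet> f i)^2) = x \<bullet> x" for x
  proof -
    have "O' *v x = (\<chi> i. x \<bullet> f i)"
      by (simp add: vec_eq_iff matrix_vector_mult_def O'_def inner_vec_def mult.commute)
    moreover have "(O' *v x) \<bullet> (O' *v x) = x \<bullet> x"
    proof -
      have "((O' *v x) v* O') \<bullet> x = (O' *v x) \<bullet> (O' *v x)" by (rule dot_lmul_matrix)
      moreover have "(O' *v x) v* O' = transpose O' *v (O' *v x)" by simp
      moreover have "transpose O' *v (O' *v x) = x"
        unfolding matrix_vector_mul_assoc O1(1) by simp
      ultimately show ?thesis by metis
    qed
    ultimately show ?thesis by (simp add: inner_vec_def power2_eq_square)
  qed
  ultimately show ?thesis using that[of f a, OF on a] by simp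
qed

text \<open>AM-GM for the eigenvalues in the form \<open>a \<le> exp (a - 1)\<close>, whose
  exponents add up to zero. For a trace-free perturbation of the identity this bounds the
  determinant without any error term.\<close>

lemma det_le_1_of_trace_le:
  fixes m :: "real^'n^'n"
  assumes sym: "transpose m = m" and pos: "\<And>x. x \<bullet> (m *v x) \<ge> 0" and tr: "trace m = real CARD('n)"
  shows "0 \<le> det m" "det m \<le> 1"
proof -
  obtain f :: "'n \<Rightarrow> real^'n" and a :: "'n \<Rightarrow> real" where f: "\<And>i j. f i \<bullet> f j = (if i = j then 1 else (0::real))" "\<And>i. m *v f i = a i *\<^sub>R f i"
    "det m = (\<Prod>i\<in>UNIV. a i)" "trace m = (\<Sum>i\<in>UNIV. a i)"
    "\<And>x. (\<Sum>i\<in>UNIV. (x \<bullet> f i)^2) = x \<bullet> x"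
    by (rule symmetric_matrix_eigenbasis[OF sym]) (rule that)
  have a: "a i \<ge> 0" for i using pos[of "f i"] f(1,2) by simp
  have "(\<Prod>i\<in>UNIV. a i) \<le> (\<Prod>i\<in>(UNIV::'n set). exp (a i - 1))"
    using a exp_ge_add_one_self by (intro prod_mono) (auto simp: exp_ge_add_one_self[of "_ - 1", simplified])
  also have "\<dots> = exp (\<Sum>i\<in>(UNIV::'n set). a i - 1)" by (simp add: exp_sum)
  also have "\<dots> = 1" using f(4) tr by (simp add: sum_subtractf)
  finally show "det m \<le> 1" using f(3) by simp
  show "0 \<le> det m" using a f(3) by (simp add: prod_nonneg)
qed

text \<open>Jensen for the logarithm: by the frame identity each eigenvalue \<open>a j\<close> is an
  average of the \<open>\<theta> i\<close> with weights \<open>c i * (e i \<bullet> f j)^2\<close>.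
  Summed over the eigenbasis \<open>f\<close>, these weights collapse to \<open>c i\<close>, because
  the \<open>e i\<close> are unit vectors.\<close>

lemma det_frame_operator_ge:
  fixes e :: "'i \<Rightarrow> real^'n" and c \<theta> :: "'i \<Rightarrow> real"
  assumes fin: "finite I" and c: "\<And>i. i \<in> I \<Longrightarrow> c i \<ge> 0" and e: "\<And>i. i \<in> I \<Longrightarrow> norm (e i) = 1"
    and frame: "\<And>x. (\<Sum>i\<in>I. c i * (e i \<bullet> x)^2) = x \<bullet> x"
    and th: "\<And>i. i \<in> I \<Longrightarrow> \<theta> i > 0"
  shows "det (matrix (\<lambda>x. \<Sum>i\<in>I. (c i * \<theta> i * (e i \<bullet> x)) *\<^sub>R e i)) \<ge> (\<Prod>i\<in>I. \<theta> i powr c i)"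
proof -
  define L where "L = (\<lambda>x. \<Sum>i\<in>I. (c i * \<theta> i * (e i \<bullet> x)) *\<^sub>R e i)"
  have lin: "linear L" unfolding L_def
    by (intro linearI) (auto simp: inner_add_right algebra_simps sum.distrib scaleR_sum_right)
  define m where "m = matrix L"
  have mv: "m *v x = L x" for x unfolding m_def using matrix_vector_mul(2)[OF lin] by metis
  have Lxy: "y \<bullet> L x = (\<Sum>i\<in>I. c i * \<theta> i * (e i \<bullet> x) * (e i \<bullet> y))" for x y
    by (simp add: L_def inner_sum_right inner_commute)
  have mij: "m $ i $ j = axis i 1 \<bullet> L (axis j 1)" for i j
    by (simp add: m_def matrix_def inner_axis')
  have sym: "transpose m = m"
    by (simp add: vec_eq_iff transpose_def mij Lxy mult.commute mult.left_commute)
  obtain f :: "'n \<Rightarrow> real^'n" and a :: "'n \<Rightarrow> real" where f: "\<And>i j. f i \<bullet> f j = (if i = j then 1 else (0::real))" "\<And>i. m *v f i = a i *\<^sub>R f i"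
    "det m = (\<Prod>i\<in>UNIV. a i)" "\<And>x. (\<Sum>i\<in>UNIV. (x \<bullet> f i)^2) = x \<bullet> x"
    by (rule symmetric_matrix_eigenbasis[OF sym]) (rule that)
  have a: "a j = (\<Sum>i\<in>I. (c i * (e i \<bullet> f j)^2) * \<theta> i)" for j
  proof -
    have "a j = f j \<bullet> (m *v f j)" using f(1,2) by simp
    also have "\<dots> = (\<Sum>i\<in>I. (c i * (e i \<bullet> f j)^2) * \<theta> i)"
      unfolding mv Lxy by (simp add: power2_eq_square algebra_simps)
    finally show ?thesis .
  qed
  have w1: "(\<Sum>i\<in>I. c i * (e i \<bullet> f j)^2) = 1" for j using frame[of "f j"] f(1) by simp
  have apos: "a j > 0" for j
  proof -
    have "a j \<ge> 0" unfolding a using c th by (intro sum_nonneg) (auto simp: less_imp_le)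
    moreover have "a j \<noteq> 0"
    proof
      assume "a j = 0"
      then have "\<forall>i\<in>I. (c i * (e i \<bullet> f j)^2) * \<theta> i = 0" unfolding a
        using c th fin by (subst (asm) sum_nonneg_eq_0_iff) (auto simp: less_imp_le)
      then have "\<forall>i\<in>I. c i * (e i \<bullet> f j)^2 = 0" using th by fastforce
      then have "(\<Sum>i\<in>I. c i * (e i \<bullet> f j)^2) = 0" by (intro sum.neutral) auto
      then show False using w1[of j] by simp
    qed
    ultimately show ?thesis by simp
  qed
  have ln_a: "(\<Sum>i\<in>I. (c i * (e i \<bullet> f j)^2) * ln (\<theta> i)) \<le> ln (a j)" for j
  proof -
    have "(\<Sum>i\<in>I. (c i * (e i \<bullet> f j)^2) * (ln (\<theta> i) - ln (a j)))
        \<le> (\<Sum>i\<in>I. (c i * (e i \<bullet> f j)^2) * (\<theta> i / a j - 1))"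
    proof (intro sum_mono mult_left_mono)
      fix i assume "i \<in> I"
      show "ln (\<theta> i) - ln (a j) \<le> \<theta> i / a j - 1"
        using ln_le_minus_one[of "\<theta> i / a j"] th[OF \<open>i \<in> I\<close>] apos[of j] by (simp add: ln_div)
      show "0 \<le> c i * (e i \<bullet> f j)\<^sup>2" using c[OF \<open>i \<in> I\<close>] by simp
    qed
    also have "\<dots> = (\<Sum>i\<in>I. (c i * (e i \<bullet> f j)^2) * \<theta> i) / a j - 1"
      using w1[of j] by (simp add: right_diff_distrib sum_subtractf sum_divide_distrib)
    also have "\<dots> = 0" using a[of j] apos[of j] by simp
    finally have "(\<Sum>i\<in>I. (c i * (e i \<bullet> f j)^2) * ln (\<theta> i)) \<le> (\<Sum>i\<in>I. (c i * (e i \<bullet> f j)^2)) * ln (a j)"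
      by (simp add: right_diff_distrib sum_subtractf sum_distrib_right)
    then show ?thesis using w1 by simp
  qed
  have "(\<Sum>i\<in>I. c i * ln (\<theta> i)) = (\<Sum>i\<in>I. \<Sum>j\<in>UNIV. (c i * (e i \<bullet> f j)^2) * ln (\<theta> i))"
  proof (rule sum.cong[OF refl])
    fix i assume "i \<in> I"
    then have "(\<Sum>j\<in>UNIV. (e i \<bullet> f j)^2) = 1" using f(4)[of "e i"] e by (simp add: norm_eq_1)
    moreover have "(\<Sum>j\<in>UNIV. c i * (e i \<bullet> f j)\<^sup>2 * ln (\<theta> i)) = (c i * ln (\<theta> i)) * (\<Sum>j\<in>UNIV. (e i \<bullet> f j)^2)"
      unfolding sum_distrib_left by (intro sum.cong) auto
    ultimately show "c i * ln (\<theta> i) = (\<Sum>j\<in>UNIV. c i * (e i \<bullet> f j)\<^sup>2 * ln (\<theta> i))" by simp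
  qed
  also have "\<dots> = (\<Sum>j\<in>UNIV. \<Sum>i\<in>I. (c i * (e i \<bullet> f j)^2) * ln (\<theta> i))" by (rule sum.swap)
  also have "\<dots> \<le> (\<Sum>j\<in>UNIV. ln (a j))" by (intro sum_mono ln_a)
  also have "\<dots> = ln (det m)" using apos ln_prod[of UNIV a] by (simp add: f(3) less_imp_neq[symmetric])
  finally have le: "(\<Sum>i\<in>I. c i * ln (\<theta> i)) \<le> ln (det m)" .
  have "det m > 0" using apos by (simp add: f(3) prod_pos)
  have "(\<Prod>i\<in>I. \<theta> i powr c i) = exp (\<Sum>i\<in>I. c i * ln (\<theta> i))"
    unfolding exp_sum[OF fin] using th by (intro prod.cong) (auto simp: powr_def less_imp_neq[symmetric])
  also have "\<dots> \<le> det m" using le \<open>det m > 0\<close> by (metis exp_le_cancel_iff exp_ln)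
  finally show ?thesis unfolding m_def L_def .
qed

section \<open>An index type for coordinates\<close>

text \<open>The change-of-variables theorems are stated for vectors indexed by a finite well-ordered type;
  this index type makes them available in the dimension of an arbitrary Euclidean space.\<close>

typedef (overloaded) ('a::euclidean_space) bidx = "{..<DIM('a)}"
  by (rule exI[of _ 0]) simp

instantiation bidx :: (euclidean_space) linorder
begin
definition less_eq_bidx :: "'a bidx \<Rightarrow> 'a bidx \<Rightarrow> bool" where
  "less_eq_bidx x y \<longleftrightarrow> Rep_bidx x \<le> Rep_bidx y"
definition less_bidx :: "'a bidx \<Rightarrow> 'a bidx \<Rightarrow> bool" where
  "less_bidx x y \<longleftrightarrow> Rep_bidx x < Rep_bidx y"
instance
  by standard (auto simp: less_eq_bidx_def less_bidx_def Rep_bidx_inject)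
end

instance bidx :: (euclidean_space) wellorder
proof
  fix P :: "'a bidx \<Rightarrow> bool" and a
  assume step: "\<And>x. (\<And>y. y < x \<Longrightarrow> P y) \<Longrightarrow> P x"
  show "P a"
    by (induction a rule: measure_induct_rule[of Rep_bidx]) (auto intro: step simp: less_bidx_def)
qed

lemma bij_betw_Abs_bidx: "bij_betw Abs_bidx {..<DIM('a)} (UNIV :: 'a::euclidean_space bidx set)"
  by (rule bij_betwI[where g = Rep_bidx])
    (use Rep_bidx Rep_bidx_inverse Abs_bidx_inverse in auto)

instance bidx :: (euclidean_space) finite
proof
  show "finite (UNIV :: 'a bidx set)"
    using bij_betw_Abs_bidx bij_betw_finite by blast
qed

lemma card_bidx: "CARD('a::euclidean_space bidx) = DIM('a)"
  using bij_betw_same_card[OF bij_betw_Abs_bidx[where 'a = 'a]] by simp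

section \<open>Scales for the exponential densities\<close>

text \<open>The squares of the two sides differ by the square of
  \<open>v^3 - 2 * v^2 + 2 * v - 2\<close>. It serves the range \<open>t > s\<close> of
  \<open>gfun_pointwise\<close>, with \<open>v = sqrt (N - s)\<close>.\<close>

lemma quadratic_sqrt_ineq:
  fixes v :: real assumes "v \<ge> 0"
  shows "v^2 \<le> (v^2 - 2 * v + 2) * sqrt (1 + v^2)"
proof -
  have "(v^2)^2 \<le> ((v^2 - 2 * v + 2) * sqrt (1 + v^2))^2"
  proof -
    have "((v^2 - 2 * v + 2) * sqrt (1 + v^2))^2 = (v^2 - 2 * v + 2)^2 * (1 + v^2)"
      by (simp add: power_mult_distrib)
    also have "\<dots> = (v^2)^2 + (v^3 - 2 * v^2 + 2 * v - 2)^2"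
      by algebra
    finally show ?thesis by simp
  qed
  moreover have "v^2 - 2 * v + 2 = (v - 1)^2 + 1" by (simp add: power2_eq_square algebra_simps)
  then have "0 \<le> v^2 - 2 * v + 2" by (metis add_nonneg_nonneg zero_le_one zero_le_power2)
  then have "0 \<le> (v^2 - 2 * v + 2) * sqrt (1 + v^2)" by simp
  ultimately show ?thesis by (metis power2_le_imp_le)
qed

text \<open>The entropy \<open>(1 + t) ln (1 + t)\<close> is \<open>t * gfun t\<close>. The total weight of \<open>t\<close> being prescribed, what has to
  be estimated is the defect \<open>t * (gfun N - gfun t)\<close>.\<close>

definition gfun :: "real \<Rightarrow> real" where "gfun t = (1 + 1 / t) * ln (1 + t)"

definition gfun' :: "real \<Rightarrow> real" where "gfun' t = (t - ln (1 + t)) / t^2"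

lemma gfun_mult: "t \<noteq> 0 \<Longrightarrow> t * gfun t = (1 + t) * ln (1 + t)"
  by (simp add: gfun_def field_simps)

lemma gfun_deriv: "t > 0 \<Longrightarrow> (gfun has_real_derivative gfun' t) (at t)"
  unfolding gfun_def gfun'_def
  by (rule derivative_eq_intros refl | simp add: add_pos_pos)+ (simp add: divide_simps power2_eq_square, algebra)

lemma ln_add_one_ge_Pade:
  fixes x :: real assumes "x \<ge> 0" shows "2 * x / (x + 2) \<le> ln (1 + x)"
proof -
  have "ln (1 + 0) - 2 * 0 / (0 + 2) \<le> ln (1 + x) - 2 * x / (x + 2)"
  proof (rule DERIV_nonneg_imp_nondecreasing[OF assms], intro exI conjI)
    fix y :: real assume y: "0 \<le> y" "y \<le> x"
    show "((\<lambda>x. ln (1 + x) - 2 * x / (x + 2)) has_real_derivative (1 / (1 + y) - 4 / (y + 2)^2)) (at y)"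
      using y by (auto intro!: derivative_eq_intros) (simp add: divide_simps power2_eq_square)
    have "4 * (1 + y) \<le> (y + 2)^2" using y by (simp add: power2_eq_square algebra_simps)
    then show "0 \<le> 1 / (1 + y) - 4 / (y + 2)^2" using y by (simp add: field_simps)
  qed
  then show ?thesis by simp
qed

text \<open>The derivative of the difference is \<open>y * (1 + 2 * y) / (1 + y)\<close>; from
  \<open>- 1 / 2\<close>, its other zero, onwards it changes sign only at \<open>0\<close>. The
  bound will be applied to the logarithm of the weights \<open>b\<close>.\<close>

lemma ln_one_plus_ge_quadratic:
  fixes x :: real assumes "x \<ge> - 1 / 2" shows "x - x^2 \<le> ln (1 + x)"
proof -
  let ?f = "\<lambda>x::real. ln (1 + x) - x + x^2"
  have der: "(?f has_real_derivative (y * (1 + 2 * y) / (1 + y))) (at y)" if "y \<ge> - 1 / 2" for y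
    using that by (auto intro!: derivative_eq_intros) (simp add: divide_simps power2_eq_square, algebra)
  have "?f 0 \<le> ?f x"
  proof (cases "x \<ge> 0")
    case True
    show ?thesis
    proof (rule DERIV_nonneg_imp_nondecreasing[OF True], intro exI conjI)
      fix y assume y: "0 \<le> y" "y \<le> x"
      show "(?f has_real_derivative (y * (1 + 2 * y) / (1 + y))) (at y)" using y by (intro der) simp
      show "0 \<le> y * (1 + 2 * y) / (1 + y)" using y by simp
    qed
  next
    case False
    show ?thesis
    proof (rule DERIV_nonpos_imp_nonincreasing[of x 0], use False in simp, intro exI conjI)
      fix y assume y: "x \<le> y" "y \<le> 0"
      show "(?f has_real_derivative (y * (1 + 2 * y) / (1 + y))) (at y)" using y assms by (intro der) simp
      show "y * (1 + 2 * y) / (1 + y) \<le> 0" using y assms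
        by (intro divide_nonpos_pos mult_nonpos_nonneg) auto
    qed
  qed
  then show ?thesis by simp
qed

lemma gfun'_nonneg: "t > 0 \<Longrightarrow> gfun' t \<ge> 0"
  using ln_add_one_self_le_self[of t] by (simp add: gfun'_def)

lemma gfun'_le: "t > 0 \<Longrightarrow> gfun' t \<le> 1 / (t + 2)"
proof -
  assume t: "t > 0"
  have "t - ln (1 + t) \<le> t - 2 * t / (t + 2)" using ln_add_one_ge_Pade[of t] t by simp
  also have "\<dots> = t^2 / (t + 2)" using t by (simp add: field_simps power2_eq_square)
  finally show ?thesis using t by (simp add: gfun'_def field_simps)
qed

text \<open>Concavity of \<open>gfun\<close>. Up to the factor \<open>t^3\<close> the second
  derivative is \<open>?h\<close>, which vanishes at \<open>0\<close> and decreases.\<close>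

lemma gfun'_antimono: assumes "0 < a" "a \<le> b" shows "gfun' b \<le> gfun' a"
proof (rule DERIV_nonpos_imp_nonincreasing[OF assms(2)], intro exI conjI)
  fix t assume t: "a \<le> t" "t \<le> b"
  let ?h = "\<lambda>t::real. t^2 / (1 + t) - 2 * t + 2 * ln (1 + t)"
  have t0: "t > 0" using t assms by simp
  show "(gfun' has_real_derivative ?h t / t^3) (at t)"
    unfolding gfun'_def using t0
    by (auto intro!: derivative_eq_intros) (simp add: divide_simps power2_eq_square power3_eq_cube, algebra)
  have "?h t \<le> ?h 0"
  proof (rule DERIV_nonpos_imp_nonincreasing[of 0 t], use t0 in simp, intro exI conjI)
    fix y assume y: "0 \<le> y" "y \<le> t"
    show "(?h has_real_derivative (- (y^2) / (1 + y)^2)) (at y)"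
      using y by (auto intro!: derivative_eq_intros) (simp add: divide_simps power2_eq_square, algebra)
    show "- (y^2) / (1 + y)^2 \<le> 0" by simp
  qed
  then show "?h t / t^3 \<le> 0" using t0 by (simp add: divide_nonpos_pos)
qed

lemma gfun_mean_value:
  assumes "0 < a" "a < b"
  obtains z where "a < z" "z < b" "gfun b - gfun a = (b - a) * gfun' z"
  using MVT2[of a b gfun gfun'] assms gfun_deriv by force

lemma gfun_chord_antimono:
  assumes "0 < t" "t \<le> s" "s < N"
  shows "(gfun N - gfun s) / (N - s) \<le> (gfun N - gfun t) / (N - t)"
proof (cases "t = s")
  case False
  then obtain z where z: "t < z" "z < s" "gfun s - gfun t = (s - t) * gfun' z"
    using gfun_mean_value[of t s] assms by auto
  obtain y where y: "s < y" "y < N" "gfun N - gfun s = (N - s) * gfun' y"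
    using gfun_mean_value[of s N] assms by auto
  have le: "gfun' y \<le> gfun' z" using gfun'_antimono[of z y] y z assms by simp
  have "(N - t) * gfun' y = (N - s) * gfun' y + (s - t) * gfun' y" by (simp add: algebra_simps)
  also have "\<dots> \<le> (N - s) * gfun' y + (s - t) * gfun' z"
    using le assms by (intro add_left_mono mult_left_mono) auto
  also have "\<dots> = gfun N - gfun t" using y z by simp
  finally have "gfun' y \<le> (gfun N - gfun t) / (N - t)" using assms by (simp add: field_simps)
  then show ?thesis using y assms by simp
qed simp

lemma gfun_chord_bounds:
  assumes "0 < s" "s < N"
  shows "0 \<le> (gfun N - gfun s) / (N - s)" "(gfun N - gfun s) / (N - s) \<le> 1 / (s + 2)"
proof -
  obtain y where y: "s < y" "y < N" "gfun N - gfun s = (N - s) * gfun' y"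
    using gfun_mean_value[of s N] assms by auto
  then have eq: "(gfun N - gfun s) / (N - s) = gfun' y" using assms by simp
  show "0 \<le> (gfun N - gfun s) / (N - s)" unfolding eq using gfun'_nonneg y assms by simp
  show "(gfun N - gfun s) / (N - s) \<le> 1 / (s + 2)" unfolding eq
    using gfun'_antimono[of s y] gfun'_le[of s] y assms by simp
qed

text \<open>This is the sign condition behind \<open>gfun_chord_sqrt_mono\<close>. Both sides vanish
  at \<open>N = t\<close>. For the derivative in \<open>N\<close>, write \<open>gfun' x\<close> as
  \<open>1 / x\<close> times \<open>1 - ln (1 + x) / x\<close>: the first factor dominates
  \<open>4 * t / (x + t)^2\<close>, and the second increases in \<open>x\<close>.\<close>

lemma gfun_diff_ge:
  assumes "0 < t" "t \<le> N"
  shows "gfun N - gfun t \<ge> 2 * t * (N - t) / (N + t) * gfun' t"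
proof -
  define K where "K = gfun' t"
  let ?f = "\<lambda>x. gfun x - gfun t - 2 * t * (x - t) / (x + t) * K"
  have "?f t \<le> ?f N"
  proof (rule DERIV_nonneg_imp_nondecreasing[OF assms(2)], intro exI conjI)
    fix x assume x: "t \<le> x" "x \<le> N"
    have x0: "x > 0" using x assms by simp
    show "(?f has_real_derivative (gfun' x - 4 * t^2 / (x + t)^2 * K)) (at x)"
      using x0 assms
      by (auto intro!: derivative_eq_intros gfun_deriv) (simp add: divide_simps power2_eq_square, algebra)
    have mono: "1 - ln (1 + t) / t \<le> 1 - ln (1 + x) / x"
    proof (rule DERIV_nonneg_imp_nondecreasing[OF x(1)], intro exI conjI)
      fix y assume y: "t \<le> y" "y \<le> x"
      have y0: "y > 0" using y assms by simp
      show "((\<lambda>x. 1 - ln (1 + x) / x) has_real_derivative (ln (1 + y) - y / (1 + y)) / y^2) (at y)"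
        using y0 by (auto intro!: derivative_eq_intros) (simp add: divide_simps power2_eq_square)
      have "y / (1 + y) \<le> ln (1 + y)"
        using ln_one_minus_pos_lower_bound[of "y / (1 + y)"] ln_ge_iff[of "1 + y"] y0
          ln_le_minus_one[of "1 / (1 + y)"] by (simp add: ln_div field_simps)
      then show "0 \<le> (ln (1 + y) - y / (1 + y)) / y^2" by simp
    qed
    have "4 * t^2 / (x + t)^2 * K = 4 * t / (x + t)^2 * (1 - ln (1 + t) / t)"
    proof -
      have "t^2 * K = t * (1 - ln (1 + t) / t)"
        using assms by (simp add: K_def gfun'_def) (simp add: field_simps)
      then show ?thesis by (simp add: mult.assoc)
    qed
    also have "\<dots> \<le> 1 / x * (1 - ln (1 + t) / t)"
    proof (rule mult_right_mono)
      have "4 * t * x \<le> (x + t)^2" using zero_le_power2[of "x - t"] by (simp add: power2_eq_square algebra_simps)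
      then show "4 * t / (x + t)^2 \<le> 1 / x" using x0 assms by (simp add: field_simps)
      show "0 \<le> 1 - ln (1 + t) / t" using ln_add_one_self_le_self[of t] assms by (simp add: field_simps)
    qed
    also have "\<dots> \<le> 1 / x * (1 - ln (1 + x) / x)"
      using mono x0 by (intro mult_left_mono) auto
    also have "\<dots> = gfun' x" using x0 by (simp add: gfun'_def field_simps power2_eq_square)
    finally show "0 \<le> gfun' x - 4 * t^2 / (x + t)^2 * K" by simp
  qed
  then show ?thesis by (simp add: K_def)
qed

text \<open>By concavity the slope of the chord to \<open>N\<close> falls as its left end moves
  right; the point is that it falls no faster than \<open>1 / sqrt t\<close>. After substituting
  \<open>t = w^2\<close>, the numerator of the derivative is the difference estimated in
  \<open>gfun_diff_ge\<close>.\<close>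

lemma gfun_chord_sqrt_mono:
  assumes "0 < s" "s \<le> t" "t < N"
  shows "(gfun N - gfun s) / (N - s) * sqrt s \<le> (gfun N - gfun t) / (N - t) * sqrt t"
proof -
  let ?f = "\<lambda>w. (gfun N - gfun (w^2)) / (N - w^2) * w"
  have "?f (sqrt s) \<le> ?f (sqrt t)"
  proof (rule DERIV_nonneg_imp_nondecreasing, use assms in simp, intro exI conjI)
    fix w assume w: "sqrt s \<le> w" "w \<le> sqrt t"
    have w0: "w > 0" using w assms by (meson less_le_trans real_sqrt_gt_zero)
    have "w^2 \<le> (sqrt t)^2" using w w0 by (intro power_mono) auto
    then have wN: "w^2 < N" using assms by simp
    let ?D = "((gfun N - gfun (w^2)) * (N + w^2) - 2 * w^2 * (N - w^2) * gfun' (w^2)) / (N - w^2)^2"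
    have "((\<lambda>w. gfun (w^2)) has_real_derivative gfun' (w^2) * (2 * w)) (at w)"
      by (rule DERIV_chain2[OF gfun_deriv]) (use w0 in \<open>auto intro!: derivative_eq_intros\<close>)
    then show "(?f has_real_derivative ?D) (at w)"
      using wN by (auto intro!: derivative_eq_intros) (simp add: divide_simps power2_eq_square, algebra)
    have "gfun N - gfun (w^2) \<ge> 2 * w^2 * (N - w^2) / (N + w^2) * gfun' (w^2)"
      using gfun_diff_ge[of "w^2" N] w0 wN by simp
    moreover have "N + w^2 > 0" using wN w0 by (smt (verit) zero_less_power2)
    ultimately have "2 * w^2 * (N - w^2) * gfun' (w^2) \<le> (gfun N - gfun (w^2)) * (N + w^2)"
      by (simp add: field_simps)
    then show "0 \<le> ?D" by simp
  qed
  then show ?thesis using assms by simp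
qed

text \<open>\<open>\<tau>\<close> linearises the square of the length of \<open>\<Sum>\<rho> |v|\<^sup>2 v\<close>, so that the estimate can be averaged.\<close>

lemma gfun_pointwise:
  fixes s N t \<tau> :: real
  assumes s: "1 \<le> s" "s + 1 \<le> N" and t: "0 \<le> t" "t \<le> N"
    and tau: "0 \<le> \<tau>" "\<tau>^2 \<le> s / (N - s)"
  defines "D \<equiv> (gfun N - gfun s) / (N - s)"
  shows "(N - t) * (D / (N + 1)) * (t + (N - s) * (2 * \<tau> * sqrt t - \<tau>^2)) \<le> t * (gfun N - gfun t)"
proof -
  have D0: "D \<ge> 0" unfolding D_def using gfun_chord_bounds[of s N] s by simp
  have sq: "2 * \<tau> * sqrt t - \<tau>^2 \<le> t"
    using zero_le_power2[of "sqrt t - \<tau>"] t by (simp add: power2_diff mult.commute mult.left_commute)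
  consider "t = 0" | "t = N" | "0 < t" "t \<le> s" | "s < t" "t < N" using t by linarith
  then show ?thesis
  proof cases
    case 1
    have "(N - t) * (D / (N + 1)) * (t + (N - s) * (2 * \<tau> * sqrt t - \<tau>^2)) = - (N * (D / (N + 1)) * ((N - s) * \<tau>^2))"
      using 1 by simp
    also have "\<dots> \<le> 0" using D0 s by simp
    finally show ?thesis using 1 by simp
  next
    case 2 then show ?thesis by simp
  next
    \<comment> \<open>Up to \<open>s\<close> concavity makes the chord to \<open>N\<close> at least
      as steep as \<open>D\<close>, and the crude bound \<open>sq\<close> on the linearised term is
      enough because \<open>1 + N - s \<le> N + 1\<close>.\<close>
    case 3
    have "t + (N - s) * (2 * \<tau> * sqrt t - \<tau>^2) \<le> t + (N - s) * t"
      using sq s by (intro add_left_mono mult_left_mono) auto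
    also have "\<dots> = (1 + N - s) * t" by (simp add: algebra_simps)
    also have "\<dots> \<le> (N + 1) * t" using s t by (intro mult_right_mono) auto
    finally have "(N - t) * (D / (N + 1)) * (t + (N - s) * (2 * \<tau> * sqrt t - \<tau>^2))
        \<le> (N - t) * (D / (N + 1)) * ((N + 1) * t)"
      using D0 s t by (intro mult_left_mono) auto
    also have "\<dots> = t * ((N - t) * D)" using s by (simp add: field_simps)
    also have "(N - t) * D \<le> gfun N - gfun t"
      using gfun_chord_antimono[of t s N] 3 s by (simp add: D_def[symmetric] field_simps)
    finally show ?thesis using t by (simp add: mult_left_mono)
  next
    \<comment> \<open>Beyond \<open>s\<close> the chord slope can drop below \<open>D\<close>, but
      only to \<open>D * sqrt s / sqrt t\<close>, so the bracket has to stay below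
      \<open>(N + 1) * sqrt s * sqrt t\<close>. The bracket grows with \<tau> up to
      \<open>sqrt t\<close>; hence \<tau> is pushed to its largest admissible value \<sigma>, and
      \<open>\<sigma> \<le> sqrt t\<close> holds since \<open>N - s \<ge> 1\<close>.\<close>
    case 4
    define v where "v = sqrt (N - s)"
    define p where "p = sqrt t"
    have v: "v \<ge> 1" "v^2 = N - s" using s by (auto simp: v_def)
    have p: "p^2 = t" "p > 0" "p \<ge> sqrt s" "p \<le> sqrt N" using 4 s by (auto simp: p_def)
    define \<sigma> where "\<sigma> = sqrt s / v"
    have sg: "\<sigma>^2 = s / (N - s)" "v^2 * \<sigma> = v * sqrt s" "v^2 * \<sigma>^2 = s" "0 \<le> \<sigma>"
      using v s by (auto simp: \<sigma>_def power_divide) (simp add: power2_eq_square v(2)[symmetric])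
    have "\<tau> \<le> \<sigma>" using tau sg by (metis power2_le_imp_le)
    moreover have "\<sigma> \<le> p"
    proof -
      have "\<sigma> \<le> sqrt s / 1" unfolding \<sigma>_def using v(1) s by (intro divide_left_mono) auto
      then show ?thesis using p by simp
    qed
    ultimately have "(p - \<sigma>)^2 \<le> (p - \<tau>)^2" by (intro power_mono) auto
    then have "2 * \<tau> * p - \<tau>^2 \<le> 2 * \<sigma> * p - \<sigma>^2" by (simp add: power2_diff mult.commute mult.left_commute)
    then have "t + (N - s) * (2 * \<tau> * p - \<tau>^2) \<le> t + v^2 * (2 * \<sigma> * p - \<sigma>^2)"
      unfolding v(2)[symmetric] by (intro add_left_mono mult_left_mono) auto
    also have "\<dots> = t + 2 * (v^2 * \<sigma>) * p - v^2 * \<sigma>^2" by (simp add: algebra_simps)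
    also have "\<dots> = p * (p - s / p + 2 * (v * sqrt s))"
      unfolding sg(2,3) using p by (simp add: field_simps power2_eq_square)
    also have "\<dots> \<le> p * ((N + 1) * sqrt s)"
    proof (intro mult_left_mono)
      have "p - s / p \<le> sqrt N - s / sqrt N"
        using p s by (intro diff_mono divide_left_mono) auto
      also have "\<dots> = v^2 / sqrt N" using s v by (simp add: field_simps)
      also have "\<dots> \<le> v^2 / sqrt (1 + v^2)"
        using s v by (intro divide_left_mono) (auto intro!: mult_pos_pos add_pos_nonneg)
      also have "\<dots> \<le> v^2 - 2 * v + 2"
      proof -
        have "sqrt (1 + v^2) > 0" by (simp add: add_pos_nonneg)
        then show ?thesis using quadratic_sqrt_ineq[of v] v by (simp add: divide_le_eq)
      qed
      also have "\<dots> \<le> sqrt s * (v^2 - 2 * v + 1 + s)"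
      proof -
        have "0 \<le> (v - 1)^2" by simp
        then have nn: "0 \<le> v^2 - 2 * v + 1" by (simp add: power2_diff)
        have "1 * (v^2 - 2 * v + 2) \<le> sqrt s * (v^2 - 2 * v + 1 + s)"
          using s nn by (intro mult_mono) auto
        then show ?thesis by simp
      qed
      also have "\<dots> = (N + 1) * sqrt s - 2 * (v * sqrt s)" unfolding v(2) by (simp add: algebra_simps)
      finally show "p - s / p + 2 * (v * sqrt s) \<le> (N + 1) * sqrt s" by simp
    qed (use p in simp)
    finally have "(N - t) * (D / (N + 1)) * (t + (N - s) * (2 * \<tau> * sqrt t - \<tau>^2))
       \<le> (N - t) * (D / (N + 1)) * (p * ((N + 1) * sqrt s))"
      using D0 s t by (intro mult_left_mono) (auto simp: p_def)
    also have "\<dots> = p * ((N - t) * (D * sqrt s))" using s by (simp add: field_simps)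
    also have "(N - t) * (D * sqrt s) \<le> (gfun N - gfun t) * p"
      using gfun_chord_sqrt_mono[of s t N] 4 s by (simp add: D_def[symmetric] p_def[symmetric] field_simps)
    finally have "(N - t) * (D / (N + 1)) * (t + (N - s) * (2 * \<tau> * sqrt t - \<tau>^2)) \<le> p * ((gfun N - gfun t) * p)"
      using p by (simp add: mult_left_mono)
    also have "\<dots> = p^2 * (gfun N - gfun t)" by (simp add: power2_eq_square algebra_simps)
    also have "\<dots> = t * (gfun N - gfun t)" unfolding p(1) ..
    finally show ?thesis .
  qed
qed

text \<open>With \<open>t = |v|\<^sup>2\<close>, the weights are \<open>b = 1 + \<eta> j\<close>, where \<open>j\<close> is the part of \<open>t\<close> orthogonal to the
  affine functions of \<open>v\<close>; this keeps the two moment conditions. The gain from \<open>ln b\<close> is proportional to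
  \<open>\<Sum>\<rho> j\<^sup>2\<close>, exactly what the entropy estimate lacks.\<close>

lemma isotropic_weights_exist:
  fixes v :: "'i \<Rightarrow> 'b::real_inner" and \<rho> :: "'i \<Rightarrow> real" and s N :: real
  assumes fin: "finite U" and rho: "\<And>i. i \<in> U \<Longrightarrow> 0 \<le> \<rho> i" "(\<Sum>i\<in>U. \<rho> i) = 1"
    and V: "subspace V" "\<And>i. i \<in> U \<Longrightarrow> v i \<in> V"
    and mean: "(\<Sum>i\<in>U. \<rho> i *\<^sub>R v i) = 0"
    and iso: "\<And>y. y \<in> V \<Longrightarrow> (\<Sum>i\<in>U. \<rho> i * (v i \<bullet> y)^2) = y \<bullet> y"
    and tr: "(\<Sum>i\<in>U. \<rho> i * (norm (v i))^2) = s"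
    and le: "\<And>i. i \<in> U \<Longrightarrow> (norm (v i))^2 \<le> N"
    and s: "1 \<le> s" "s + 1 \<le> N"
  obtains b :: "'i \<Rightarrow> real" where "\<And>i. i \<in> U \<Longrightarrow> b i > 0" "(\<Sum>i\<in>U. \<rho> i * b i) = 1"
    "(\<Sum>i\<in>U. (\<rho> i * b i) *\<^sub>R v i) = 0"
    "(\<Sum>i\<in>U. \<rho> i * ((1 + (norm (v i))^2) * ln (1 + (norm (v i))^2)))
       - 2 * (\<Sum>i\<in>U. \<rho> i * ((1 + (norm (v i))^2) * ln (b i)))
     \<le> s * ln (N + 1) + (s + 1) / (N + 1) * ln (s + 1)"
proof -
  define E where "E = (\<lambda>f. \<Sum>i\<in>U. \<rho> i * f i)"
  have E_add: "E (\<lambda>i. f i + g i) = E f + E g" for f g by (simp add: E_def algebra_simps sum.distrib)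
  have E_diff: "E (\<lambda>i. f i - g i) = E f - E g" for f g by (simp add: E_def algebra_simps sum_subtractf)
  have E_cmult: "E (\<lambda>i. c * f i) = c * E f" for f c by (simp add: E_def sum_distrib_left algebra_simps)
  have E_const: "E (\<lambda>i. c) = c" for c using rho(2) by (simp add: E_def sum_distrib_right[symmetric])
  have E_mono: "E f \<le> E g" if "\<And>i. i \<in> U \<Longrightarrow> f i \<le> g i" for f g
    unfolding E_def using that rho by (intro sum_mono mult_left_mono) auto
  have E_inner: "E (\<lambda>i. y \<bullet> v i) = 0" for y
  proof -
    have "E (\<lambda>i. y \<bullet> v i) = y \<bullet> (\<Sum>i\<in>U. \<rho> i *\<^sub>R v i)" by (simp add: E_def inner_sum_right)
    then show ?thesis using mean by simp
  qed
  define t where "t = (\<lambda>i. (norm (v i))^2)"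
  have t: "0 \<le> t i" "i \<in> U \<Longrightarrow> t i \<le> N" for i using le by (auto simp: t_def)
  have Et: "E t = s" using tr by (simp add: E_def t_def)
  \<comment> \<open>By isotropy \<open>y0 \<bullet> v i\<close> is the orthogonal projection of
    \<open>t\<close> to the linear functions of \<open>v\<close>; its mean square is
    \<open>y^2\<close>.\<close>
  define y0 where "y0 = (\<Sum>i\<in>U. (\<rho> i * t i) *\<^sub>R v i)"
  define y where "y = norm y0"
  have y0V: "y0 \<in> V" unfolding y0_def using V by (intro subspace_sum subspace_scale) auto
  have yy: "y0 \<bullet> y0 = y^2" by (simp add: y_def power2_norm_eq_inner)
  have Ety: "E (\<lambda>i. t i * (z \<bullet> v i)) = z \<bullet> y0" for z by (simp add: E_def y0_def inner_sum_right mult.assoc)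
  have iso': "E (\<lambda>i. (z \<bullet> v i)^2) = z \<bullet> z" if "z \<in> V" for z
    using iso[OF that] by (simp add: E_def inner_commute)
  have Ey2: "E (\<lambda>i. (y0 \<bullet> v i)^2) = y^2" using iso'[OF y0V] yy by simp
  define Q where "Q = E (\<lambda>i. (t i)^2)"
  define j where "j = (\<lambda>i. t i - s - y0 \<bullet> v i)"
  have Ej: "E j = 0" unfolding j_def E_diff E_const E_inner Et by simp
  have Etj: "E (\<lambda>i. t i * j i) = Q - s^2 - y^2"
  proof -
    have "E (\<lambda>i. t i * j i) = E (\<lambda>i. ((t i)^2 - s * t i) - t i * (y0 \<bullet> v i))"
      by (simp add: j_def algebra_simps power2_eq_square)
    then show ?thesis unfolding E_diff E_cmult Et Ety Q_def[symmetric] yy by (simp add: power2_eq_square)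
  qed
  define J where "J = Q - s^2 - y^2"
  have Ejj: "E (\<lambda>i. (j i)^2) = J"
  proof -
    have "E (\<lambda>i. (y0 \<bullet> v i) * j i) = 0"
    proof -
      have "E (\<lambda>i. (y0 \<bullet> v i) * j i) = E (\<lambda>i. (t i * (y0 \<bullet> v i) - s * (y0 \<bullet> v i)) - (y0 \<bullet> v i)^2)"
        by (simp add: j_def algebra_simps power2_eq_square)
      then show ?thesis unfolding E_diff E_cmult Ety E_inner Ey2 yy by simp
    qed
    moreover have "E (\<lambda>i. (j i)^2) = E (\<lambda>i. (t i * j i - s * j i) - (y0 \<bullet> v i) * j i)"
      by (simp add: j_def algebra_simps power2_eq_square)
    ultimately show ?thesis unfolding E_diff E_cmult Etj Ej J_def by simp
  qed
  have J0: "J \<ge> 0" unfolding Ejj[symmetric] E_def using rho by (intro sum_nonneg) auto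
  have QN: "Q \<le> N * s"
  proof -
    have "Q \<le> E (\<lambda>i. N * t i)" unfolding Q_def
      using t by (intro E_mono) (auto simp: power2_eq_square intro!: mult_right_mono)
    then show ?thesis by (simp add: E_cmult Et)
  qed
  have y2: "y^2 \<le> (N - s) * s" using J0 QN by (simp add: J_def power2_eq_square algebra_simps)
  \<comment> \<open>With this slope the linearisation is exact at the length of \<open>y0\<close>:
    \<open>(N - s) * (2 * \<tau> * y - \<tau>^2 * (N - s)) = y^2\<close>. Its admissibility is
    Bessel's inequality \<open>J \<ge> 0\<close> together with \<open>t \<le> N\<close>.\<close>
  define \<tau> where "\<tau> = y / (N - s)"
  have tau: "0 \<le> \<tau>" "\<tau>^2 \<le> s / (N - s)"
  proof -
    show "0 \<le> \<tau>" using s by (simp add: \<tau>_def y_def)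
    have "\<tau>^2 = y^2 / (N - s)^2" by (simp add: \<tau>_def power_divide)
    also have "\<dots> \<le> ((N - s) * s) / (N - s)^2" using y2 by (intro divide_right_mono) auto
    also have "\<dots> = s / (N - s)" using s by (simp add: power2_eq_square)
    finally show "\<tau>^2 \<le> s / (N - s)" .
  qed
  \<comment> \<open>As \<open>v\<close> has mean zero, \<open>t\<close> may be replaced by
    \<open>t - N\<close> in the moment that defines \<open>y0\<close>. This brings in the factor
    \<open>N - t\<close>, which the pointwise estimate needs because its right-hand side vanishes at
    \<open>t = N\<close>.\<close>
  have y_le: "y \<le> E (\<lambda>i. (N - t i) * sqrt (t i))"
  proof -
    have "y^2 = E (\<lambda>i. (N * ((- y0) \<bullet> v i)) - t i * ((- y0) \<bullet> v i))"
      unfolding E_diff E_cmult E_inner Ety using yy by simp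
    also have "\<dots> = E (\<lambda>i. (N - t i) * ((- y0) \<bullet> v i))" by (simp add: algebra_simps)
    also have "\<dots> \<le> E (\<lambda>i. y * ((N - t i) * sqrt (t i)))"
    proof (rule E_mono)
      fix i assume i: "i \<in> U"
      have "(- y0) \<bullet> v i \<le> y * sqrt (t i)"
        using norm_cauchy_schwarz[of "- y0" "v i"] by (simp add: y_def t_def)
      then have "(N - t i) * ((- y0) \<bullet> v i) \<le> (N - t i) * (y * sqrt (t i))"
        using t(2)[OF i] by (intro mult_left_mono) auto
      then show "(N - t i) * ((- y0) \<bullet> v i) \<le> y * ((N - t i) * sqrt (t i))" by (simp add: algebra_simps)
    qed
    finally have "y * y \<le> y * E (\<lambda>i. (N - t i) * sqrt (t i))" by (simp add: E_cmult power2_eq_square)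
    moreover have "E (\<lambda>i. (N - t i) * sqrt (t i)) \<ge> 0"
      unfolding E_def using rho t by (intro sum_nonneg mult_nonneg_nonneg) auto
    moreover have "y \<ge> 0" by (simp add: y_def)
    ultimately show ?thesis by (cases "y = 0") (auto simp: mult_le_cancel_left)
  qed
  define D where "D = (gfun N - gfun s) / (N - s)"
  have D: "0 \<le> D" "D \<le> 1 / (s + 2)" unfolding D_def using gfun_chord_bounds[of s N] s by auto
  \<comment> \<open>This is the mean of \<open>t * (N - t)\<close>.\<close>
  define \<Lambda> where "\<Lambda> = N * s - Q"
  have EL: "(D / (N + 1)) * (\<Lambda> + y^2) \<le> E (\<lambda>i. t i * (gfun N - gfun (t i)))"
  proof -
    have "(D / (N + 1)) * (\<Lambda> + y^2) = (D / (N + 1)) * (\<Lambda> + (N - s) * (2 * \<tau> * y - \<tau>^2 * (N - s)))"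
    proof -
      have "y = (N - s) * \<tau>" using s by (simp add: \<tau>_def)
      moreover have "(N - s) * (2 * \<tau> * y - \<tau>^2 * (N - s)) = 2 * ((N - s) * \<tau>) * y - ((N - s) * \<tau>)^2"
        by algebra
      ultimately have "(N - s) * (2 * \<tau> * y - \<tau>^2 * (N - s)) = y^2"
        by (metis (no_types) diff_add_cancel mult_2 power2_eq_square add_diff_cancel_left' distrib_right)
      then show ?thesis by simp
    qed
    also have "\<dots> \<le> (D / (N + 1)) * (\<Lambda> + (N - s) * (2 * \<tau> * E (\<lambda>i. (N - t i) * sqrt (t i)) - \<tau>^2 * (N - s)))"
      using D s y_le tau by (intro mult_left_mono add_left_mono diff_right_mono) auto
    also have "\<dots> = (D / (N + 1)) * E (\<lambda>i. ((N * t i - (t i)^2) + ((N - s) * (2 * \<tau>)) * ((N - t i) * sqrt (t i))) - ((N - s) * \<tau>^2) * (N - t i))"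
      unfolding E_diff E_add E_cmult E_const Et \<Lambda>_def Q_def by (simp add: algebra_simps)
    also have "\<dots> = E (\<lambda>i. (D / (N + 1)) * (((N * t i - (t i)^2) + ((N - s) * (2 * \<tau>)) * ((N - t i) * sqrt (t i))) - ((N - s) * \<tau>^2) * (N - t i)))"
      unfolding E_cmult by simp
    also have "\<dots> \<le> E (\<lambda>i. t i * (gfun N - gfun (t i)))"
    proof (rule E_mono)
      fix i assume i: "i \<in> U"
      have "(D / (N + 1)) * (((N * t i - (t i)^2) + ((N - s) * (2 * \<tau>)) * ((N - t i) * sqrt (t i))) - ((N - s) * \<tau>^2) * (N - t i))
         = (N - t i) * (D / (N + 1)) * (t i + (N - s) * (2 * \<tau> * sqrt (t i) - \<tau>^2))"
        by algebra
      also have "\<dots> \<le> t i * (gfun N - gfun (t i))"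
        unfolding D_def using s t(1)[of i] t(2)[OF i] tau by (rule gfun_pointwise)
      finally show "(D / (N + 1)) * (((N * t i - (t i)^2) + ((N - s) * (2 * \<tau>)) * ((N - t i) * sqrt (t i))) - ((N - s) * \<tau>^2) * (N - t i))
         \<le> t i * (gfun N - gfun (t i))" .
    qed
    finally show ?thesis .
  qed
  have ErL: "E (\<lambda>i. (1 + t i) * ln (1 + t i)) = s * gfun N - E (\<lambda>i. t i * (gfun N - gfun (t i)))"
  proof -
    have "E (\<lambda>i. (1 + t i) * ln (1 + t i)) = E (\<lambda>i. gfun N * t i - t i * (gfun N - gfun (t i)))"
    proof (rule arg_cong[where f = E], rule ext)
      fix i show "(1 + t i) * ln (1 + t i) = gfun N * t i - t i * (gfun N - gfun (t i))"
        using gfun_mult[of "t i"] by (cases "t i = 0") (simp_all add: algebra_simps)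
    qed
    then show ?thesis unfolding E_diff E_cmult Et by simp
  qed
  \<comment> \<open>Two requirements meet here: \<open>\<eta> * j\<close> must stay above
    \<open>- 1 / 2\<close>, and twice the gain \<open>\<eta> * J * (1 - \<eta> * (N + 1))\<close>
    must reach \<open>D / (N + 1) * J\<close>. With \<open>\<eta> * (N + 1) = 1 / (s + 1)\<close>
    the second reduces to \<open>D \<le> 2 * s / (s + 1)^2\<close>, which follows from
    \<open>D \<le> 1 / (s + 2)\<close>.\<close>
  define \<eta> where "\<eta> = 1 / ((N + 1) * (s + 1))"
  have eta: "\<eta> > 0" using s by (simp add: \<eta>_def)
  define b where "b = (\<lambda>i. 1 + \<eta> * j i)"
  \<comment> \<open>Completing the square in \<open>v\<close> bounds
    \<open>t - y0 \<bullet> v\<close> below by \<open>- y^2 / 4\<close>.\<close>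
  have ej: "\<eta> * j i \<ge> - 1 / 2" for i
  proof -
    have "t i - y0 \<bullet> v i = (norm (v i - (1/2) *\<^sub>R y0))^2 - y^2 / 4"
      unfolding power2_norm_eq_inner t_def using yy
      by (simp add: inner_diff_left inner_diff_right inner_commute power2_norm_eq_inner algebra_simps)
    then have "j i \<ge> - s - y^2 / 4" by (simp add: j_def)
    moreover have "y^2 \<le> (N - 1) * s" using y2 s by (smt (verit) mult_right_mono)
    ultimately have "j i \<ge> - s - (N - 1) * s / 4" by simp
    also have "- s - (N - 1) * s / 4 = - (s * (N + 3) / 4)" by (simp add: field_simps)
    finally have "j i \<ge> - (s * (N + 3) / 4)" .
    moreover have "s * (N + 3) / 4 \<le> (N + 1) * (s + 1) / 2"
    proof -
      have "s * (N + 3) \<le> (s + 1) * (2 * (N + 1))" using s by (intro mult_mono) auto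
      then show ?thesis by (simp add: field_simps)
    qed
    ultimately have "j i \<ge> - ((N + 1) * (s + 1) / 2)" by linarith
    then have "\<eta> * j i \<ge> \<eta> * (- ((N + 1) * (s + 1) / 2))" using eta by (intro mult_left_mono) auto
    moreover have "\<eta> * (- ((N + 1) * (s + 1) / 2)) = - 1 / 2" using s by (simp add: \<eta>_def)
    ultimately show ?thesis by simp
  qed
  have bpos: "b i > 0" for i using ej[of i] by (simp add: b_def)
  have gain: "\<eta> * J * (1 - \<eta> * (N + 1)) \<le> E (\<lambda>i. (1 + t i) * ln (b i))"
  proof -
    have "\<eta> * J * (1 - \<eta> * (N + 1)) = \<eta> * (E j + E (\<lambda>i. t i * j i)) - \<eta>^2 * ((N + 1) * E (\<lambda>i. (j i)^2))"
      unfolding Ej Etj Ejj J_def[symmetric] by (simp add: algebra_simps power2_eq_square)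
    also have "\<dots> = E (\<lambda>i. \<eta> * (j i + t i * j i) - \<eta>^2 * ((N + 1) * (j i)^2))"
      unfolding E_diff E_cmult E_add by simp
    also have "\<dots> \<le> E (\<lambda>i. (1 + t i) * ln (b i))"
    proof (rule E_mono)
      fix i assume i: "i \<in> U"
      have "\<eta> * (j i + t i * j i) - \<eta>^2 * ((N + 1) * (j i)^2) \<le> \<eta> * (j i + t i * j i) - \<eta>^2 * ((1 + t i) * (j i)^2)"
        using t(2)[OF i] by (intro diff_left_mono mult_left_mono mult_right_mono) auto
      also have "\<dots> = (1 + t i) * (\<eta> * j i - (\<eta> * j i)^2)" by (simp add: algebra_simps power2_eq_square)
      also have "\<dots> \<le> (1 + t i) * ln (b i)"
      proof (rule mult_left_mono)
        show "\<eta> * j i - (\<eta> * j i)^2 \<le> ln (b i)"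
          unfolding b_def using ej by (rule ln_one_plus_ge_quadratic)
      qed (use t in auto)
      finally show "\<eta> * (j i + t i * j i) - \<eta>^2 * ((N + 1) * (j i)^2) \<le> (1 + t i) * ln (b i)" .
    qed
    finally show ?thesis .
  qed
  have gain2: "D / (N + 1) * J \<le> 2 * (\<eta> * J * (1 - \<eta> * (N + 1)))"
  proof -
    have "\<eta> * (N + 1) = 1 / (s + 1)" using s by (simp add: \<eta>_def)
    then have "1 - \<eta> * (N + 1) = s / (s + 1)" using s by (simp add: field_simps)
    then have "2 * (\<eta> * J * (1 - \<eta> * (N + 1))) = 2 * (\<eta> * J * (s / (s + 1)))" by simp
    also have "\<dots> = J / (N + 1) * (2 * s / (s + 1)^2)"
      by (simp add: \<eta>_def power2_eq_square algebra_simps)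
    finally have "2 * (\<eta> * J * (1 - \<eta> * (N + 1))) = J / (N + 1) * (2 * s / (s + 1)^2)" .
    moreover have "D \<le> 2 * s / (s + 1)^2"
    proof -
      have "(s + 1)^2 \<le> 2 * s * (s + 2)" using s mult_mono[of 1 s 1 s] by (simp add: power2_eq_square algebra_simps)
      then have "1 / (s + 2) \<le> 2 * s / (s + 1)^2" using s by (simp add: field_simps)
      then show ?thesis using D by linarith
    qed
    then have "J / (N + 1) * D \<le> J / (N + 1) * (2 * s / (s + 1)^2)" using J0 s by (intro mult_left_mono) auto
    ultimately show ?thesis by (simp add: mult.commute)
  qed
  \<comment> \<open>The unknown moments \<open>Q\<close> and \<open>y\<close> cancel:
    \<open>\<Lambda> + y^2 + J = s * (N - s)\<close> for every distribution of
    \<open>t\<close>.\<close>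
  have "E (\<lambda>i. (1 + t i) * ln (1 + t i)) - 2 * E (\<lambda>i. (1 + t i) * ln (b i))
      \<le> s * gfun N - (D / (N + 1)) * (\<Lambda> + y^2) - D / (N + 1) * J"
    unfolding ErL using EL gain gain2 by linarith
  also have "\<dots> = s * gfun N - (D / (N + 1)) * (s * (N - s))"
    by (simp add: \<Lambda>_def J_def algebra_simps power2_eq_square)
  also have "\<dots> = s * gfun N - s * (gfun N - gfun s) / (N + 1)" using s by (simp add: D_def)
  also have "\<dots> = (s * (N * gfun N) + s * gfun s) / (N + 1)" using s by (simp add: field_simps)
  also have "\<dots> = s * ln (N + 1) + (s + 1) / (N + 1) * ln (s + 1)"
  proof -
    have "s * (N * gfun N) + s * gfun s = (s * ln (N + 1)) * (N + 1) + (s + 1) * ln (s + 1)"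
      using gfun_mult[of N] gfun_mult[of s] s by (simp add: add.commute mult.commute mult.left_commute)
    then have "(s * (N * gfun N) + s * gfun s) / (N + 1)
        = (s * ln (N + 1)) * (N + 1) / (N + 1) + (s + 1) * ln (s + 1) / (N + 1)"
      by (simp only: add_divide_distrib)
    then show ?thesis using s by simp
  qed
  finally have main: "E (\<lambda>i. (1 + t i) * ln (1 + t i)) - 2 * E (\<lambda>i. (1 + t i) * ln (b i))
      \<le> s * ln (N + 1) + (s + 1) / (N + 1) * ln (s + 1)" .
  show ?thesis
  proof (rule that[of b])
    show "b i > 0" for i by (rule bpos)
    have "E b = 1" unfolding b_def E_add E_cmult E_const Ej by simp
    then show "(\<Sum>i\<in>U. \<rho> i * b i) = 1" by (simp add: E_def)
    show "(\<Sum>i\<in>U. \<rho> i * ((1 + (norm (v i))^2) * ln (1 + (norm (v i))^2)))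
       - 2 * (\<Sum>i\<in>U. \<rho> i * ((1 + (norm (v i))^2) * ln (b i)))
     \<le> s * ln (N + 1) + (s + 1) / (N + 1) * ln (s + 1)" using main by (simp add: E_def t_def)
    define w where "w = (\<Sum>i\<in>U. (\<rho> i * b i) *\<^sub>R v i)"
    have wV: "w \<in> V" unfolding w_def using V by (intro subspace_sum subspace_scale) auto
    \<comment> \<open>Polarised isotropy. It makes the two third-moment contributions to
      \<open>w \<bullet> w\<close>, from \<open>t\<close> and from its linear projection,
      cancel.\<close>
    have pol: "E (\<lambda>i. (y0 \<bullet> v i) * (w \<bullet> v i)) = y0 \<bullet> w"
    proof -
      have "y0 + w \<in> V" using y0V wV V(1) by (rule subspace_add[rotated 1])
      then have "E (\<lambda>i. ((y0 + w) \<bullet> v i)^2) = (y0 + w) \<bullet> (y0 + w)" by (rule iso')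
      moreover have "E (\<lambda>i. (w \<bullet> v i)^2) = w \<bullet> w" by (rule iso'[OF wV])
      moreover have "E (\<lambda>i. ((y0 + w) \<bullet> v i)^2) = E (\<lambda>i. ((y0 \<bullet> v i)^2 + (w \<bullet> v i)^2) + 2 * ((y0 \<bullet> v i) * (w \<bullet> v i)))"
        by (simp add: inner_add_left power2_eq_square algebra_simps)
      ultimately show ?thesis unfolding E_add E_cmult Ey2 yy[symmetric]
        by (simp add: inner_add_left inner_add_right inner_commute)
    qed
    have "w \<bullet> w = E (\<lambda>i. b i * (w \<bullet> v i))" by (simp add: w_def E_def inner_sum_right mult.assoc)
    also have "\<dots> = E (\<lambda>i. w \<bullet> v i + \<eta> * ((t i * (w \<bullet> v i) - s * (w \<bullet> v i)) - (y0 \<bullet> v i) * (w \<bullet> v i)))"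
      by (simp add: b_def j_def algebra_simps)
    also have "\<dots> = 0"
      unfolding E_add E_cmult E_diff E_inner Ety pol by (simp add: inner_commute)
    finally show "(\<Sum>i\<in>U. (\<rho> i * b i) *\<^sub>R v i) = 0" by (simp add: w_def)
  qed
qed

section \<open>The Brascamp--Lieb inequality\<close>

lemma std_normal_density_pos: "std_normal_density x > 0"
  by (simp add: normal_density_pos)

lemma real_distribution_std_normal: "real_distribution (density lborel std_normal_density)"
proof -
  interpret prob_space "density lborel std_normal_density" by (rule prob_space_normal_density) simp
  show ?thesis by unfold_locales auto
qed

definition std_normal_cdf :: "real \<Rightarrow> real" where
  "std_normal_cdf = cdf (density lborel std_normal_density)"

lemma std_normal_cdf_diff:
  assumes "a \<le> b"
  shows "std_normal_cdf b - std_normal_cdf a = integral {a..b} std_normal_density"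
proof -
  interpret real_distribution "density lborel std_normal_density" by (rule real_distribution_std_normal)
  have cont: "continuous_on {a..b} std_normal_density"
    unfolding normal_density_def by (intro continuous_intros) auto
  have int: "set_integrable lborel {a..b} std_normal_density"
    by (rule borel_integrable_atLeastAtMost') (rule cont)
  have d: "std_normal_cdf b - std_normal_cdf a = measure (density lborel std_normal_density) {a<..b}"
    using assms unfolding std_normal_cdf_def by (cases "a = b") (auto simp: cdf_diff_eq)
  have "emeasure (density lborel std_normal_density) {a<..b} = (\<integral>\<^sup>+x. ennreal (std_normal_density x) * indicator {a<..b} x \<partial>lborel)"
    by (subst emeasure_density) auto
  also have "\<dots> = (\<integral>\<^sup>+x. ennreal (std_normal_density x * indicator {a..b} x) \<partial>lborel)"
  proof (rule nn_integral_cong_AE)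
    show "AE x in lborel. ennreal (std_normal_density x) * indicator {a<..b} x = ennreal (std_normal_density x * indicator {a..b} x)"
      using AE_lborel_singleton[of a] by eventually_elim (auto simp: indicator_def)
  qed
  also have "\<dots> = ennreal (LINT x|lborel. std_normal_density x * indicator {a..b} x)"
    using int by (intro nn_integral_eq_integral) (auto simp: set_integrable_def mult.commute)
  also have "(LINT x|lborel. std_normal_density x * indicator {a..b} x) = integral {a..b} std_normal_density"
    using set_borel_integral_eq_integral(2)[OF int] by (simp add: set_lebesgue_integral_def mult.commute)
  finally show ?thesis
    unfolding d by (simp add: measure_def integral_nonneg integrable_continuous_real[OF cont])
qed

lemma std_normal_cdf_deriv: "(std_normal_cdf has_real_derivative std_normal_density x) (at x)"
proof -
  have cont: "continuous_on S std_normal_density" for S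
    unfolding normal_density_def by (intro continuous_intros) auto
  have "((\<lambda>u. integral {x - 1..u} std_normal_density) has_real_derivative std_normal_density x) (at x within {x-1..x+1})"
    by (rule integral_has_real_derivative[OF cont]) auto
  then have "((\<lambda>u. integral {x - 1..u} std_normal_density) has_real_derivative std_normal_density x) (at x)"
    using at_within_interior[of x "{x-1..x+1}"] by simp
  then have "((\<lambda>u. std_normal_cdf (x - 1) + integral {x - 1..u} std_normal_density) has_real_derivative std_normal_density x) (at x)"
    by (auto intro!: derivative_eq_intros)
  then show ?thesis
  proof (rule has_field_derivative_transform_within_open[where S = "{x-1<..<x+1}"])
    fix u assume "u \<in> {x-1<..<x+1}"
    then show "std_normal_cdf (x - 1) + integral {x - 1..u} std_normal_density = std_normal_cdf u"
      using std_normal_cdf_diff[of "x-1" u] by simp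
  qed auto
qed

lemma std_normal_cdf_strict_mono: "a < b \<Longrightarrow> std_normal_cdf a < std_normal_cdf b"
  by (rule DERIV_pos_imp_increasing) (use std_normal_cdf_deriv std_normal_density_pos in blast)+

lemma std_normal_cdf_bij:
  assumes "0 < p" "p < 1" obtains x where "std_normal_cdf x = p"
proof -
  interpret real_distribution "density lborel std_normal_density" by (rule real_distribution_std_normal)
  have "\<forall>\<^sub>F x in at_bot. std_normal_cdf x < p" "\<forall>\<^sub>F x in at_top. p < std_normal_cdf x"
    using order_tendstoD(2)[OF cdf_lim_at_bot, of p] order_tendstoD(1)[OF cdf_lim_at_top_prob, of p] assms
    by (auto simp: std_normal_cdf_def)
  then obtain a b where ab: "\<And>x. x \<le> a \<Longrightarrow> std_normal_cdf x < p" "\<And>x. x \<ge> b \<Longrightarrow> p < std_normal_cdf x"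
    unfolding eventually_at_bot_linorder eventually_at_top_linorder by blast
  have "\<exists>x. min a b \<le> x \<and> x \<le> max a b \<and> std_normal_cdf x = p"
    using ab std_normal_cdf_deriv
    by (intro IVT) (auto simp: less_imp_le intro!: DERIV_isCont)
  then show ?thesis using that by blast
qed

definition gauss_quantile :: "real \<Rightarrow> real" where
  "gauss_quantile p = inv_into UNIV std_normal_cdf p"

lemma std_normal_cdf_quantile: "0 < p \<Longrightarrow> p < 1 \<Longrightarrow> std_normal_cdf (gauss_quantile p) = p"
  unfolding gauss_quantile_def by (rule f_inv_into_f) (metis std_normal_cdf_bij rangeI)

lemma gauss_quantile_cdf: "gauss_quantile (std_normal_cdf x) = x"
  unfolding gauss_quantile_def
  by (rule inv_into_f_f) (auto intro!: linorder_injI simp: std_normal_cdf_strict_mono less_imp_neq)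

lemma gauss_quantile_deriv:
  assumes "0 < p" "p < 1"
  shows "(gauss_quantile has_real_derivative inverse (std_normal_density (gauss_quantile p))) (at p)"
proof (rule DERIV_inverse_function[where f = std_normal_cdf and a = 0 and b = 1])
  show "(std_normal_cdf has_real_derivative std_normal_density (gauss_quantile p)) (at (gauss_quantile p))"
    by (rule std_normal_cdf_deriv)
  show "std_normal_density (gauss_quantile p) \<noteq> 0" using std_normal_density_pos by (metis less_irrefl)
  show "std_normal_cdf (gauss_quantile y) = y" if "0 < y" "y < 1" for y using that by (rule std_normal_cdf_quantile)
  show "isCont gauss_quantile p"
  proof -
    have "isCont gauss_quantile (std_normal_cdf (gauss_quantile p))"
      by (rule isCont_inverse_function[where d = 1])
        (auto simp: gauss_quantile_cdf intro!: DERIV_isCont std_normal_cdf_deriv)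
    then show ?thesis using assms by (simp add: std_normal_cdf_quantile)
  qed
qed (use assms in auto)

section \<open>The Gaussian density on vectors\<close>

lemma nn_integral_vec_prod:
  fixes f :: "'n::finite \<Rightarrow> real \<Rightarrow> ennreal"
  assumes [measurable]: "\<And>i. f i \<in> borel_measurable borel"
  shows "(\<integral>\<^sup>+x. (\<Prod>i\<in>UNIV. f i ((x::real^'n) $ i)) \<partial>lborel) = (\<Prod>i\<in>UNIV. \<integral>\<^sup>+t. f i t \<partial>lborel)"
proof -
  define g where "g = (\<lambda>b::real^'n. f (THE i. b = axis i 1))"
  have g: "g (axis i 1) = f i" for i by (simp add: g_def axis_eq_axis)
  have bij: "bij_betw (\<lambda>i. axis i 1) (UNIV::'n set) (Basis :: (real^'n) set)"
    by (auto simp: bij_betw_def inj_on_def Basis_vec_def axis_eq_axis)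
  have "(\<Prod>b\<in>Basis. g b (x \<bullet> b)) = (\<Prod>i\<in>UNIV. f i (x $ i))" for x
    by (subst prod.reindex_bij_betw[OF bij, symmetric]) (simp add: g inner_axis)
  then have "(\<integral>\<^sup>+x. (\<Prod>i\<in>UNIV. f i (x $ i)) \<partial>lborel) = (\<integral>\<^sup>+x. (\<Prod>b\<in>Basis. g b (x \<bullet> b)) \<partial>lborel)"
    by simp
  also have "\<dots> = (\<Prod>b\<in>Basis. \<integral>\<^sup>+t. g b t \<partial>lborel)"
    by (rule nn_integral_lborel_prod) (auto simp: g_def)
  also have "\<dots> = (\<Prod>i\<in>UNIV. \<integral>\<^sup>+t. f i t \<partial>lborel)"
    by (subst prod.reindex_bij_betw[OF bij, symmetric]) (simp add: g)
  finally show ?thesis .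
qed

definition std_normal_vec :: "real^'n \<Rightarrow> real" where
  "std_normal_vec x = (\<Prod>i\<in>UNIV. std_normal_density (x $ i))"

lemma nn_integral_std_normal_vec: "(\<integral>\<^sup>+x. ennreal (std_normal_vec (x::real^'n)) \<partial>lborel) = 1"
proof -
  have 1: "(\<integral>\<^sup>+t. ennreal (std_normal_density t) \<partial>lborel) = 1"
  proof -
    interpret prob_space "density lborel std_normal_density" by (rule prob_space_normal_density) simp
    show ?thesis using emeasure_space_1 by (simp add: emeasure_density)
  qed
  have "(\<integral>\<^sup>+x. ennreal (std_normal_vec (x::real^'n)) \<partial>lborel)
      = (\<integral>\<^sup>+x. (\<Prod>i\<in>UNIV. ennreal (std_normal_density ((x::real^'n) $ i))) \<partial>lborel)"
    by (simp add: std_normal_vec_def prod_ennreal)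
  also have "\<dots> = 1" by (subst nn_integral_vec_prod) (auto simp: 1)
  finally show ?thesis .
qed

lemma std_normal_vec_eq:
  "std_normal_vec (x::real^'n) = (1 / sqrt (2 * pi)) ^ CARD('n) * exp (- (x \<bullet> x) / 2)"
proof -
  have "std_normal_vec x = (\<Prod>i\<in>UNIV. (1 / sqrt (2 * pi)) * exp (- (x $ i)\<^sup>2 / 2))"
    by (simp add: std_normal_vec_def std_normal_density_def)
  also have "\<dots> = (1 / sqrt (2 * pi)) ^ CARD('n) * exp (\<Sum>i\<in>UNIV. - (x $ i)\<^sup>2 / 2)"
    by (simp add: prod.distrib exp_sum prod_dividef power_one_over)
  also have "(\<Sum>i\<in>UNIV. - (x $ i)\<^sup>2 / 2) = - (x \<bullet> x) / 2"
    by (simp add: inner_vec_def power2_eq_square sum_negf sum_divide_distrib)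
  finally show ?thesis .
qed

lemma integral_std_normal_vec:
  "std_normal_vec absolutely_integrable_on (UNIV :: (real^'n) set)" "integral UNIV (std_normal_vec :: real^'n \<Rightarrow> real) = 1"
proof -
  have nn: "0 \<le> std_normal_vec x" for x :: "real^'n"
    unfolding std_normal_vec_def by (intro prod_nonneg) (auto simp: less_imp_le std_normal_density_pos)
  have m[measurable]: "std_normal_vec \<in> borel_measurable (borel :: (real^'n) measure)"
    unfolding std_normal_vec_eq by measurable
  have "((std_normal_vec :: real^'n \<Rightarrow> real) has_integral 1) UNIV"
    by (rule nn_integral_has_integral) (use nn nn_integral_std_normal_vec[where 'n = 'n] in auto)
  then show "std_normal_vec absolutely_integrable_on (UNIV :: (real^'n) set)" "integral UNIV (std_normal_vec :: real^'n \<Rightarrow> real) = 1"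
    using nn by (auto intro!: nonnegative_absolutely_integrable_1 integral_unique)
qed

text \<open>The density \<open>f\<close> on the open interval \<open>S\<close> is pulled back from the standard Gaussian by a smooth
  increasing map.\<close>

definition gauss_transport :: "real set \<Rightarrow> (real \<Rightarrow> real) \<Rightarrow> bool" where
  "gauss_transport S f \<longleftrightarrow> open S \<and> convex S \<and>
     (\<exists>T T'. \<forall>t\<in>S. (T has_real_derivative T' t) (at t) \<and> T' t > 0 \<and> f t = std_normal_density (T t) * T' t)"

text \<open>Monotone rearrangement: the transport map is \<open>gauss_quantile\<close> after the
  distribution function \<open>F\<close>, and the strict bounds on \<open>F\<close> keep its values
  in the open range where the quantile is differentiable.\<close>

lemma gauss_transport_cdf:
  assumes "open S" "convex S" "\<And>t. t \<in> S \<Longrightarrow> (F has_real_derivative f t) (at t)" "\<And>t. t \<in> S \<Longrightarrow> f t > 0"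
    "\<And>t. t \<in> S \<Longrightarrow> 0 < F t \<and> F t < 1"
  shows "gauss_transport S f"
  unfolding gauss_transport_def
proof (intro conjI exI ballI)
  fix t assume t: "t \<in> S"
  let ?T = "\<lambda>t. gauss_quantile (F t)" and ?T' = "\<lambda>t. inverse (std_normal_density (gauss_quantile (F t))) * f t"
  show "(?T has_real_derivative ?T' t) (at t)"
    using assms t by (intro DERIV_chain2[OF gauss_quantile_deriv]) auto
  show "?T' t > 0" using assms(4)[OF t] std_normal_density_pos by simp
  show "f t = std_normal_density (?T t) * ?T' t"
    using std_normal_density_pos[of "?T t"] by simp
qed (use assms in auto)

lemma gauss_transport_exponential:
  assumes "M > 0" shows "gauss_transport {0<..} (\<lambda>t. exp (- t / M) / M)"
proof (rule gauss_transport_cdf)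
  show "((\<lambda>t. 1 - exp (- t / M)) has_real_derivative exp (- t / M) / M) (at t)" for t
    using assms by (auto intro!: derivative_eq_intros)
qed (use assms in auto)

lemma gauss_transport_uniform:
  assumes "a < b" shows "gauss_transport {a<..<b} (\<lambda>t. 1 / (b - a))"
proof (rule gauss_transport_cdf)
  show "((\<lambda>t. (t - a) / (b - a)) has_real_derivative 1 / (b - a)) (at t)" for t
    using assms by (auto intro!: derivative_eq_intros)
qed (use assms in \<open>auto simp: field_simps\<close>)

text \<open>Expand the weighted squared distance of the coefficients \<open>T i\<close> from the
  frame coefficients of their own synthesis \<open>y\<close>. In Barthe's argument this compares the
  Gaussian exponents.\<close>

lemma frame_sum_norm_le:
  fixes e :: "'i \<Rightarrow> 'b::real_inner"
  assumes c: "\<And>i. i \<in> I \<Longrightarrow> c i \<ge> 0" and frame: "\<And>x. (\<Sum>i\<in>I. c i * (e i \<bullet> x)^2) = x \<bullet> x"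
  shows "(\<Sum>i\<in>I. (c i * T i) *\<^sub>R e i) \<bullet> (\<Sum>i\<in>I. (c i * T i) *\<^sub>R e i) \<le> (\<Sum>i\<in>I. c i * (T i)^2)"
proof -
  define y where "y = (\<Sum>i\<in>I. (c i * T i) *\<^sub>R e i)"
  have "0 \<le> (\<Sum>i\<in>I. c i * (T i - e i \<bullet> y)^2)" using c by (intro sum_nonneg) auto
  also have "\<dots> = (\<Sum>i\<in>I. c i * (T i)^2) - 2 * (\<Sum>i\<in>I. c i * T i * (e i \<bullet> y)) + (\<Sum>i\<in>I. c i * (e i \<bullet> y)^2)"
    by (simp add: power2_diff algebra_simps sum.distrib sum_subtractf sum_distrib_left)
  also have "(\<Sum>i\<in>I. c i * T i * (e i \<bullet> y)) = y \<bullet> y"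
    by (subst (2) y_def) (simp add: inner_sum_left)
  finally show ?thesis unfolding frame y_def[symmetric] by simp
qed

text \<open>Barthe's argument: substitute \<open>y = \<Sum>c\<^sub>i T\<^sub>i(\<langle>e\<^sub>i, x\<rangle>) e\<^sub>i\<close> in the Gaussian integral, where \<open>T\<^sub>i\<close> transports
  \<open>f\<^sub>i\<close> to the Gaussian.\<close>

lemma brascamp_lieb_rank_one:
  fixes e :: "'i \<Rightarrow> real^('n::{finite,wellorder})" and c :: "'i \<Rightarrow> real"
  assumes fin: "finite I" and c: "\<And>i. i \<in> I \<Longrightarrow> c i \<ge> 0" and e: "\<And>i. i \<in> I \<Longrightarrow> norm (e i) = 1"
    and frame: "\<And>x. (\<Sum>i\<in>I. c i * (e i \<bullet> x)^2) = x \<bullet> x"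
    and tr: "\<And>i. i \<in> I \<Longrightarrow> gauss_transport (S i) (f i)"
  shows "(\<integral>\<^sup>+x. ennreal (\<Prod>i\<in>I. f i (e i \<bullet> x) powr c i) * indicator {x. \<forall>i\<in>I. e i \<bullet> x \<in> S i} x \<partial>lborel) \<le> 1"
proof -
  let ?\<phi> = std_normal_density
  have "\<forall>i\<in>I. \<exists>T T'. \<forall>t\<in>S i. (T has_real_derivative T' t) (at t) \<and> T' t > 0 \<and> f i t = ?\<phi> (T t) * T' t"
    using tr by (auto simp: gauss_transport_def)
  then obtain T T' where T: "\<And>i t. i \<in> I \<Longrightarrow> t \<in> S i \<Longrightarrow> (T i has_real_derivative T' i t) (at t)"
    "\<And>i t. i \<in> I \<Longrightarrow> t \<in> S i \<Longrightarrow> T' i t > 0"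
    "\<And>i t. i \<in> I \<Longrightarrow> t \<in> S i \<Longrightarrow> f i t = ?\<phi> (T i t) * T' i t"
    unfolding bchoice_iff by blast
  define W where "W = {x. \<forall>i\<in>I. e i \<bullet> x \<in> S i}"
  define Y where "Y = (\<lambda>x. \<Sum>i\<in>I. (c i * T i (e i \<bullet> x)) *\<^sub>R e i)"
  define L where "L = (\<lambda>x h. \<Sum>i\<in>I. (c i * T' i (e i \<bullet> x) * (e i \<bullet> h)) *\<^sub>R e i)"
  have "W = (\<Inter>i\<in>I. (\<lambda>x. e i \<bullet> x) -` S i)" by (auto simp: W_def)
  moreover have "open ((\<lambda>x. e i \<bullet> x) -` S i)" if "i \<in> I" for i
    using tr[OF that] by (intro open_vimage) (auto simp: gauss_transport_def intro!: continuous_intros)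
  ultimately have openW: "open W" using fin by auto
  have der: "(Y has_derivative L x) (at x)" if "x \<in> W" for x
  proof -
    have "((\<lambda>x. T i (e i \<bullet> x)) has_derivative (\<lambda>h. (e i \<bullet> h) * T' i (e i \<bullet> x))) (at x)" if i: "i \<in> I" for i
    proof -
      have 1: "(T i has_real_derivative T' i (e i \<bullet> x)) (at (e i \<bullet> x))"
        using T(1)[OF i] \<open>x \<in> W\<close> i by (auto simp: W_def)
      have 2: "((\<lambda>x. e i \<bullet> x) has_derivative (\<lambda>h. e i \<bullet> h)) (at x)"
        by (rule bounded_linear_imp_has_derivative[OF bounded_linear_inner_right])
      show ?thesis using DERIV_compose_FDERIV[OF 1 2] .
    qed
    then have "(Y has_derivative (\<lambda>h. \<Sum>i\<in>I. (c i * ((e i \<bullet> h) * T' i (e i \<bullet> x))) *\<^sub>R e i)) (at x)"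
      unfolding Y_def by (intro has_derivative_sum has_derivative_scaleR_left has_derivative_mult_right) auto
    then show ?thesis unfolding L_def by (simp add: mult.commute mult.left_commute)
  qed
  have mono: "0 \<le> (T i t - T i u) * (t - u)" "(T i t - T i u) * (t - u) = 0 \<Longrightarrow> t = u"
    if i: "i \<in> I" and "t \<in> S i" "u \<in> S i" for i t u
  proof -
    have less: "T i u < T i t" if "u < t" "u \<in> S i" "t \<in> S i" for u t
    proof (rule DERIV_pos_imp_increasing[OF that(1)])
      fix x assume "u \<le> x" "x \<le> t"
      then have "x \<in> S i" using that tr[OF i] unfolding gauss_transport_def
        by (metis is_interval_convex_1 mem_is_interval_1_I)
      then show "\<exists>y. (T i has_real_derivative y) (at x) \<and> 0 < y" using T i by blast
    qed
    show "0 \<le> (T i t - T i u) * (t - u)" using less[of u t] less[of t u] that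
      by (cases u t rule: linorder_cases) (auto simp: zero_le_mult_iff)
    show "(T i t - T i u) * (t - u) = 0 \<Longrightarrow> t = u" using less[of u t] less[of t u] that
      by (cases u t rule: linorder_cases) auto
  qed
  \<comment> \<open>\<open>Y\<close> is a monotone map: \<open>(Y x - Y y) \<bullet> (x - y)\<close>
    is a sum of nonnegative terms. If it vanishes, so does each term of the frame identity for
    \<open>x - y\<close>.\<close>
  have inj: "inj_on Y W"
  proof (rule inj_onI, rule ccontr)
    fix x y assume xy: "x \<in> W" "y \<in> W" "Y x = Y y" "x \<noteq> y"
    have "0 = (Y x - Y y) \<bullet> (x - y)" using xy by simp
    also have "\<dots> = (\<Sum>i\<in>I. c i * ((T i (e i \<bullet> x) - T i (e i \<bullet> y)) * (e i \<bullet> x - e i \<bullet> y)))"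
      unfolding Y_def sum_subtractf[symmetric] inner_sum_left
      by (intro sum.cong) (auto simp: inner_diff_right inner_diff_left algebra_simps)
    finally have "(\<Sum>i\<in>I. c i * ((T i (e i \<bullet> x) - T i (e i \<bullet> y)) * (e i \<bullet> x - e i \<bullet> y))) = 0" ..
    then have z: "\<forall>i\<in>I. c i * ((T i (e i \<bullet> x) - T i (e i \<bullet> y)) * (e i \<bullet> x - e i \<bullet> y)) = 0"
      using fin c mono(1) xy by (subst (asm) sum_nonneg_eq_0_iff) (auto simp: W_def)
    have "c i * (e i \<bullet> (x - y))^2 = 0" if "i \<in> I" for i
      using z[rule_format, OF that] mono(2)[OF that, of "e i \<bullet> x" "e i \<bullet> y"] xy that
      by (auto simp: W_def inner_diff_right)
    then have "(x - y) \<bullet> (x - y) = 0" unfolding frame[symmetric] by (intro sum.neutral) auto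
    then show False using xy by simp
  qed
  have contY: "continuous_on W Y"
    using der by (meson continuous_at_imp_continuous_on has_derivative_continuous)
  have openYW: "open (Y ` W)" using invariance_of_domain[OF contY openW inj] .
  have intY: "std_normal_vec absolutely_integrable_on (Y ` W)"
    by (rule set_integrable_subset[OF integral_std_normal_vec(1)]) (auto simp: openYW borel_open)
  have nn: "0 \<le> std_normal_vec z" for z :: "real^('n::{finite,wellorder})"
    unfolding std_normal_vec_def by (intro prod_nonneg) (auto simp: less_imp_le std_normal_density_pos)
  have "integral (Y ` W) std_normal_vec \<le> integral UNIV (std_normal_vec :: real^('n::{finite,wellorder}) \<Rightarrow> real)"
    using set_lebesgue_integral_eq_integral(1)[OF intY] nn
      set_lebesgue_integral_eq_integral(1)[OF integral_std_normal_vec(1)[where 'n = 'n]]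
    by (intro integral_subset_le) auto
  then have le1: "integral (Y ` W) std_normal_vec \<le> 1" by (simp only: integral_std_normal_vec(2))
  define F where "F = (\<lambda>x. \<bar>det (matrix (L x))\<bar> *\<^sub>R std_normal_vec (Y x))"
  have F: "F absolutely_integrable_on W" "integral W F \<le> 1"
  proof -
    let ?g = "\<lambda>x. (\<chi> _. std_normal_vec x) :: real^1"
    have "?g absolutely_integrable_on (Y ` W) \<and> integral (Y ` W) ?g = integral (Y ` W) ?g"
      using intY by (simp add: absolutely_integrable_on_1_iff)
    then have *: "(\<lambda>x. \<bar>det (matrix (L x))\<bar> *\<^sub>R ?g (Y x)) absolutely_integrable_on W"
      "integral W (\<lambda>x. \<bar>det (matrix (L x))\<bar> *\<^sub>R ?g (Y x)) = integral (Y ` W) ?g"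
      using has_absolute_integral_change_of_variables[of W Y L ?g "integral (Y ` W) ?g"]
        openW der inj by (auto simp: has_derivative_at_withinI borel_open)
    show Fint: "F absolutely_integrable_on W" using *(1) by (simp add: absolutely_integrable_on_1_iff F_def)
    have "integral W F = integral W (\<lambda>x. \<bar>det (matrix (L x))\<bar> *\<^sub>R ?g (Y x)) $ 1"
      by (subst integral_on_1_eq) (simp add: F_def)
    also have "\<dots> = integral (Y ` W) std_normal_vec" unfolding *(2) by (subst integral_on_1_eq) simp
    finally show "integral W F \<le> 1" using le1 by simp
  qed
  \<comment> \<open>Trace of the frame identity; it makes the factors
    \<open>(1 / sqrt (2 * pi)) powr c i\<close> multiply to the normalising constant in dimension
    \<open>CARD('n)\<close>.\<close>
  have sumc: "(\<Sum>i\<in>I. c i) = real CARD('n)"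
  proof -
    have "(\<Sum>i\<in>I. c i) = (\<Sum>i\<in>I. c i * (\<Sum>k\<in>UNIV. (e i $ k)^2))"
    proof (rule sum.cong[OF refl])
      fix i assume "i \<in> I"
      then have "e i \<bullet> e i = 1" using e by (simp add: norm_eq_1)
      then show "c i = c i * (\<Sum>k\<in>UNIV. (e i $ k)^2)" by (simp add: inner_vec_def power2_eq_square)
    qed
    also have "\<dots> = (\<Sum>k\<in>UNIV. \<Sum>i\<in>I. c i * (e i \<bullet> axis k 1)^2)"
      unfolding sum_distrib_left by (subst sum.swap) (simp add: inner_axis)
    also have "\<dots> = real CARD('n)" unfolding frame by (simp add: inner_axis)
    finally show ?thesis .
  qed
  \<comment> \<open>The integrand splits into Gaussian factors and derivatives of the transports.
    \<open>frame_sum_norm_le\<close> bounds the former by the Gaussian density at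
    \<open>Y x\<close>, and \<open>det_frame_operator_ge\<close> bounds the latter by the Jacobian
    of \<open>Y\<close>.\<close>
  have le: "(\<Prod>i\<in>I. f i (e i \<bullet> x) powr c i) \<le> F x" if x: "x \<in> W" for x
  proof -
    have xS: "e i \<bullet> x \<in> S i" if "i \<in> I" for i using x that by (simp add: W_def)
    have "(\<Prod>i\<in>I. f i (e i \<bullet> x) powr c i) = (\<Prod>i\<in>I. ?\<phi> (T i (e i \<bullet> x)) powr c i) * (\<Prod>i\<in>I. T' i (e i \<bullet> x) powr c i)"
      unfolding prod.distrib[symmetric]
      by (intro prod.cong) (auto simp: T(3) xS powr_mult less_imp_le std_normal_density_pos T(2))
    also have "\<dots> \<le> std_normal_vec (Y x) * det (matrix (L x))"
    proof (rule mult_mono)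
      have "L x = (\<lambda>h. \<Sum>i\<in>I. (c i * T' i (e i \<bullet> x) * (e i \<bullet> h)) *\<^sub>R e i)" by (simp add: L_def)
      then show "(\<Prod>i\<in>I. T' i (e i \<bullet> x) powr c i) \<le> det (matrix (L x))"
        using det_frame_operator_ge[of I c e "\<lambda>i. T' i (e i \<bullet> x)"] fin c e frame T(2) xS by simp
      have "(\<Prod>i\<in>I. ?\<phi> (T i (e i \<bullet> x)) powr c i)
          = (\<Prod>i\<in>I. (1 / sqrt (2 * pi)) powr c i * exp (- (c i * (T i (e i \<bullet> x))\<^sup>2) / 2))"
      proof (rule prod.cong[OF refl])
        fix i
        have "?\<phi> (T i (e i \<bullet> x)) powr c i = ((1 / sqrt (2 * pi)) * exp (- (T i (e i \<bullet> x))\<^sup>2 / 2)) powr c i"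
          by (simp only: std_normal_density_def)
        also have "\<dots> = (1 / sqrt (2 * pi)) powr c i * exp (- (T i (e i \<bullet> x))\<^sup>2 / 2) powr c i"
          by (rule powr_mult)
        finally show "?\<phi> (T i (e i \<bullet> x)) powr c i = (1 / sqrt (2 * pi)) powr c i * exp (- (c i * (T i (e i \<bullet> x))\<^sup>2) / 2)"
          by (simp add: exp_powr_real mult.commute)
      qed
      also have "\<dots> = (1 / sqrt (2 * pi)) powr (\<Sum>i\<in>I. c i) * exp (- (\<Sum>i\<in>I. c i * (T i (e i \<bullet> x))\<^sup>2) / 2)"
        by (simp add: prod.distrib powr_sum exp_sum[symmetric] fin sum_negf sum_divide_distrib)
      also have "\<dots> \<le> (1 / sqrt (2 * pi)) ^ CARD('n) * exp (- (Y x \<bullet> Y x) / 2)"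
      proof (rule mult_mono)
        show "(1 / sqrt (2 * pi)) powr (\<Sum>i\<in>I. c i) \<le> (1 / sqrt (2 * pi)) ^ CARD('n)"
          unfolding sumc by (subst powr_realpow) auto
        show "exp (- (\<Sum>i\<in>I. c i * (T i (e i \<bullet> x))\<^sup>2) / 2) \<le> exp (- (Y x \<bullet> Y x) / 2)"
          unfolding Y_def using frame_sum_norm_le[of I c e "\<lambda>i. T i (e i \<bullet> x)", OF c frame] by simp
      qed auto
      finally show "(\<Prod>i\<in>I. ?\<phi> (T i (e i \<bullet> x)) powr c i) \<le> std_normal_vec (Y x)"
        unfolding std_normal_vec_eq .
    qed (auto intro!: prod_nonneg nn)
    also have "\<dots> \<le> std_normal_vec (Y x) * \<bar>det (matrix (L x))\<bar>"
      using nn[of "Y x"] by (intro mult_left_mono) auto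
    also have "\<dots> = F x" by (simp add: F_def mult.commute)
    finally show ?thesis .
  qed
  have "(\<integral>\<^sup>+x. ennreal (\<Prod>i\<in>I. f i (e i \<bullet> x) powr c i) * indicator W x \<partial>lborel)
      \<le> (\<integral>\<^sup>+x. ennreal (indicator W x *\<^sub>R F x) \<partial>lborel)"
    by (intro nn_integral_mono) (auto simp: indicator_def le intro!: ennreal_leI)
  also have "\<dots> = (\<integral>\<^sup>+x. ennreal (indicator W x *\<^sub>R F x) \<partial>lebesgue)"
    by (rule nn_integral_completion[symmetric])
  also have "\<dots> = ennreal (LINT x|lebesgue. indicator W x *\<^sub>R F x)"
    using F(1) nn by (intro nn_integral_eq_integral) (auto simp: set_integrable_def F_def indicator_def)
  also have "(LINT x|lebesgue. indicator W x *\<^sub>R F x) = integral W F"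
    using set_lebesgue_integral_eq_integral(2)[OF F(1)] by (simp add: set_lebesgue_integral_def)
  also have "ennreal (integral W F) \<le> 1" using F(2) by (simp add: ennreal_le_1)
  finally show ?thesis unfolding W_def .
qed

section \<open>Integration over the model space\<close>

abbreviation PiL :: "nat \<Rightarrow> (nat \<Rightarrow> real) measure" where
  "PiL m \<equiv> Pi\<^sub>M {..<m} (\<lambda>_. lborel)"

interpretation PiL: product_sigma_finite "\<lambda>_::nat. lborel :: real measure" by standard

definition coords :: "(nat \<Rightarrow> 'n) \<Rightarrow> nat \<Rightarrow> real^'n \<Rightarrow> nat \<Rightarrow> real" where
  "coords h m x = (\<lambda>i\<in>{..<m}. x $ h i)"

text \<open>The coordinates from \<open>m\<close> on are confined to \<open>(0, 1)\<close>, which turns integrals over the model space of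
  dimension \<open>m\<close> into integrals over \<open>real ^ 'n\<close>, where a change of variables is available.\<close>

definition unit_slab :: "(nat \<Rightarrow> 'n) \<Rightarrow> nat \<Rightarrow> (real^'n) set" where
  "unit_slab h m = {x. \<forall>i\<in>{m..<CARD('n)}. x $ h i \<in> {0<..<1}}"

lemma measurable_coords [measurable]: "coords h m \<in> lborel \<rightarrow>\<^sub>M PiL m"
  unfolding coords_def by (rule measurable_restrict) simp

lemma open_unit_slab: "open (unit_slab (h :: nat \<Rightarrow> 'n::finite) m)"
proof -
  have "unit_slab h m = (\<Inter>i\<in>{m..<CARD('n)}. (\<lambda>x. (x::real^'n) $ h i) -` {0<..<1})"
    by (auto simp: unit_slab_def)
  also have "open \<dots>" by (intro open_INT ballI open_vimage continuous_intros) auto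
  finally show ?thesis .
qed

lemma unit_slab_sets [measurable]: "unit_slab h m \<in> sets borel"
  using open_unit_slab by (rule borel_open)

text \<open>It suffices to compare boxes. Padding the sides by \<open>{0<..<1}\<close> turns the
  preimage of a box within the slab into a product over all coordinates, and the padding contributes
  factors \<open>1\<close>.\<close>

lemma PiL_eq_distr_coords:
  fixes h :: "nat \<Rightarrow> 'n::finite"
  assumes h: "bij_betw h {..<CARD('n)} UNIV" and m: "m \<le> CARD('n)"
  shows "distr (density lborel (indicator (unit_slab h m))) (PiL m) (coords h m) = PiL m"
proof (rule PiL.PiM_eqI)
  fix A :: "nat \<Rightarrow> real set" assume A: "\<And>i. i \<in> {..<m} \<Longrightarrow> A i \<in> sets lborel"
  define B where "B = (\<lambda>i. if i < m then A i else {0<..<1::real})"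
  have B[measurable]: "B i \<in> sets borel" for i using A by (auto simp: B_def)
  define g where "g = inv_into {..<CARD('n)} h"
  have g: "g (h i) = i" if "i < CARD('n)" for i
    unfolding g_def using h that by (auto simp: bij_betw_def)
  have eq: "indicator (unit_slab h m) x * indicator (coords h m -` Pi\<^sub>E {..<m} A) x
       = (\<Prod>k\<in>UNIV. indicator (B (g k)) (x $ k) :: ennreal)" for x :: "real^'n"
  proof -
    have "(\<Prod>k\<in>UNIV. indicator (B (g k)) (x $ k) :: ennreal) = (\<Prod>i<CARD('n). indicator (B i) (x $ h i))"
      by (subst prod.reindex_bij_betw[OF h, symmetric]) (simp add: g)
    also have "\<dots> = indicator {x. \<forall>i<CARD('n). x $ h i \<in> B i} x"
      by (auto simp: indicator_def)
    also have "{x. \<forall>i<CARD('n). x $ h i \<in> B i} = unit_slab h m \<inter> coords h m -` Pi\<^sub>E {..<m} A"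
      using m by (auto simp: unit_slab_def coords_def B_def PiE_iff split: if_splits)
    finally show ?thesis by (simp only: indicator_inter_arith)
  qed
  have [measurable]: "Pi\<^sub>E {..<m} A \<in> sets (PiL m)" using A by (intro sets_PiM_I_finite) auto
  have "emeasure (distr (density lborel (indicator (unit_slab h m))) (PiL m) (coords h m)) (Pi\<^sub>E {..<m} A)
      = emeasure (density lborel (indicator (unit_slab h m))) (coords h m -` Pi\<^sub>E {..<m} A)"
    by (subst emeasure_distr) auto
  also have "\<dots> = (\<integral>\<^sup>+x. indicator (unit_slab h m) x * indicator (coords h m -` Pi\<^sub>E {..<m} A) x \<partial>lborel)"
  proof (rule emeasure_density)
    have "coords h m -` Pi\<^sub>E {..<m} A \<inter> space lborel \<in> sets lborel" by measurable
    then show "coords h m -` Pi\<^sub>E {..<m} A \<in> sets lborel" by simp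
  qed simp
  also have "\<dots> = (\<Prod>k\<in>UNIV. \<integral>\<^sup>+t. indicator (B (g k)) t \<partial>lborel)"
    unfolding eq by (rule nn_integral_vec_prod) simp
  also have "\<dots> = (\<Prod>i<CARD('n). emeasure lborel (B i))"
    by (subst prod.reindex_bij_betw[OF h, symmetric]) (simp add: g)
  also have "\<dots> = (\<Prod>i<m. emeasure lborel (B i)) * (\<Prod>i\<in>{m..<CARD('n)}. emeasure lborel (B i))"
    using m by (subst prod.union_disjoint[symmetric]) (auto intro!: prod.cong)
  also have "\<dots> = (\<Prod>i<m. emeasure lborel (A i))" by (simp add: B_def)
  finally show "emeasure (distr (density lborel (indicator (unit_slab h m))) (PiL m) (coords h m)) (Pi\<^sub>E {..<m} A)
      = (\<Prod>i\<in>{..<m}. emeasure lborel (A i))" .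
qed auto

lemma nn_integral_PiL:
  fixes h :: "nat \<Rightarrow> 'n::finite"
  assumes h: "bij_betw h {..<CARD('n)} UNIV" and m: "m \<le> CARD('n)" and [measurable]: "g \<in> borel_measurable (PiL m)"
  shows "(\<integral>\<^sup>+x. g x \<partial>PiL m) = (\<integral>\<^sup>+x. g (coords h m x) * indicator (unit_slab h m) x \<partial>lborel)"
proof -
  have "(\<integral>\<^sup>+x. g x \<partial>PiL m) = (\<integral>\<^sup>+x. g x \<partial>distr (density lborel (indicator (unit_slab h m))) (PiL m) (coords h m))"
    unfolding PiL_eq_distr_coords[OF h m] ..
  also have "\<dots> = (\<integral>\<^sup>+x. g (coords h m x) \<partial>density lborel (indicator (unit_slab h m)))"
    by (rule nn_integral_distr) auto
  also have "\<dots> = (\<integral>\<^sup>+x. g (coords h m x) * indicator (unit_slab h m) x \<partial>lborel)"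
    by (subst nn_integral_density) (auto simp: mult.commute)
  finally show ?thesis .
qed

section \<open>Dilations and cones in the model space\<close>

lemma nn_integral_PiL_scale:
  assumes a: "a > 0" and g[measurable]: "g \<in> borel_measurable (PiL m)"
  shows "(\<integral>\<^sup>+x. g x \<partial>PiL m) = ennreal (a ^ m) * (\<integral>\<^sup>+x. g (\<lambda>i\<in>{..<m}. a * x i) \<partial>PiL m)"
proof -
  let ?S = "\<lambda>x. \<lambda>i\<in>{..<m}. a * x i"
  have [measurable]: "?S \<in> PiL m \<rightarrow>\<^sub>M PiL m" by (intro measurable_restrict) measurable
  have "density (distr (PiL m) (PiL m) ?S) (\<lambda>_. ennreal (a ^ m)) = PiL m"
  proof (rule PiL.PiM_eqI)
    fix A :: "nat \<Rightarrow> real set" assume A: "\<And>i. i \<in> {..<m} \<Longrightarrow> A i \<in> sets lborel"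
    have [measurable]: "Pi\<^sub>E {..<m} A \<in> sets (PiL m)" using A by (intro sets_PiM_I_finite) auto
    have A': "(\<lambda>t. a * t) -` A i \<in> sets lborel" if "i < m" for i
      using measurable_sets[of "\<lambda>t. a * t" lborel lborel "A i"] A that by simp
    have "emeasure (distr (PiL m) (PiL m) ?S) (Pi\<^sub>E {..<m} A) = emeasure (PiL m) (?S -` Pi\<^sub>E {..<m} A \<inter> space (PiL m))"
      by (subst emeasure_distr) auto
    also have "?S -` Pi\<^sub>E {..<m} A \<inter> space (PiL m) = Pi\<^sub>E {..<m} (\<lambda>i. (\<lambda>t. a * t) -` A i)"
      by (auto simp: space_PiM PiE_iff)
    also have "emeasure (PiL m) \<dots> = (\<Prod>i<m. emeasure lborel ((\<lambda>t. a * t) -` A i))"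
      using A' by (intro PiL.emeasure_PiM) auto
    finally have 1: "emeasure (distr (PiL m) (PiL m) ?S) (Pi\<^sub>E {..<m} A) = (\<Prod>i<m. emeasure lborel ((\<lambda>t. a * t) -` A i))" .
    have "emeasure (density (distr (PiL m) (PiL m) ?S) (\<lambda>_. ennreal (a ^ m))) (Pi\<^sub>E {..<m} A)
       = ennreal (a ^ m) * emeasure (distr (PiL m) (PiL m) ?S) (Pi\<^sub>E {..<m} A)"
      by (rule emeasure_density_const) simp
    also have "\<dots> = ennreal (a ^ m) * (\<Prod>i<m. emeasure lborel ((\<lambda>t. a * t) -` A i))" unfolding 1 ..
    also have "\<dots> = (\<Prod>i<m. ennreal a * emeasure lborel ((\<lambda>t. a * t) -` A i))"
      using a by (simp add: prod.distrib ennreal_power)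
    also have "\<dots> = (\<Prod>i<m. emeasure lborel (A i))"
    proof (rule prod.cong[OF refl])
      fix i assume i: "i \<in> {..<m}"
      have "emeasure lborel (A i) = (\<integral>\<^sup>+t. indicator (A i) t \<partial>lborel)" using A[OF i] by simp
      also have "\<dots> = ennreal a * (\<integral>\<^sup>+t. indicator (A i) (0 + a * t) \<partial>lborel)"
        using A[OF i] a by (subst nn_integral_real_affine[where c = a and t = 0]) auto
      also have "(\<integral>\<^sup>+t. indicator (A i) (0 + a * t) \<partial>lborel) = (\<integral>\<^sup>+t. indicator ((\<lambda>t. a * t) -` A i) t \<partial>lborel)"
        by (intro nn_integral_cong) (auto simp: indicator_def)
      also have "\<dots> = emeasure lborel ((\<lambda>t. a * t) -` A i)" using A' i by (subst nn_integral_indicator) auto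
      finally show "ennreal a * emeasure lborel ((\<lambda>t. a * t) -` A i) = emeasure lborel (A i)" ..
    qed
    finally show "emeasure (density (distr (PiL m) (PiL m) ?S) (\<lambda>_. ennreal (a ^ m))) (Pi\<^sub>E {..<m} A) = (\<Prod>i\<in>{..<m}. emeasure lborel (A i))" .
  qed auto
  then have "(\<integral>\<^sup>+x. g x \<partial>PiL m) = (\<integral>\<^sup>+x. g x \<partial>density (distr (PiL m) (PiL m) ?S) (\<lambda>_. ennreal (a ^ m)))" by simp
  also have "\<dots> = (\<integral>\<^sup>+x. ennreal (a ^ m) * g x \<partial>distr (PiL m) (PiL m) ?S)"
    by (subst nn_integral_density) auto
  also have "\<dots> = (\<integral>\<^sup>+x. ennreal (a ^ m) * g (?S x) \<partial>PiL m)" by (subst nn_integral_distr) auto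
  also have "\<dots> = ennreal (a ^ m) * (\<integral>\<^sup>+x. g (?S x) \<partial>PiL m)" by (subst nn_integral_cmult) auto
  finally show ?thesis .
qed

text \<open>A Gamma integral. It appears in \<open>nn_integral_cone\<close>, where the slice of the
  cone at height \<open>t\<close> is the base dilated by \<open>t / \<theta>\<close>.\<close>

lemma nn_integral_power_exp_scaled:
  assumes "\<theta> > 0"
  shows "(\<integral>\<^sup>+t. ennreal ((t / \<theta>) ^ s * exp (- (\<theta> * t))) * indicator {0<..} t \<partial>lborel) = ennreal (fact s / \<theta> ^ (2 * s + 1))"
proof -
  have "(\<integral>\<^sup>+t. ennreal ((t / \<theta>) ^ s * exp (- (\<theta> * t))) * indicator {0<..} t \<partial>lborel)
     = ennreal (1 / \<theta>) * (\<integral>\<^sup>+t. ennreal (((t / \<theta>) / \<theta>) ^ s * exp (- t)) * indicator {0<..} (t / \<theta>) \<partial>lborel)"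
    using assms by (subst nn_integral_real_affine[where c = "1 / \<theta>" and t = 0]) auto
  also have "(\<integral>\<^sup>+t. ennreal (((t / \<theta>) / \<theta>) ^ s * exp (- t)) * indicator {0<..} (t / \<theta>) \<partial>lborel)
     = (\<integral>\<^sup>+t. ennreal (1 / \<theta> ^ (2 * s)) * (ennreal (t ^ s * exp (- t)) * indicator {0..} t) \<partial>lborel)"
  proof (rule nn_integral_cong_AE)
    show "AE t in lborel. ennreal (((t / \<theta>) / \<theta>) ^ s * exp (- t)) * indicator {0<..} (t / \<theta>)
       = ennreal (1 / \<theta> ^ (2 * s)) * (ennreal (t ^ s * exp (- t)) * indicator {0..} t)"
      using AE_lborel_singleton[of 0]
    proof eventually_elim
      case (elim t)
      show ?case
      proof (cases "t > 0")
        case True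
        have "((t / \<theta>) / \<theta>) ^ s * exp (- t) = (1 / \<theta> ^ (2 * s)) * (t ^ s * exp (- t))"
          by (simp add: power_divide power_mult power2_eq_square power_mult_distrib)
        then have "ennreal (((t / \<theta>) / \<theta>) ^ s * exp (- t)) = ennreal (1 / \<theta> ^ (2 * s)) * ennreal (t ^ s * exp (- t))"
          using True assms by (subst ennreal_mult[symmetric]) auto
        then show ?thesis using True assms by simp
      next
        case False then show ?thesis using elim assms by (auto simp: indicator_def zero_less_divide_iff)
      qed
    qed
  qed
  also have "\<dots> = ennreal (1 / \<theta> ^ (2 * s)) * ennreal (fact s)"
    by (subst nn_integral_cmult) (auto simp: nn_intergal_power_times_exp_Ici)
  also have "ennreal (1 / \<theta>) * \<dots> = ennreal (fact s / \<theta> ^ (2 * s + 1))"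
    using assms by (simp add: ennreal_mult[symmetric])
  finally show ?thesis .
qed

lemma measurable_cone_density:
  assumes P[measurable]: "P \<in> sets (PiL s)"
  shows "(\<lambda>y. indicator {y. 0 < y s \<and> (\<lambda>i\<in>{..<s}. y i * (\<theta> / y s)) \<in> P} y * ennreal (exp (- (\<theta> * y s))))
     \<in> borel_measurable (PiL (Suc s))"
proof -
  have [measurable]: "(\<lambda>y. \<lambda>i\<in>{..<s}. y i * (\<theta> / y s)) \<in> PiL (Suc s) \<rightarrow>\<^sub>M PiL s"
    by (intro measurable_restrict) measurable
  have "(\<lambda>y. indicator {y. 0 < y s \<and> (\<lambda>i\<in>{..<s}. y i * (\<theta> / y s)) \<in> P} y * ennreal (exp (- (\<theta> * y s))))
      = (\<lambda>y. indicator {0<..} (y s) * indicator P (\<lambda>i\<in>{..<s}. y i * (\<theta> / y s)) * ennreal (exp (- (\<theta> * y s))))"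
    by (auto simp: indicator_def)
  also have "\<dots> \<in> borel_measurable (PiL (Suc s))" by measurable
  finally show ?thesis .
qed

text \<open>Integration over the height \<open>y s\<close>. The volume of \<open>P\<close> is
  thereby encoded in an integral of an exponential in dimension \<open>s + 1\<close>, and an
  exponential of a linear function factors along any frame. The base sits at height
  \<theta>.\<close>

lemma nn_integral_cone:
  assumes th: "\<theta> > 0" and P[measurable]: "P \<in> sets (PiL s)"
  shows "(\<integral>\<^sup>+y. indicator {y. 0 < y s \<and> (\<lambda>i\<in>{..<s}. y i * (\<theta> / y s)) \<in> P} y * ennreal (exp (- (\<theta> * y s))) \<partial>PiL (Suc s))
     = emeasure (PiL s) P * ennreal (fact s / \<theta> ^ (2 * s + 1))"
proof -
  let ?f = "\<lambda>y::nat \<Rightarrow> real. indicator {y. 0 < y s \<and> (\<lambda>i\<in>{..<s}. y i * (\<theta> / y s)) \<in> P} y * ennreal (exp (- (\<theta> * y s)))"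
  have Suc: "{..<Suc s} = insert s {..<s}" by auto
  have m: "?f \<in> borel_measurable (PiL (Suc s))" by (rule measurable_cone_density[OF P])
  have "(\<integral>\<^sup>+y. ?f y \<partial>PiL (Suc s)) = (\<integral>\<^sup>+t. (\<integral>\<^sup>+x. ?f (x(s := t)) \<partial>PiL s) \<partial>lborel)"
    unfolding Suc by (rule PiL.product_nn_integral_insert_rev) (use m Suc in auto)
  also have "\<dots> = (\<integral>\<^sup>+t. emeasure (PiL s) P * (ennreal ((t / \<theta>) ^ s * exp (- (\<theta> * t))) * indicator {0<..} t) \<partial>lborel)"
  proof (rule nn_integral_cong)
    fix t :: real
    show "(\<integral>\<^sup>+x. ?f (x(s := t)) \<partial>PiL s) = emeasure (PiL s) P * (ennreal ((t / \<theta>) ^ s * exp (- (\<theta> * t))) * indicator {0<..} t)"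
    proof (cases "t > 0")
      case True
      have eq: "(\<lambda>i\<in>{..<s}. (x(s := t)) i * (\<theta> / t)) = (\<lambda>i\<in>{..<s}. \<theta> / t * x i)" for x :: "nat \<Rightarrow> real"
        by (auto simp: restrict_def)
      have "(\<integral>\<^sup>+x. indicator P x \<partial>PiL s) = ennreal ((\<theta> / t) ^ s) * (\<integral>\<^sup>+x. indicator P (\<lambda>i\<in>{..<s}. \<theta> / t * x i) \<partial>PiL s)"
        by (rule nn_integral_PiL_scale) (use True th in auto)
      then have "emeasure (PiL s) P = ennreal ((\<theta> / t) ^ s) * (\<integral>\<^sup>+x. indicator P (\<lambda>i\<in>{..<s}. \<theta> / t * x i) \<partial>PiL s)"
        by (simp only: nn_integral_indicator[OF P])
      moreover have "ennreal ((t / \<theta>) ^ s * (\<theta> / t) ^ s) = ennreal ((t / \<theta>) ^ s) * ennreal ((\<theta> / t) ^ s)"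
        using True th by (intro ennreal_mult) auto
      ultimately have "ennreal ((t / \<theta>) ^ s) * emeasure (PiL s) P
          = ennreal ((t / \<theta>) ^ s * (\<theta> / t) ^ s) * (\<integral>\<^sup>+x. indicator P (\<lambda>i\<in>{..<s}. \<theta> / t * x i) \<partial>PiL s)"
        by (simp only: mult.assoc)
      also have "(t / \<theta>) ^ s * (\<theta> / t) ^ s = 1" using True th by (simp add: power_mult_distrib[symmetric])
      finally have sc: "(\<integral>\<^sup>+x. indicator P (\<lambda>i\<in>{..<s}. \<theta> / t * x i) \<partial>PiL s) = ennreal ((t / \<theta>) ^ s) * emeasure (PiL s) P"
        by (simp only: ennreal_1 mult_1_left)
      have mi: "(\<lambda>x. indicator P (\<lambda>i\<in>{..<s}. \<theta> / t * x i) :: ennreal) \<in> borel_measurable (PiL s)"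
      proof -
        have [measurable]: "(\<lambda>x. \<lambda>i\<in>{..<s}. \<theta> / t * x i) \<in> PiL s \<rightarrow>\<^sub>M PiL s"
          by (intro measurable_restrict) measurable
        show ?thesis by measurable
      qed
      have "(\<integral>\<^sup>+x. ?f (x(s := t)) \<partial>PiL s) = (\<integral>\<^sup>+x. indicator P (\<lambda>i\<in>{..<s}. \<theta> / t * x i) * ennreal (exp (- (\<theta> * t))) \<partial>PiL s)"
        by (intro nn_integral_cong) (simp only: indicator_def mem_Collect_eq fun_upd_same eq True simp_thms)
      also have "\<dots> = (ennreal ((t / \<theta>) ^ s) * emeasure (PiL s) P) * ennreal (exp (- (\<theta> * t)))"
        by (subst nn_integral_multc[OF mi]) (simp_all only: sc)
      finally show ?thesis using True th by (simp add: ennreal_mult mult.commute mult.left_commute)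
    next
      case False then show ?thesis by (simp add: indicator_def)
    qed
  qed
  also have "\<dots> = emeasure (PiL s) P * ennreal (fact s / \<theta> ^ (2 * s + 1))"
    by (subst nn_integral_cmult) (auto simp: nn_integral_power_exp_scaled[OF th])
  finally show ?thesis .
qed

section \<open>Volumes of polytopes\<close>

lemma sum_over_enumeration:
  fixes h :: "nat \<Rightarrow> 'n::finite" and F :: "'n \<Rightarrow> real"
  assumes h: "bij_betw h {..<CARD('n)} UNIV" and m: "m \<le> CARD('n)"
  shows "(\<Sum>l\<in>UNIV. F l) = (\<Sum>a<m. F (h a)) + (\<Sum>a\<in>{m..<CARD('n)}. F (h a))"
proof -
  have "(\<Sum>l\<in>UNIV. F l) = (\<Sum>a<CARD('n). F (h a))"
    by (rule sum.reindex_bij_betw[OF h, symmetric])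
  also have "{..<CARD('n)} = {..<m} \<union> {m..<CARD('n)}" using m by auto
  also have "(\<Sum>a\<in>{..<m} \<union> {m..<CARD('n)}. F (h a)) = (\<Sum>a<m. F (h a)) + (\<Sum>a\<in>{m..<CARD('n)}. F (h a))"
    by (rule sum.union_disjoint) auto
  finally show ?thesis .
qed

definition embed_vec :: "(nat \<Rightarrow> 'n::finite) \<Rightarrow> nat \<Rightarrow> (nat \<Rightarrow> real) \<Rightarrow> real^'n" where
  "embed_vec h m w = (\<Sum>a<m. w a *\<^sub>R axis (h a) 1)"

lemma embed_vec_nth:
  fixes h :: "nat \<Rightarrow> 'n::finite"
  assumes h: "bij_betw h {..<CARD('n)} UNIV" and m: "m \<le> CARD('n)" and b: "b < CARD('n)"
  shows "embed_vec h m w $ h b = (if b < m then w b else 0)"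
proof -
  have inj: "h a = h b \<longleftrightarrow> a = b" if "a < m" for a
    using h that m b by (auto simp: bij_betw_def inj_on_def)
  have "embed_vec h m w $ h b = (\<Sum>a<m. w a * (if a = b then 1 else 0))"
    using inj by (auto simp: embed_vec_def axis_def eq_commute[of "h b"] intro!: sum.cong)
  then show ?thesis by (simp add: if_distrib cong: if_cong)
qed

lemma inner_embed_vec:
  fixes h :: "nat \<Rightarrow> 'n::finite"
  shows "embed_vec h m w \<bullet> x = (\<Sum>a<m. w a * x $ h a)"
  by (simp add: embed_vec_def inner_sum_left inner_axis')

lemma inner_embed_embed:
  fixes h :: "nat \<Rightarrow> 'n::finite"
  assumes h: "bij_betw h {..<CARD('n)} UNIV" and m: "m \<le> CARD('n)"
  shows "embed_vec h m w \<bullet> embed_vec h m w' = (\<Sum>a<m. w a * w' a)"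
  using m by (simp add: inner_embed_vec embed_vec_nth[OF h m])

text \<open>The frame is completed by the remaining coordinate vectors, with weight \<open>1\<close>
  and the uniform density on \<open>{0<..<1}\<close>. The extra constraints cut out exactly the unit
  slab, so the integral is the one on the model space.\<close>

lemma brascamp_lieb_PiL:
  fixes h :: "nat \<Rightarrow> 'n::{finite,wellorder}" and q :: "'i \<Rightarrow> nat \<Rightarrow> real"
  assumes h: "bij_betw h {..<CARD('n)} UNIV" and m: "m \<le> CARD('n)"
    and fin: "finite I" and c: "\<And>i. i \<in> I \<Longrightarrow> c i \<ge> 0" and unit: "\<And>i. i \<in> I \<Longrightarrow> (\<Sum>a<m. (q i a)^2) = 1"
    and frame: "\<And>x. (\<Sum>i\<in>I. c i * (\<Sum>a<m. q i a * x a)^2) = (\<Sum>a<m. (x a)^2)"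
    and tr: "\<And>i. i \<in> I \<Longrightarrow> gauss_transport (S i) (f i)"
    and f[measurable]: "\<And>i. i \<in> I \<Longrightarrow> f i \<in> borel_measurable borel"
  shows "(\<integral>\<^sup>+x. ennreal (\<Prod>i\<in>I. f i (\<Sum>a<m. q i a * x a) powr c i) *
     indicator {x. \<forall>i\<in>I. (\<Sum>a<m. q i a * x a) \<in> S i} x \<partial>PiL m) \<le> 1"
proof -
  let ?G = "\<lambda>x. ennreal (\<Prod>i\<in>I. f i (\<Sum>a<m. q i a * x a) powr c i) *
     indicator {x. \<forall>i\<in>I. (\<Sum>a<m. q i a * x a) \<in> S i} x"
  let ?J = "{m..<CARD('n)}"
  let ?e = "case_sum (\<lambda>i. embed_vec h m (q i)) (\<lambda>j. axis (h j) 1)"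
  let ?c = "case_sum c (\<lambda>_. 1)" and ?S = "case_sum S (\<lambda>_. {0<..<1::real})" and ?f = "case_sum f (\<lambda>_ _. 1)"
  have G: "?G \<in> borel_measurable (PiL m)"
  proof -
    have l[measurable]: "(\<lambda>x. \<Sum>a<m. q i a * x a) \<in> borel_measurable (PiL m)" for i
      by (intro borel_measurable_sum borel_measurable_times) auto
    have [measurable]: "S i \<in> sets borel" if "i \<in> I" for i
      using tr[OF that] by (simp add: gauss_transport_def)
    have "?G = (\<lambda>x. ennreal (\<Prod>i\<in>I. f i (\<Sum>a<m. q i a * x a) powr c i) * (\<Prod>i\<in>I. indicator (S i) (\<Sum>a<m. q i a * x a)))"
      using fin by (intro ext arg_cong2[where f = "(*)"] refl) (auto simp: indicator_def)
    also have "\<dots> \<in> borel_measurable (PiL m)"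
    proof (intro borel_measurable_times_ennreal measurable_compose[OF _ measurable_ennreal] borel_measurable_prod borel_measurable_prod_ennreal powr_real_measurable)
      fix i assume i: "i \<in> I"
      show "(\<lambda>x. f i (\<Sum>a<m. q i a * x a)) \<in> borel_measurable (PiL m)" using measurable_compose[OF l f[OF i]] .
      show "(\<lambda>x. indicator (S i) (\<Sum>a<m. q i a * x a) :: ennreal) \<in> borel_measurable (PiL m)"
        using i by (intro measurable_compose[OF l]) auto
    qed auto
    finally show ?thesis .
  qed
  have "(\<integral>\<^sup>+x. ?G x \<partial>PiL m) = (\<integral>\<^sup>+x. ?G (coords h m x) * indicator (unit_slab h m) x \<partial>lborel)"
    by (rule nn_integral_PiL[OF h m G])
  also have "\<dots> = (\<integral>\<^sup>+x. ennreal (\<Prod>k\<in>I <+> ?J. ?f k (?e k \<bullet> x) powr ?c k) *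
      indicator {x. \<forall>k\<in>I <+> ?J. ?e k \<bullet> x \<in> ?S k} x \<partial>lborel)"
  proof (rule nn_integral_cong)
    fix x :: "real^('n::{finite,wellorder})"
    have co: "(\<Sum>a<m. q i a * coords h m x a) = embed_vec h m (q i) \<bullet> x" for i
      by (simp add: inner_embed_vec coords_def)
    have "(\<Prod>k\<in>I <+> ?J. ?f k (?e k \<bullet> x) powr ?c k) = (\<Prod>i\<in>I. f i (embed_vec h m (q i) \<bullet> x) powr c i)"
      using fin by (subst prod.Plus) auto
    moreover have "(\<forall>k\<in>I <+> ?J. ?e k \<bullet> x \<in> ?S k) \<longleftrightarrow> (\<forall>i\<in>I. embed_vec h m (q i) \<bullet> x \<in> S i) \<and> x \<in> unit_slab h m"
      by (simp add: unit_slab_def inner_axis' Plus_def ball_Un)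
    ultimately show "?G (coords h m x) * indicator (unit_slab h m) x = ennreal (\<Prod>k\<in>I <+> ?J. ?f k (?e k \<bullet> x) powr ?c k) *
      indicator {x. \<forall>k\<in>I <+> ?J. ?e k \<bullet> x \<in> ?S k} x"
      unfolding co by (auto simp: indicator_def co)
  qed
  also have "\<dots> \<le> 1"
  proof (rule brascamp_lieb_rank_one)
    show "norm (?e k) = 1" if "k \<in> I <+> ?J" for k
      using that unit by (auto simp: norm_eq_1 inner_embed_embed[OF h m] power2_eq_square[symmetric] inner_axis_axis)
    show "(\<Sum>k\<in>I <+> ?J. ?c k * (?e k \<bullet> x)^2) = x \<bullet> x" for x
    proof -
      have "(\<Sum>k\<in>I <+> ?J. ?c k * (?e k \<bullet> x)^2) = (\<Sum>i\<in>I. c i * (embed_vec h m (q i) \<bullet> x)^2) + (\<Sum>j\<in>?J. (x $ h j)^2)"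
        using fin by (subst sum.Plus) (auto simp: inner_axis')
      also have "(\<Sum>i\<in>I. c i * (embed_vec h m (q i) \<bullet> x)^2) = (\<Sum>a<m. (x $ h a)^2)"
        using frame[of "\<lambda>a. x $ h a"] by (simp add: inner_embed_vec)
      also have "\<dots> + (\<Sum>j\<in>?J. (x $ h j)^2) = x \<bullet> x"
        unfolding inner_vec_def by (subst sum_over_enumeration[OF h m]) (simp add: power2_eq_square)
      finally show ?thesis .
    qed
    show "gauss_transport (?S k) (?f k)" if "k \<in> I <+> ?J" for k
      using that tr gauss_transport_uniform[of 0 1] by auto
  qed (use fin c in auto)
  finally show ?thesis .
qed

lemma polytope_sets [measurable]:
  assumes [simp]: "finite U"
  shows "{x \<in> space (PiL m). \<forall>u\<in>U. (\<Sum>a<m. w u a * x a) < (1::real)} \<in> sets (PiL m)"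
    "{x \<in> space (PiL m). \<forall>u\<in>U. (\<Sum>a<m. w u a * x a) \<le> (1::real)} \<in> sets (PiL m)"
proof -
  have [measurable]: "(\<lambda>x. \<Sum>a<m. w u a * x a) \<in> borel_measurable (PiL m)" for u
    by (intro borel_measurable_sum borel_measurable_times) auto
  show "{x \<in> space (PiL m). \<forall>u\<in>U. (\<Sum>a<m. w u a * x a) < (1::real)} \<in> sets (PiL m)"
    "{x \<in> space (PiL m). \<forall>u\<in>U. (\<Sum>a<m. w u a * x a) \<le> (1::real)} \<in> sets (PiL m)" by measurable
qed

text \<open>Transport works on open intervals, so only the open polytope is estimated directly. The
  closed one is contained in every dilate of the open one by a factor \<open>r > 1\<close>, and
  \<open>r ^ m\<close> tends to \<open>1\<close>.\<close>

lemma emeasure_closed_polytope_le: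
  assumes fin: "finite U" and B: "B \<ge> 0"
    and le: "emeasure (PiL m) {x \<in> space (PiL m). \<forall>u\<in>U. (\<Sum>a<m. w u a * x a) < 1} \<le> ennreal B"
  shows "emeasure (PiL m) {x \<in> space (PiL m). \<forall>u\<in>U. (\<Sum>a<m. w u a * x a) \<le> 1} \<le> ennreal B"
proof -
  let ?C = "{x \<in> space (PiL m). \<forall>u\<in>U. (\<Sum>a<m. w u a * x a) \<le> 1}"
  let ?O = "{x \<in> space (PiL m). \<forall>u\<in>U. (\<Sum>a<m. w u a * x a) < 1}"
  have [measurable]: "?C \<in> sets (PiL m)" "?O \<in> sets (PiL m)" using polytope_sets[OF fin] by auto
  have step: "emeasure (PiL m) ?C \<le> ennreal (r ^ m * B)" if r: "r > 1" for r
  proof -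
    have "emeasure (PiL m) ?C = (\<integral>\<^sup>+x. indicator ?C x \<partial>PiL m)" by simp
    also have "\<dots> = ennreal (r ^ m) * (\<integral>\<^sup>+x. indicator ?C (\<lambda>i\<in>{..<m}. r * x i) \<partial>PiL m)"
      by (rule nn_integral_PiL_scale) (use r in auto)
    also have "\<dots> \<le> ennreal (r ^ m) * (\<integral>\<^sup>+x. indicator ?O x \<partial>PiL m)"
    proof (intro mult_left_mono nn_integral_mono)
      fix x assume x: "x \<in> space (PiL m)"
      have "(\<Sum>a<m. w u a * x a) < 1" if "(\<Sum>a<m. w u a * (\<lambda>i\<in>{..<m}. r * x i) a) \<le> 1" for u
      proof -
        have "r * (\<Sum>a<m. w u a * x a) \<le> 1" using that by (simp add: sum_distrib_left mult.left_commute)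
        then have "(\<Sum>a<m. w u a * x a) \<le> 1 / r" using r by (simp add: field_simps)
        also have "1 / r < 1" using r by simp
        finally show ?thesis .
      qed
      then show "indicator ?C (\<lambda>i\<in>{..<m}. r * x i) \<le> (indicator ?O x :: ennreal)"
        using x by (auto simp: indicator_def)
    qed simp
    also have "\<dots> \<le> ennreal (r ^ m) * ennreal B" using le by (intro mult_left_mono) auto
    also have "\<dots> = ennreal (r ^ m * B)" using r B by (intro ennreal_mult[symmetric]) auto
    finally show ?thesis .
  qed
  show ?thesis
  proof (rule LIMSEQ_le_const)
    have "(\<lambda>k. (1 + 1 / real (Suc k)) ^ m * B) \<longlonglongrightarrow> (1 + 0) ^ m * B"
      by (intro tendsto_intros LIMSEQ_Suc[OF lim_inverse_n'])
    then show "(\<lambda>k. ennreal ((1 + 1 / real (Suc k)) ^ m * B)) \<longlonglongrightarrow> ennreal B"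
      by (intro tendsto_ennrealI) simp
    show "\<exists>N. \<forall>k\<ge>N. emeasure (PiL m) ?C \<le> ennreal ((1 + 1 / real (Suc k)) ^ m * B)"
      by (intro exI allI impI step) simp
  qed
qed

lemma frame_trace:
  fixes v :: "'i \<Rightarrow> nat \<Rightarrow> real"
  assumes frame: "\<And>x. (\<Sum>u\<in>U. l u * (\<Sum>a<s. v u a * x a)^2) = (\<Sum>a<s. (x a)^2)"
  shows "(\<Sum>u\<in>U. l u * (\<Sum>a<s. (v u a)^2)) = real s"
proof -
  have "(\<Sum>u\<in>U. l u * (\<Sum>a<s. (v u a)^2)) = (\<Sum>b<s. \<Sum>u\<in>U. l u * (v u b)^2)"
    unfolding sum_distrib_left by (rule sum.swap)
  also have "\<dots> = (\<Sum>b<s. 1)"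
  proof (rule sum.cong[OF refl])
    fix b assume b: "b \<in> {..<s}"
    have "(\<Sum>u\<in>U. l u * (\<Sum>a<s. v u a * (if a = b then 1 else 0))^2) = (\<Sum>a<s. (if a = b then 1 else 0 :: real)^2)"
      by (rule frame)
    moreover have "(\<Sum>a<s. v u a * (if a = b then 1 else 0)) = v u b" for u
      using b by (simp add: if_distrib cong: if_cong)
    moreover have "(\<Sum>a<s. (if a = b then 1 else 0 :: real)^2) = (\<Sum>a<s. if a = b then 1 else 0)"
      by (intro sum.cong) auto
    ultimately show "(\<Sum>u\<in>U. l u * (v u b)^2) = 1" using b by simp
  qed
  finally show ?thesis by simp
qed

text \<open>Brascamp--Lieb for the unit vectors \<open>v\<^sub>u / |v\<^sub>u|\<close> and uniform densities on \<open>(-1 / |v\<^sub>u|, 1 / |v\<^sub>u|)\<close>; the product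
  of the norms is then estimated by AM-GM.\<close>

lemma symmetric_polytope_volume_le:
  fixes h :: "nat \<Rightarrow> 'n::{finite,wellorder}" and v :: "'i \<Rightarrow> nat \<Rightarrow> real"
  assumes h: "bij_betw h {..<CARD('n)} UNIV" and s: "1 \<le> s" "s \<le> CARD('n)"
    and fin: "finite U" and l: "\<And>u. u \<in> U \<Longrightarrow> 0 \<le> l u" "(\<Sum>u\<in>U. l u) = d"
    and frame: "\<And>x. (\<Sum>u\<in>U. l u * (\<Sum>a<s. v u a * x a)^2) = (\<Sum>a<s. (x a)^2)"
  shows "emeasure (PiL s) {x \<in> space (PiL s). \<forall>u\<in>U. \<bar>\<Sum>a<s. v u a * x a\<bar> \<le> 1} \<le> ennreal ((2 * sqrt (d / s)) ^ s)"
proof -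
  define N where "N = (\<lambda>u. sqrt (\<Sum>a<s. (v u a)^2))"
  have N2: "(N u)^2 = (\<Sum>a<s. (v u a)^2)" for u by (simp add: N_def sum_nonneg)
  \<comment> \<open>Vanishing vectors have no direction and impose no constraint. They drop out of
    the frame identity, but their weight remains in \<open>d\<close>; hence only an inequality for
    the sum of \<open>l\<close> over \<open>I\<close> below.\<close>
  define I where "I = {u \<in> U. N u \<noteq> 0}"
  have finI: "finite I" using fin by (simp add: I_def)
  have Npos: "N u > 0" if "u \<in> I" for u
  proof -
    have "N u \<ge> 0" by (simp add: N_def sum_nonneg)
    then show ?thesis using that by (simp add: I_def)
  qed
  have v0: "v u a = 0" if "u \<in> U - I" "a < s" for u a
  proof -
    have "(\<Sum>a<s. (v u a)^2) = 0" using that N2[of u] by (simp add: I_def)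
    then show ?thesis using that by (simp add: sum_nonneg_eq_0_iff)
  qed
  define c where "c = (\<lambda>u. l u * (N u)^2)"
  have c: "c u \<ge> 0" if "u \<in> I" for u using l that by (simp add: c_def I_def)
  have sumI: "(\<Sum>u\<in>I. l u * g u) = (\<Sum>u\<in>U. l u * g u)" if "\<And>u. u \<in> U - I \<Longrightarrow> g u = 0" for g
    by (rule sum.mono_neutral_left) (use fin that in \<open>auto simp: I_def\<close>)
  have csum: "(\<Sum>u\<in>I. c u) = s"
    using frame_trace[OF frame] sumI[of "\<lambda>u. (N u)^2"] by (auto simp: c_def N2[symmetric] I_def)
  have d: "d > 0"
  proof -
    have "d \<ge> 0" using l by (auto intro: sum_nonneg)
    moreover have "d \<noteq> 0"
    proof
      assume "d = 0"
      then have "\<forall>u\<in>U. l u = 0" using l fin by (simp add: sum_nonneg_eq_0_iff)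
      then have "(\<Sum>u\<in>I. c u) = 0" by (intro sum.neutral) (auto simp: c_def I_def)
      then show False using csum s by simp
    qed
    ultimately show ?thesis by simp
  qed
  let ?O = "{x. \<forall>u\<in>I. (\<Sum>a<s. v u a / N u * x a) \<in> {- 1 / N u <..< 1 / N u}}"
  have BL: "(\<integral>\<^sup>+x. ennreal (\<Prod>u\<in>I. (1 / (1 / N u - (- 1 / N u))) powr c u) * indicator ?O x \<partial>PiL s) \<le> 1"
  proof (rule brascamp_lieb_PiL[OF h s(2) finI c, where f = "\<lambda>u _. 1 / (1 / N u - (- 1 / N u))"])
    show "(\<Sum>a<s. (v u a / N u)^2) = 1" if "u \<in> I" for u
      using Npos[OF that] by (simp add: power_divide sum_divide_distrib[symmetric] N2[symmetric])
    show "gauss_transport {- 1 / N u <..< 1 / N u} (\<lambda>_. 1 / (1 / N u - (- 1 / N u)))" if "u \<in> I" for u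
      using Npos[OF that] by (intro gauss_transport_uniform) (simp add: divide_strict_right_mono)
    show "(\<Sum>u\<in>I. c u * (\<Sum>a<s. v u a / N u * x a)^2) = (\<Sum>a<s. (x a)^2)" for x
    proof -
      have "(\<Sum>u\<in>I. c u * (\<Sum>a<s. v u a / N u * x a)^2) = (\<Sum>u\<in>I. l u * (\<Sum>a<s. v u a * x a)^2)"
      proof (rule sum.cong[OF refl])
        fix u assume u: "u \<in> I"
        have "(\<Sum>a<s. v u a / N u * x a) = (\<Sum>a<s. v u a * x a) / N u" by (simp add: sum_divide_distrib)
        then show "c u * (\<Sum>a<s. v u a / N u * x a)^2 = l u * (\<Sum>a<s. v u a * x a)^2"
          using Npos[OF u] by (simp add: c_def power_divide)
      qed
      also have "\<dots> = (\<Sum>u\<in>U. l u * (\<Sum>a<s. v u a * x a)^2)" by (rule sumI) (simp add: v0)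
      finally show ?thesis unfolding frame .
    qed
  qed auto
  define Q where "Q = (\<Prod>u\<in>I. (N u / 2) powr c u)"
  have Q: "Q > 0" unfolding Q_def using Npos by (intro prod_pos) (auto simp: powr_gt_zero less_imp_neq[symmetric])
  \<comment> \<open>The Boolean selects one of the two half-spaces that make up a slab, so that the
    passage from open to closed polytopes applies.\<close>
  let ?w = "\<lambda>(u, b) a. (if b then v u a else - v u a)"
  let ?P = "{x \<in> space (PiL s). \<forall>k\<in>U \<times> UNIV. (\<Sum>a<s. ?w k a * x a) < 1}"
  have Psets: "?P \<in> sets (PiL s)" by (rule polytope_sets) (use fin in simp)
  have sub: "x \<in> ?O" if "x \<in> ?P" for x
  proof -
    have "(\<Sum>a<s. v u a / N u * x a) \<in> {- 1 / N u <..< 1 / N u}" if u: "u \<in> I" for u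
    proof -
      have "u \<in> U" using u by (simp add: I_def)
      then have "(\<Sum>a<s. ?w (u, True) a * x a) < 1" "(\<Sum>a<s. ?w (u, False) a * x a) < 1"
        using \<open>x \<in> ?P\<close> by blast+
      then have "(\<Sum>a<s. v u a * x a) < 1" "- (\<Sum>a<s. v u a * x a) < 1" by (simp_all add: sum_negf)
      moreover have "(\<Sum>a<s. v u a / N u * x a) = (\<Sum>a<s. v u a * x a) / N u" by (simp add: sum_divide_distrib)
      ultimately show ?thesis using Npos[OF u] by (auto simp: divide_simps)
    qed
    then show ?thesis by simp
  qed
  have "ennreal Q * emeasure (PiL s) ?P = (\<integral>\<^sup>+x. ennreal Q * indicator ?P x \<partial>PiL s)"
    using Psets by (subst nn_integral_cmult_indicator) auto
  also have "\<dots> \<le> (\<integral>\<^sup>+x. ennreal (\<Prod>u\<in>I. (1 / (1 / N u - (- 1 / N u))) powr c u) * indicator ?O x \<partial>PiL s)"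
  proof (rule nn_integral_mono)
    fix x
    have "Q = (\<Prod>u\<in>I. (1 / (1 / N u - (- 1 / N u))) powr c u)"
      unfolding Q_def using Npos by (intro prod.cong) (auto simp: field_simps)
    then show "ennreal Q * indicator ?P x \<le> ennreal (\<Prod>u\<in>I. (1 / (1 / N u - (- 1 / N u))) powr c u) * indicator ?O x"
      using sub[of x] by (auto simp: indicator_def)
  qed
  also note BL
  finally have QP: "ennreal Q * emeasure (PiL s) ?P \<le> 1" .
  have "ennreal (1 / Q) * (ennreal Q * emeasure (PiL s) ?P) \<le> ennreal (1 / Q) * 1"
    using QP by (intro mult_left_mono) auto
  moreover have "ennreal (1 / Q) * (ennreal Q * emeasure (PiL s) ?P) = emeasure (PiL s) ?P"
    using Q by (simp add: mult.assoc[symmetric] ennreal_mult[symmetric])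
  ultimately have P1: "emeasure (PiL s) ?P \<le> ennreal (1 / Q)" by simp
  have Qle: "1 / Q \<le> (2 * sqrt (d / s)) ^ s"
  proof -
    \<comment> \<open>The weights \<open>c\<close> have total \<open>s\<close>, and the sum of
      \<open>c u / (N u)^2\<close> is at most \<open>d\<close>. So \<theta> bounds the mean of
      \<open>1 / (N u)^2\<close>, and the tangent of \<open>ln\<close> at \<theta> gives AM-GM with
      the right constant.\<close>
    define \<theta> where "\<theta> = d / s"
    have th: "\<theta> > 0" using d s by (simp add: \<theta>_def)
    have lnN: "- 2 * ln (N u) \<le> 1 / (N u)^2 / \<theta> - 1 + ln \<theta>" if "u \<in> I" for u
      using ln_le_minus_one[of "1 / (N u)^2 / \<theta>"] Npos[OF that] th
      by (simp add: ln_div ln_mult ln_realpow)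
    have "- 2 * (\<Sum>u\<in>I. c u * ln (N u)) = (\<Sum>u\<in>I. c u * (- 2 * ln (N u)))"
      by (simp add: sum_distrib_left algebra_simps sum_negf)
    also have "\<dots> \<le> (\<Sum>u\<in>I. c u * (1 / (N u)^2 / \<theta> - 1 + ln \<theta>))"
      using lnN c by (intro sum_mono mult_left_mono) auto
    also have "\<dots> = (\<Sum>u\<in>I. c u / (N u)^2) / \<theta> - (\<Sum>u\<in>I. c u) + (\<Sum>u\<in>I. c u) * ln \<theta>"
      by (simp add: algebra_simps sum.distrib sum_subtractf sum_divide_distrib sum_distrib_left)
    also have "(\<Sum>u\<in>I. c u / (N u)^2) = (\<Sum>u\<in>I. l u)"
      using Npos by (intro sum.cong) (auto simp: c_def I_def)
    also have "(\<Sum>u\<in>I. l u) \<le> d" unfolding l(2)[symmetric]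
      using l(1) fin by (intro sum_mono2) (auto simp: I_def)
    finally have main: "- 2 * (\<Sum>u\<in>I. c u * ln (N u)) \<le> s * ln \<theta>"
      using th s d by (simp add: csum divide_right_mono \<theta>_def)
    have "ln (1 / Q) = (\<Sum>u\<in>I. c u * (ln 2 - ln (N u)))"
    proof -
      have "ln Q = (\<Sum>u\<in>I. c u * ln (N u / 2))"
        unfolding Q_def using Npos finI by (subst ln_prod) (auto simp: ln_powr dest: Npos)
      also have "\<dots> = - (\<Sum>u\<in>I. c u * (ln 2 - ln (N u)))"
        unfolding sum_negf[symmetric] by (intro sum.cong) (auto simp: ln_div algebra_simps dest: Npos)
      finally show ?thesis using Q by (simp add: ln_div)
    qed
    also have "\<dots> = s * ln 2 - (\<Sum>u\<in>I. c u * ln (N u))"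
      by (simp add: right_diff_distrib sum_subtractf sum_distrib_right[symmetric] csum)
    also have "\<dots> \<le> s * ln 2 + s * ln \<theta> / 2" using main by simp
    also have "\<dots> = ln ((2 * sqrt \<theta>) ^ s)" using th by (simp add: ln_realpow ln_mult ln_sqrt algebra_simps)
    finally show ?thesis using Q th by (simp add: \<theta>_def)
  qed
  have "emeasure (PiL s) {x \<in> space (PiL s). \<forall>k\<in>U \<times> UNIV. (\<Sum>a<s. ?w k a * x a) \<le> 1} \<le> ennreal (1 / Q)"
    using fin Q P1 by (intro emeasure_closed_polytope_le) auto
  also have "{x \<in> space (PiL s). \<forall>k\<in>U \<times> UNIV. (\<Sum>a<s. ?w k a * x a) \<le> 1}
     = {x \<in> space (PiL s). \<forall>u\<in>U. \<bar>\<Sum>a<s. v u a * x a\<bar> \<le> 1}"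
    by (auto simp: sum_negf UNIV_bool abs_le_iff)
  finally show ?thesis using Qle by (meson ennreal_leI order_trans)
qed

section \<open>John's decomposition for ellipsoids of revolution\<close>

text \<open>The matrices of \<open>F\<close>-operators in coordinates for which \<open>P\<close> spans \<open>F\<close>, except for invertibility.\<close>

definition block_scalar :: "'n set \<Rightarrow> real^'n^'n \<Rightarrow> bool" where
  "block_scalar P M \<longleftrightarrow> (\<exists>g. \<forall>i j. i \<notin> P \<or> j \<notin> P \<longrightarrow> M $ i $ j = (if i = j then g else 0))"

text \<open>The inverse of \<open>1 + \<epsilon> H\<close> is used instead of
  \<open>1 - \<epsilon> H\<close>: AM-GM gives \<open>det (1 + \<epsilon> H) \<le> 1\<close>, so the
  inverse loses no volume at all, not even to second order. Since \<open>N\<close> is symmetric,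
  \<open>norm (N *v u)\<close> is the support function of the image of the unit ball.\<close>

lemma symmetric_perturbation_inverse:
  fixes H :: "real^'n^'n" and \<epsilon> :: real
  assumes sym: "transpose H = H" and tr: "trace H = 0" and blk: "block_scalar P H"
    and C: "\<And>x. norm (H *v x) \<le> C * norm x" and e: "0 < \<epsilon>" "\<epsilon> * C \<le> 1 / 2" "C \<ge> 0"
  obtains N :: "real^'n^'n" where "block_scalar P N" "det N \<ge> 1"
    "\<And>x y. (N *v x) \<bullet> y = x \<bullet> (N *v y)"
    "\<And>u. norm u = 1 \<Longrightarrow> norm (N *v u) \<le> 1 - \<epsilon> * (u \<bullet> (H *v u)) + 6 * \<epsilon>^2 * C^2"
proof -
  define M where "M = mat 1 + \<epsilon> *\<^sub>R H"
  have Mx: "M *v x = x + \<epsilon> *\<^sub>R (H *v x)" for x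
    by (simp add: M_def matrix_vector_mult_add_rdistrib scaleR_matrix_vector_assoc)
  have symM: "transpose M = M" using sym by (simp add: M_def transpose_def vec_eq_iff mat_def)
  have Hb: "\<bar>x \<bullet> (H *v y)\<bar> \<le> C * norm x * norm y" for x y
  proof -
    have "\<bar>x \<bullet> (H *v y)\<bar> \<le> norm x * norm (H *v y)" by (rule Cauchy_Schwarz_ineq2)
    also have "\<dots> \<le> norm x * (C * norm y)" using C by (intro mult_left_mono) auto
    finally show ?thesis by (simp add: algebra_simps)
  qed
  have low: "x \<bullet> (M *v x) \<ge> (x \<bullet> x) / 2" for x
  proof -
    have "\<epsilon> * (x \<bullet> (H *v x)) \<ge> - (\<epsilon> * (C * norm x * norm x))"
    proof -
      have "- (C * norm x * norm x) \<le> x \<bullet> (H *v x)" using Hb[of x x] by linarith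
      then have "\<epsilon> * (- (C * norm x * norm x)) \<le> \<epsilon> * (x \<bullet> (H *v x))" using e by (intro mult_left_mono) auto
      then show ?thesis by simp
    qed
    moreover have "\<epsilon> * (C * norm x * norm x) \<le> 1 / 2 * (norm x * norm x)"
      using mult_right_mono[OF e(2), of "norm x * norm x"] by (simp add: algebra_simps)
    ultimately show ?thesis by (simp add: Mx inner_add_right dot_square_norm power2_eq_square)
  qed
  have trM: "trace M = real CARD('n)"
    using tr by (simp add: M_def trace_def mat_def sum.distrib sum_distrib_left[symmetric])
  have "x \<bullet> (M *v x) \<ge> 0" for x using low[of x] inner_ge_zero[of x] by linarith
  then have det: "0 \<le> det M" "det M \<le> 1" using det_le_1_of_trace_le[OF symM _ trM] by auto
  have "inj ((*v) M)"
  proof (rule injI)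
    fix x y assume "M *v x = M *v y"
    then have "M *v (x - y) = 0" by (simp add: matrix_vector_mult_diff_distrib)
    then have "(x - y) \<bullet> (x - y) \<le> 0" using low[of "x - y"] by simp
    then have "(x - y) \<bullet> (x - y) = 0" using inner_ge_zero[of "x - y"] by linarith
    then show "x = y" by simp
  qed
  then have "invertible M" by (simp add: invertible_left_inverse matrix_left_invertible_injective)
  then obtain N where MN: "M ** N = mat 1" "N ** M = mat 1" by (auto simp: invertible_def)
  have detN: "det N \<ge> 1"
  proof -
    have "det M * det N = 1" using MN(1) by (metis det_I det_mul)
    moreover have "det N \<ge> 0"
    proof (rule ccontr)
      assume "\<not> det N \<ge> 0"
      then have "det M * det N \<le> 0" using det by (intro mult_nonneg_nonpos) auto
      then show False using \<open>det M * det N = 1\<close> by simp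
    qed
    then have "det M * det N \<le> 1 * det N" using det by (intro mult_right_mono)
    ultimately show ?thesis by simp
  qed
  have symN: "transpose N = N"
  proof -
    have "transpose N ** M = mat 1" using MN(1) symM
      using matrix_transpose_mul[of M N] by (simp add: transpose_mat)
    then have "(transpose N ** M) ** N = N" by simp
    moreover have "(transpose N ** M) ** N = transpose N"
      unfolding matrix_mul_assoc[symmetric] MN(1) by simp
    ultimately show ?thesis by simp
  qed
  have adjN: "(N *v x) \<bullet> y = x \<bullet> (N *v y)" for x y
  proof -
    have "N *v x = x v* N" using transpose_matrix_vector[of N x] symN by simp
    then show ?thesis using dot_lmul_matrix[of x N y] by simp
  qed
  have MNv: "M *v (N *v u) = u" for u by (simp add: matrix_vector_mul_assoc MN)
  have NMv: "N *v (M *v u) = u" for u by (simp add: matrix_vector_mul_assoc MN)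
  have blkN: "block_scalar P N"
  proof -
    obtain g where g: "\<And>i j. i \<notin> P \<or> j \<notin> P \<Longrightarrow> H $ i $ j = (if i = j then g else 0)"
      using blk by (auto simp: block_scalar_def)
    \<comment> \<open>A coordinate vector outside \<open>P\<close> is an eigenvector of
      \<open>H\<close>, hence of \<open>M\<close> and of its inverse. Symmetry of \<open>N\<close>
      transfers the statement to rows.\<close>
    have col: "N $ i $ j = (if i = j then 1 / (1 + \<epsilon> * g) else 0)" if j: "j \<notin> P" for i j
    proof -
      have "H *v axis j 1 = g *\<^sub>R axis j 1"
        using g j by (simp add: vec_eq_iff matrix_vector_mult_def axis_def if_distrib cong: if_cong)
      then have Me: "M *v axis j 1 = (1 + \<epsilon> * g) *\<^sub>R axis j 1" by (simp add: Mx algebra_simps)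
      have "N *v (M *v axis j 1) = axis j 1" by (rule NMv)
      then have eq: "(1 + \<epsilon> * g) *\<^sub>R (N *v axis j 1) = axis j 1" unfolding Me by (simp add: matrix_vector_mult_scaleR)
      then have "1 + \<epsilon> * g \<noteq> 0" by (auto simp: axis_eq_0_iff)
      then have "N *v axis j 1 = (1 / (1 + \<epsilon> * g)) *\<^sub>R axis j 1"
      proof -
        have "(1 / (1 + \<epsilon> * g)) *\<^sub>R ((1 + \<epsilon> * g) *\<^sub>R (N *v axis j 1)) = (1 / (1 + \<epsilon> * g)) *\<^sub>R axis j 1"
          by (simp only: eq)
        then show ?thesis using \<open>1 + \<epsilon> * g \<noteq> 0\<close> by simp
      qed
      moreover have "(N *v axis j 1) $ i = N $ i $ j" by (simp add: matrix_vector_mult_basis column_def)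
      ultimately have "N $ i $ j = (1 / (1 + \<epsilon> * g)) * (axis j 1 $ i)" by simp
      then show ?thesis by (simp add: axis_def)
    qed
    have "N $ i $ j = N $ j $ i" for i j using arg_cong[OF symN, of "\<lambda>A. A $ i $ j"] by (simp add: transpose_def)
    then have "i \<notin> P \<or> j \<notin> P \<Longrightarrow> N $ i $ j = (if i = j then 1 / (1 + \<epsilon> * g) else 0)" for i j
      using col[of j i] col[of i j] by auto
    then show ?thesis unfolding block_scalar_def by blast
  qed
  \<comment> \<open>With \<open>y = N *v u\<close> the unit length of
    \<open>u = y + \<epsilon> H y\<close> is expanded in \<open>y\<close>. From
    \<open>norm y \<le> 2\<close> and \<open>norm (y - u) \<le> 2 * (\<epsilon> * C)\<close>,
    replacing \<open>y\<close> by \<open>u\<close> in the quadratic form costs at most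
    \<open>C * (2 * \<epsilon> * C) * 3\<close>, the source of the constant
    \<open>6\<close>.\<close>
  have bound: "norm (N *v u) \<le> 1 - \<epsilon> * (u \<bullet> (H *v u)) + 6 * \<epsilon>^2 * C^2" if u: "norm u = 1" for u
  proof -
    define y where "y = N *v u"
    have uy: "u = y + \<epsilon> *\<^sub>R (H *v y)" using MNv[of u] by (simp add: Mx y_def)
    have "y = u - \<epsilon> *\<^sub>R (H *v y)" using uy by (simp add: algebra_simps)
    then have "norm y \<le> norm u + norm (\<epsilon> *\<^sub>R (H *v y))" by (metis norm_triangle_ineq4)
    moreover have nHy: "norm (\<epsilon> *\<^sub>R (H *v y)) \<le> (\<epsilon> * C) * norm y" using C[of y] e by simp
    moreover have "(\<epsilon> * C) * norm y \<le> 1 / 2 * norm y" using e by (intro mult_right_mono) auto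
    ultimately have y2: "norm y \<le> 2" using u by linarith
    have dy: "norm (y - u) \<le> 2 * (\<epsilon> * C)"
    proof -
      have "y - u = - (\<epsilon> *\<^sub>R (H *v y))" using uy by (simp add: algebra_simps)
      then have "norm (y - u) = norm (\<epsilon> *\<^sub>R (H *v y))" by (simp only: norm_minus_cancel)
      also have "\<dots> \<le> (\<epsilon> * C) * norm y" by (rule nHy)
      also have "\<dots> \<le> (\<epsilon> * C) * 2" using y2 e by (intro mult_left_mono) auto
      finally show ?thesis by simp
    qed
    have "y \<bullet> (H *v y) - u \<bullet> (H *v u) = (y - u) \<bullet> (H *v y) + u \<bullet> (H *v (y - u))"
      by (simp add: inner_diff_left inner_diff_right matrix_vector_mult_diff_distrib)
    also have "\<dots> \<ge> - (C * norm (y - u) * norm y) - C * norm u * norm (y - u)"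
      using Hb[of "y - u" y] Hb[of u "y - u"] by linarith
    also have "- (C * norm (y - u) * norm y) - C * norm u * norm (y - u) = - (C * norm (y - u) * (norm y + 1))"
      using u by (simp add: algebra_simps)
    finally have "y \<bullet> (H *v y) - u \<bullet> (H *v u) \<ge> - (C * norm (y - u) * (norm y + 1))" .
    moreover have "C * norm (y - u) * (norm y + 1) \<le> C * (2 * (\<epsilon> * C)) * 3"
      using dy y2 e by (intro mult_mono) auto
    ultimately have q: "y \<bullet> (H *v y) \<ge> u \<bullet> (H *v u) - 6 * \<epsilon> * C^2" by (simp add: power2_eq_square algebra_simps)
    have "1 = u \<bullet> u" using u by (simp add: norm_eq_1)
    also have "u \<bullet> u = (y + \<epsilon> *\<^sub>R (H *v y)) \<bullet> (y + \<epsilon> *\<^sub>R (H *v y))" using uy by simp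
    also have "\<dots> = (norm y)^2 + 2 * \<epsilon> * (y \<bullet> (H *v y)) + \<epsilon>^2 * (norm (H *v y))^2"
      by (simp add: inner_add_left inner_add_right inner_commute power2_norm_eq_inner power2_eq_square[of \<epsilon>] algebra_simps)
    finally have "1 = (norm y)^2 + 2 * \<epsilon> * (y \<bullet> (H *v y)) + \<epsilon>^2 * (norm (H *v y))^2" .
    then have "(norm y)^2 \<le> 1 - 2 * \<epsilon> * (y \<bullet> (H *v y))"
    proof -
      have "0 \<le> \<epsilon>^2 * (norm (H *v y))^2" by simp
      then show ?thesis using \<open>1 = (norm y)^2 + 2 * \<epsilon> * (y \<bullet> (H *v y)) + \<epsilon>^2 * (norm (H *v y))^2\<close> by linarith
    qed
    also have "\<dots> \<le> 1 - 2 * \<epsilon> * (u \<bullet> (H *v u) - 6 * \<epsilon> * C^2)" using q e by simp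
    finally have "(norm y)^2 \<le> 1 + 2 * (- \<epsilon> * (u \<bullet> (H *v u)) + 6 * \<epsilon>^2 * C^2)"
      by (simp add: power2_eq_square algebra_simps)
    moreover have "2 * norm y \<le> 1 + (norm y)^2" using zero_le_power2[of "norm y - 1"] by (simp add: power2_diff)
    ultimately show ?thesis by (simp add: y_def)
  qed
  show ?thesis by (rule that[OF blkN detN adjN bound])
qed

text \<open>Directions in which the body reaches at most \<open>1 + 1 / (k + 1)\<close> form
  decreasing compact sets with empty intersection, so one of them is empty. This gives a margin
  uniform over all directions that stay away from contact.\<close>

lemma support_gap:
  fixes K T :: "'b::euclidean_space set"
  assumes T: "compact T" and gt: "\<And>u. u \<in> T \<Longrightarrow> \<exists>x\<in>K. x \<bullet> u > 1"
  obtains \<eta> :: real where "\<eta> > 0" "\<And>u. u \<in> T \<Longrightarrow> \<exists>x\<in>K. x \<bullet> u > 1 + \<eta>"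
proof -
  define F where "F = (\<lambda>k::nat. T \<inter> {u. \<forall>x\<in>K. x \<bullet> u \<le> 1 + 1 / real (Suc k)})"
  have "closed {u. \<forall>x\<in>K. x \<bullet> u \<le> 1 + 1 / real (Suc k)}" for k
  proof -
    have "{u. \<forall>x\<in>K. x \<bullet> u \<le> 1 + 1 / real (Suc k)} = (\<Inter>x\<in>K. {u. x \<bullet> u \<le> 1 + 1 / real (Suc k)})" by auto
    then show ?thesis by (auto simp: closed_halfspace_le)
  qed
  then have "compact (F k)" for k unfolding F_def using T by (simp add: compact_Int_closed)
  moreover have "F n \<subseteq> F m" if "m \<le> n" for m n
  proof -
    have "1 / real (Suc n) \<le> 1 / real (Suc m)" using that by (simp add: field_simps)
    then show ?thesis by (force simp: F_def)
  qed
  moreover have "(\<Inter>k. F k) = {}"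
  proof (rule ccontr)
    assume "(\<Inter>k. F k) \<noteq> {}"
    then obtain u where u: "\<And>k. u \<in> F k" by blast
    then have "u \<in> T" by (auto simp: F_def)
    then obtain x where x: "x \<in> K" "x \<bullet> u > 1" using gt by blast
    obtain k where "1 / real (Suc k) < x \<bullet> u - 1" using x(2) nat_approx_posE[of "x \<bullet> u - 1"] by auto
    then show False using u[of k] x(1) by (force simp: F_def)
  qed
  ultimately obtain k where "F k = {}" using compact_nest[of F] by blast
  then show ?thesis by (intro that[of "1 / real (Suc k)"]) (force simp: F_def not_le)+
qed

text \<open>The orthogonal projection of \<open>u u\<^sup>T\<close> to the block scalar matrices.\<close>

definition revolution_moment :: "'n set \<Rightarrow> real^'n \<Rightarrow> real^'n^'n" where
  "revolution_moment P u = (\<chi> i j. if i \<in> P \<and> j \<in> P then u $ i * u $ j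
     else if i = j then (\<Sum>l\<in>-P. (u $ l)^2) / real (card (-P)) else 0)"

lemma continuous_on_revolution_moment: "continuous_on S (revolution_moment (P :: 'n::finite set))"
proof -
  have "continuous_on S (\<lambda>u. if i \<in> P \<and> j \<in> P then u $ i * u $ j
     else if i = j then (\<Sum>l\<in>-P. (u $ l)^2) / real (card (-P)) else 0)" for i j :: 'n
    by (cases "i \<in> P \<and> j \<in> P"; cases "i = j") (auto simp: divide_inverse intro!: continuous_intros)
  then show ?thesis
    unfolding revolution_moment_def by (intro continuous_on_vec_lambda)
qed

text \<open>John's decomposition of the identity. If it failed, a separating hyperplane would give a
  trace-free block operator \<open>H\<close> and a vector \<open>w\<close> for which the images of the ball under
  \<open>(1 + \<epsilon>\<delta>/4) (1 + \<epsilon>H)\<^sup>-\<^sup>1 - \<epsilon>w\<close> lie in the body, and these have larger volume.\<close>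

lemma john_decomposition:
  fixes K :: "(real^'n) set" and P :: "'n set"
  assumes K: "compact K" "convex K" "cball 0 1 \<subseteq> K" and P: "P \<noteq> UNIV"
    and max: "\<And>M z. block_scalar P M \<Longrightarrow> det M \<noteq> 0 \<Longrightarrow> (\<lambda>x. M *v x + z) ` cball 0 1 \<subseteq> K \<Longrightarrow> \<bar>det M\<bar> \<le> 1"
  obtains U :: "(real^'n) set" and \<mu> :: "real^'n \<Rightarrow> real" where
    "finite U" "\<And>u. u \<in> U \<Longrightarrow> norm u = 1" "\<And>u x. u \<in> U \<Longrightarrow> x \<in> K \<Longrightarrow> x \<bullet> u \<le> 1"
    "\<And>u. u \<in> U \<Longrightarrow> 0 \<le> \<mu> u" "(\<Sum>u\<in>U. \<mu> u) = real CARD('n)" "(\<Sum>u\<in>U. \<mu> u *\<^sub>R u) = 0"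
    "\<And>i j. i \<in> P \<Longrightarrow> j \<in> P \<Longrightarrow> (\<Sum>u\<in>U. \<mu> u * (u $ i * u $ j)) = (if i = j then 1 else 0)"
    "(\<Sum>u\<in>U. \<mu> u * (\<Sum>i\<in>-P. (u $ i)^2)) = real (card (-P))"
proof -
  define n where "n = real CARD('n)"
  have n: "n > 0" by (simp add: n_def)
  define m where "m = real (card (-P))"
  have m: "m > 0" using P by (auto simp: m_def card_gt_0_iff)
  define X where "X = {u. norm u = 1 \<and> (\<forall>x\<in>K. x \<bullet> u \<le> 1)}"
  define \<psi> where "\<psi> = (\<lambda>u. (revolution_moment P u, u))"
  \<comment> \<open>A convex combination has total mass \<open>1\<close> and the moment matrix of a
    unit vector has trace \<open>1\<close>, hence the factor \<open>1 / n\<close>. The weights are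
    multiplied by \<open>n\<close> at the end.\<close>
  define p :: "(real^'n^'n) \<times> (real^'n)" where "p = ((1 / n) *\<^sub>R mat 1, 0)"
  have "compact X"
  proof -
    have "X = sphere 0 1 \<inter> (\<Inter>x\<in>K. {u. x \<bullet> u \<le> 1})" by (auto simp: X_def)
    then show ?thesis by (auto intro!: compact_Int_closed closed_INT simp: closed_halfspace_le)
  qed
  then have "compact (\<psi> ` X)" unfolding \<psi>_def
    by (intro compact_continuous_image continuous_on_Pair continuous_on_revolution_moment continuous_on_id)
  then have cl: "closed (convex hull (\<psi> ` X))" by (simp add: compact_convex_hull compact_imp_closed)
  have "p \<in> convex hull (\<psi> ` X)"
  proof (rule ccontr)
    assume "p \<notin> convex hull (\<psi> ` X)"
    then obtain a b where ab: "a \<bullet> p < b" "\<And>q. q \<in> convex hull (\<psi> ` X) \<Longrightarrow> b < a \<bullet> q"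
      using separating_hyperplane_closed_point[OF convex_convex_hull cl] by metis
    obtain H0 w where a: "a = (H0, w)" by (cases a)
    define \<tau> where "\<tau> = trace H0 / n"
    define \<gamma> where "\<gamma> = (\<Sum>l\<in>-P. H0 $ l $ l) / m"
    \<comment> \<open>The separating matrix \<open>H0\<close> is symmetrised on the block, averaged
      along the diagonal outside it, and made trace-free by subtracting \<tau>. On moment matrices
      only the last operation is visible, as \<open>quad\<close> records.\<close>
    define H :: "real^'n^'n" where "H = (\<chi> i j. (if i \<in> P \<and> j \<in> P then (H0 $ i $ j + H0 $ j $ i) / 2
        else if i = j then \<gamma> else 0) - (if i = j then \<tau> else 0))"
    have symH: "transpose H = H" by (auto simp: H_def transpose_def vec_eq_iff)
    have blkH: "block_scalar P H"
      unfolding block_scalar_def by (rule exI[of _ "\<gamma> - \<tau>"]) (auto simp: H_def)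
    have splitU: "(\<Sum>i\<in>UNIV. f i) = (\<Sum>i\<in>P. f i) + (\<Sum>i\<in>-P. f i)" for f :: "'n \<Rightarrow> real"
      by (metis Compl_disjoint Compl_partition finite sum.union_disjoint)
    have trH: "trace H = 0"
    proof -
      have "trace H = (\<Sum>i\<in>UNIV. (if i \<in> P then H0 $ i $ i else \<gamma>) - \<tau>)"
        unfolding trace_def H_def by (intro sum.cong) auto
      also have "\<dots> = (\<Sum>i\<in>P. H0 $ i $ i) + (\<Sum>i\<in>-P. \<gamma>) - n * \<tau>"
        by (simp add: sum_subtractf splitU n_def)
      also have "(\<Sum>i\<in>-P. \<gamma>) = (\<Sum>i\<in>-P. H0 $ i $ i)" using m by (simp add: \<gamma>_def m_def)
      also have "(\<Sum>i\<in>P. H0 $ i $ i) + (\<Sum>i\<in>-P. H0 $ i $ i) = trace H0"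
        by (simp add: trace_def splitU)
      finally show ?thesis using n by (simp add: \<tau>_def)
    qed
    have quad: "u \<bullet> (H *v u) = H0 \<bullet> revolution_moment P u - \<tau> * (u \<bullet> u)" for u
    proof -
      have "u \<bullet> (H *v u) = (\<Sum>i\<in>UNIV. \<Sum>j\<in>UNIV. u $ i * u $ j * H $ i $ j)"
        by (simp add: inner_vec_def matrix_vector_mult_def sum_distrib_left algebra_simps)
      also have "\<dots> = (\<Sum>i\<in>UNIV. \<Sum>j\<in>UNIV. (if i \<in> P \<and> j \<in> P then u $ i * u $ j * H0 $ i $ j / 2 else 0)
          + (if i \<in> P \<and> j \<in> P then u $ i * u $ j * H0 $ j $ i / 2 else 0)
          + (if i = j then (if i \<in> P then 0 else \<gamma> * (u $ i)^2) - \<tau> * (u $ i)^2 else 0))"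
        by (intro sum.cong refl) (auto simp: H_def algebra_simps power2_eq_square add_divide_distrib)
      also have "\<dots> = (\<Sum>i\<in>UNIV. \<Sum>j\<in>UNIV. if i \<in> P \<and> j \<in> P then u $ i * u $ j * H0 $ i $ j / 2 else 0)
          + (\<Sum>i\<in>UNIV. \<Sum>j\<in>UNIV. if i \<in> P \<and> j \<in> P then u $ i * u $ j * H0 $ j $ i / 2 else 0)
          + (\<Sum>i\<in>UNIV. (if i \<in> P then 0 else \<gamma> * (u $ i)^2) - \<tau> * (u $ i)^2)"
        by (simp add: sum.distrib)
      also have "(\<Sum>i\<in>UNIV. \<Sum>j\<in>UNIV. if i \<in> P \<and> j \<in> P then u $ i * u $ j * H0 $ j $ i / 2 else 0)
          = (\<Sum>i\<in>UNIV. \<Sum>j\<in>UNIV. if i \<in> P \<and> j \<in> P then u $ i * u $ j * H0 $ i $ j / 2 else 0)"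
        by (subst sum.swap) (auto intro!: sum.cong simp: mult.commute)
      also have "(\<Sum>i\<in>UNIV. (if i \<in> P then 0 else \<gamma> * (u $ i)^2) - \<tau> * (u $ i)^2)
         = \<gamma> * (\<Sum>l\<in>-P. (u $ l)^2) - \<tau> * (u \<bullet> u)"
        by (simp add: sum_subtractf splitU sum_distrib_left inner_vec_def power2_eq_square distrib_left)
      also have "(\<Sum>i\<in>UNIV. \<Sum>j\<in>UNIV. if i \<in> P \<and> j \<in> P then u $ i * u $ j * H0 $ i $ j / 2 else 0)
          + (\<Sum>i\<in>UNIV. \<Sum>j\<in>UNIV. if i \<in> P \<and> j \<in> P then u $ i * u $ j * H0 $ i $ j / 2 else 0)
          = (\<Sum>i\<in>UNIV. \<Sum>j\<in>UNIV. if i \<in> P \<and> j \<in> P then H0 $ i $ j * (u $ i * u $ j) else 0)"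
        unfolding sum.distrib[symmetric] by (intro sum.cong refl) auto
      finally have L: "u \<bullet> (H *v u) = (\<Sum>i\<in>UNIV. \<Sum>j\<in>UNIV. if i \<in> P \<and> j \<in> P then H0 $ i $ j * (u $ i * u $ j) else 0)
         + (\<gamma> * (\<Sum>l\<in>-P. (u $ l)^2) - \<tau> * (u \<bullet> u))" .
      have "H0 \<bullet> revolution_moment P u = (\<Sum>i\<in>UNIV. \<Sum>j\<in>UNIV. (if i \<in> P \<and> j \<in> P then H0 $ i $ j * (u $ i * u $ j) else 0)
          + (if i = j then (if i \<in> P then 0 else H0 $ i $ i * ((\<Sum>l\<in>-P. (u $ l)^2) / m)) else 0))"
        unfolding inner_vec_def inner_real_def revolution_moment_def m_def by (intro sum.cong refl) auto
      also have "\<dots> = (\<Sum>i\<in>UNIV. \<Sum>j\<in>UNIV. if i \<in> P \<and> j \<in> P then H0 $ i $ j * (u $ i * u $ j) else 0)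
          + (\<Sum>i\<in>UNIV. if i \<in> P then 0 else H0 $ i $ i * ((\<Sum>l\<in>-P. (u $ l)^2) / m))"
        by (simp add: sum.distrib)
      also have "(\<Sum>i\<in>UNIV. if i \<in> P then 0 else H0 $ i $ i * ((\<Sum>l\<in>-P. (u $ l)^2) / m)) = \<gamma> * (\<Sum>l\<in>-P. (u $ l)^2)"
        by (simp add: splitU \<gamma>_def sum_divide_distrib[symmetric] sum_distrib_right[symmetric])
      finally show ?thesis using L by simp
    qed
    define \<delta> where "\<delta> = b - \<tau>"
    have "a \<bullet> p = \<tau>"
      by (simp add: a p_def inner_vec_def mat_def \<tau>_def trace_def if_distrib sum_divide_distrib cong: if_cong)
    then have d: "\<delta> > 0" using ab(1) by (simp add: \<delta>_def)
    define f where "f = (\<lambda>u. u \<bullet> (H *v u) + w \<bullet> u)"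
    have fX: "f u > \<delta>" if "u \<in> X" for u
    proof -
      have "b < a \<bullet> \<psi> u" using that by (intro ab(2) hull_inc) auto
      moreover have "u \<bullet> u = 1" using that by (simp add: X_def norm_eq_1)
      ultimately show ?thesis by (simp add: f_def quad a \<psi>_def \<delta>_def)
    qed
    \<comment> \<open>Directions are split according to the first-order effect \<open>f\<close>. It
      exceeds \<delta> on contact vectors, so \<open>T\<close> contains none and \<eta> gives room
      there; outside \<open>T\<close> the perturbation itself lowers the support function.\<close>
    define T where "T = {u. norm u = 1 \<and> f u \<le> \<delta> / 2}"
    have "compact T"
    proof -
      have "continuous_on UNIV f" unfolding f_def
        by (intro continuous_intros linear_continuous_on matrix_vector_mul_bounded_linear)
      then have "closed {u. f u \<le> \<delta> / 2}" by (intro closed_Collect_le continuous_on_const)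
      moreover have "T = sphere 0 1 \<inter> {u. f u \<le> \<delta> / 2}" by (auto simp: T_def)
      ultimately show ?thesis by (auto intro: compact_Int_closed)
    qed
    moreover have "\<exists>x\<in>K. x \<bullet> u > 1" if "u \<in> T" for u
      using fX[of u] d that by (force simp: T_def X_def)
    ultimately obtain \<eta> where eta: "\<eta> > 0" "\<And>u. u \<in> T \<Longrightarrow> \<exists>x\<in>K. x \<bullet> u > 1 + \<eta>"
      using support_gap by blast
    obtain C0 where C0: "\<And>x. norm (H *v x) \<le> norm x * C0"
      using bounded_linear.bounded[OF matrix_vector_mul_bounded_linear] by blast
    define C where "C = max (max C0 (norm w)) 1"
    have C: "norm (H *v x) \<le> C * norm x" "norm w \<le> C" "C \<ge> 1" for x
    proof -
      have "norm x * C0 \<le> norm x * C" by (intro mult_left_mono) (auto simp: C_def)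
      then show "norm (H *v x) \<le> C * norm x" using C0[of x] by (simp add: mult.commute)
    qed (auto simp: C_def)
    \<comment> \<open>Its first three summands bound the second-order coefficient outside
      \<open>T\<close>. The remaining ones bound the first-order terms, which have no favourable
      sign on \<open>T\<close>.\<close>
    define B where "B = 6 * C^2 + \<delta> * C + 6 * \<delta> * C^2 + \<delta> + 2 * C"
    have B: "B > 0" using C(3) d by (simp add: B_def add_pos_pos)
    define \<epsilon> where "\<epsilon> = min (min 1 (1 / (2 * C))) (min (\<delta> / (4 * B)) (\<eta> / B))"
    have e: "\<epsilon> > 0" "\<epsilon> \<le> 1" "\<epsilon> * C \<le> 1 / 2" "\<epsilon> * B \<le> \<delta> / 4" "\<epsilon> * B \<le> \<eta>"
    proof -
      show "\<epsilon> > 0" using C(3) d B eta by (auto simp: \<epsilon>_def)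
      show "\<epsilon> \<le> 1" by (simp add: \<epsilon>_def min_le_iff_disj)
      have "\<epsilon> \<le> 1 / (2 * C)" "\<epsilon> \<le> \<delta> / (4 * B)" "\<epsilon> \<le> \<eta> / B" by (simp_all add: \<epsilon>_def min_le_iff_disj)
      then show "\<epsilon> * C \<le> 1 / 2" "\<epsilon> * B \<le> \<delta> / 4" "\<epsilon> * B \<le> \<eta>" using C(3) B by (auto simp: field_simps)
    qed
    obtain N :: "real^'n^'n" where N: "block_scalar P N" "det N \<ge> 1"
      "\<And>x y. (N *v x) \<bullet> y = x \<bullet> (N *v y)"
      "\<And>u. norm u = 1 \<Longrightarrow> norm (N *v u) \<le> 1 - \<epsilon> * (u \<bullet> (H *v u)) + 6 * \<epsilon>^2 * C^2"
      by (rule symmetric_perturbation_inverse[OF symH trH blkH C(1) e(1) e(3)]) (use C(3) in auto)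
    \<comment> \<open>Outside \<open>T\<close> the perturbation lowers the support function by more
      than \<open>\<epsilon> * \<delta> / 2\<close> to first order. One half of this pays for the
      second-order error and the other half for the dilation \<kappa>, which makes the volume grow
      strictly.\<close>
    define \<kappa> where "\<kappa> = 1 + \<epsilon> * \<delta> / 4"
    have k: "\<kappa> > 1" using e d by (simp add: \<kappa>_def)
    have "(\<lambda>x. (\<kappa> *\<^sub>R N) *v x + (- \<epsilon>) *\<^sub>R w) ` cball 0 1 \<subseteq> K"
    proof (rule ccontr)
      assume "\<not> ?thesis"
      then obtain \<xi> where xi: "\<xi> \<in> cball 0 1" "(\<kappa> *\<^sub>R N) *v \<xi> + (- \<epsilon>) *\<^sub>R w \<notin> K" (is "?y \<notin> K")
        unfolding image_subset_iff by blast
      obtain c g where cg: "c \<bullet> ?y < g" "\<And>x. x \<in> K \<Longrightarrow> g < c \<bullet> x"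
        using separating_hyperplane_closed_point[OF K(2) compact_imp_closed[OF K(1)] xi(2)] by metis
      have "c \<noteq> 0" using cg(1) cg(2)[of 0] K(3) by force
      \<comment> \<open>The separating functional is normalised and reversed, so that
        \<open>K\<close> lies below the level \<open>b\<close> in the unit direction
        \<open>u\<close>. Since \<open>u\<close> itself belongs to \<open>K\<close>, this level
        exceeds \<open>1\<close>.\<close>
      define u where "u = (- 1 / norm c) *\<^sub>R c"
      define b where "b = - g / norm c"
      have u1: "norm u = 1" using \<open>c \<noteq> 0\<close> by (simp add: u_def)
      have yb: "?y \<bullet> u > b" using cg(1) \<open>c \<noteq> 0\<close> by (simp add: u_def b_def inner_commute divide_strict_right_mono)
      have Kb: "x \<bullet> u < b" if "x \<in> K" for x
        using cg(2)[OF that] \<open>c \<noteq> 0\<close> by (simp add: u_def b_def inner_commute divide_strict_right_mono)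
      have b1: "b > 1"
      proof -
        have "u \<in> K" using K(3) u1 by auto
        then show ?thesis using Kb[of u] u1 by (simp add: norm_eq_1)
      qed
      define A where "A = u \<bullet> (H *v u)"
      have A: "\<bar>A\<bar> \<le> C" using Cauchy_Schwarz_ineq2[of u "H *v u"] C(1)[of u] u1 by (simp add: A_def)
      have W: "\<bar>w \<bullet> u\<bar> \<le> C" using Cauchy_Schwarz_ineq2[of w u] C(2) u1 by simp
      have "?y \<bullet> u = \<kappa> * (\<xi> \<bullet> (N *v u)) - \<epsilon> * (w \<bullet> u)"
        by (simp add: inner_diff_left scaleR_matrix_vector_assoc[symmetric] N(3))
      also have "\<xi> \<bullet> (N *v u) \<le> norm \<xi> * norm (N *v u)" by (rule norm_cauchy_schwarz)
      also have "norm \<xi> * norm (N *v u) \<le> 1 * norm (N *v u)" using xi(1) by (intro mult_right_mono) auto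
      also have "1 * norm (N *v u) \<le> 1 - \<epsilon> * A + 6 * \<epsilon>^2 * C^2" using N(4)[OF u1] by (simp add: A_def)
      finally have "?y \<bullet> u \<le> \<kappa> * (1 - \<epsilon> * A + 6 * \<epsilon>^2 * C^2) - \<epsilon> * (w \<bullet> u)" using k by simp
      also have "\<dots> = 1 + \<epsilon> * \<delta> / 4 - \<epsilon> * f u + \<epsilon>^2 * (6 * C^2 - \<delta> * A / 4 + \<epsilon> * (6 * \<delta> * C^2 / 4))"
        unfolding f_def A_def[symmetric] \<kappa>_def by (simp add: algebra_simps power2_eq_square)
      also have "\<dots> \<le> 1 + \<epsilon> * \<delta> / 4 - \<epsilon> * f u + \<epsilon>^2 * (6 * C^2 + \<delta> * C + 6 * \<delta> * C^2)"
      proof -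
        have "- (\<delta> * A / 4) \<le> \<delta> * C"
        proof -
          have "\<delta> * (- A) \<le> \<delta> * C" using A d by (intro mult_left_mono) auto
          moreover have "0 \<le> \<delta> * C" using d C(3) by simp
          ultimately show ?thesis by simp
        qed
        moreover have "\<epsilon> * (6 * \<delta> * C^2 / 4) \<le> 1 * (6 * \<delta> * C^2)"
          using e d by (intro mult_mono) auto
        ultimately have "6 * C^2 - \<delta> * A / 4 + \<epsilon> * (6 * \<delta> * C^2 / 4) \<le> 6 * C^2 + \<delta> * C + 6 * \<delta> * C^2" by linarith
        then show ?thesis by (intro add_left_mono mult_left_mono) auto
      qed
      finally have main: "?y \<bullet> u \<le> 1 + \<epsilon> * \<delta> / 4 - \<epsilon> * f u + \<epsilon> * (\<epsilon> * (6 * C^2 + \<delta> * C + 6 * \<delta> * C^2))"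
        by (simp add: power2_eq_square mult.assoc)
      show False
      proof (cases "u \<in> T")
        case False
        then have "f u > \<delta> / 2" using u1 by (auto simp: T_def)
        then have "\<epsilon> * f u \<ge> \<epsilon> * (\<delta> / 2)" using e by (intro mult_left_mono) auto
        moreover have "\<epsilon> * (\<epsilon> * (6 * C^2 + \<delta> * C + 6 * \<delta> * C^2)) \<le> \<epsilon> * (\<delta> / 4)"
        proof (rule mult_left_mono)
          have "\<epsilon> * (6 * C^2 + \<delta> * C + 6 * \<delta> * C^2) \<le> \<epsilon> * B"
            using e d C(3) by (intro mult_left_mono) (auto simp: B_def)
          then show "\<epsilon> * (6 * C^2 + \<delta> * C + 6 * \<delta> * C^2) \<le> \<delta> / 4" using e(4) by linarith
        qed (use e in simp)
        ultimately have "?y \<bullet> u \<le> 1" using main by simp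
        then show False using yb b1 by simp
      next
        case True
        then obtain x where "x \<in> K" "x \<bullet> u > 1 + \<eta>" using eta by blast
        then have "b > 1 + \<eta>" using Kb[of x] by simp
        moreover have "?y \<bullet> u \<le> 1 + \<epsilon> * B"
        proof -
          have "f u \<ge> - (2 * C)" using A W by (auto simp: f_def A_def[symmetric])
          then have "\<epsilon> * f u \<ge> \<epsilon> * (- (2 * C))" using e by (intro mult_left_mono) auto
          moreover have "\<epsilon> * (\<epsilon> * (6 * C^2 + \<delta> * C + 6 * \<delta> * C^2)) \<le> \<epsilon> * (1 * (6 * C^2 + \<delta> * C + 6 * \<delta> * C^2))"
            using e d C(3) by (intro mult_left_mono mult_right_mono) auto
          moreover have "\<epsilon> * \<delta> / 4 \<le> \<epsilon> * \<delta>" using e d by simp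
          ultimately show ?thesis using main by (simp add: B_def algebra_simps)
        qed
        ultimately show False using yb e(5) by simp
      qed
    qed
    moreover have "block_scalar P (\<kappa> *\<^sub>R N)"
    proof -
      obtain g where "\<And>i j. i \<notin> P \<or> j \<notin> P \<Longrightarrow> N $ i $ j = (if i = j then g else 0)"
        using N(1) by (auto simp: block_scalar_def)
      then show ?thesis unfolding block_scalar_def by (intro exI[of _ "\<kappa> * g"]) auto
    qed
    moreover have detk: "det (\<kappa> *\<^sub>R N) = \<kappa> ^ CARD('n) * det N"
    proof -
      have "\<kappa> *\<^sub>R N = (\<kappa> *\<^sub>R mat 1) ** N"
      proof -
        have "(\<Sum>k\<in>UNIV. (\<kappa> *\<^sub>R mat 1 :: real^'n^'n) $ i $ k * N $ k $ j) = (\<Sum>k\<in>UNIV. if k = i then \<kappa> * N $ k $ j else 0)" for i j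
          by (intro sum.cong) (auto simp: mat_def)
        then show ?thesis by (simp add: vec_eq_iff matrix_matrix_mult_def)
      qed
      moreover have "det (\<kappa> *\<^sub>R mat 1 :: real^'n^'n) = \<kappa> ^ CARD('n)"
        by (subst det_diagonal) (auto simp: mat_def)
      ultimately show ?thesis by (simp add: det_mul)
    qed
    moreover have "\<kappa> ^ CARD('n) * det N > 1"
    proof -
      have "1 < \<kappa> ^ CARD('n) * 1" using k by (simp add: one_less_power)
      also have "\<kappa> ^ CARD('n) * 1 \<le> \<kappa> ^ CARD('n) * det N" using N(2) k by (intro mult_left_mono) auto
      finally show ?thesis by simp
    qed
    ultimately have "(\<lambda>x. (\<kappa> *\<^sub>R N) *v x + (- \<epsilon>) *\<^sub>R w) ` cball 0 1 \<subseteq> K" "block_scalar P (\<kappa> *\<^sub>R N)" "det (\<kappa> *\<^sub>R N) > 1"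
      by simp_all
    then show False using max[of "\<kappa> *\<^sub>R N" "(- \<epsilon>) *\<^sub>R w"] by simp
  qed
  then obtain S t where St: "finite S" "S \<subseteq> \<psi> ` X" "\<And>q. q \<in> S \<Longrightarrow> 0 \<le> t q" "sum t S = 1" "(\<Sum>q\<in>S. t q *\<^sub>R q) = p"
    unfolding convex_hull_explicit by auto
  define U where "U = {u \<in> X. \<psi> u \<in> S}"
  have inj: "inj_on \<psi> U" by (auto simp: inj_on_def \<psi>_def)
  have SU: "S = \<psi> ` U" using St(2) by (auto simp: U_def)
  have finU: "finite U" using St(1) inj unfolding SU by (rule finite_imageD)
  define \<mu> where "\<mu> = (\<lambda>u. n * t (\<psi> u))"
  have red: "(\<Sum>q\<in>S. g q) = (\<Sum>u\<in>U. g (\<psi> u))" for g :: "_ \<Rightarrow> 'z::comm_monoid_add"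
    unfolding SU using inj by (simp add: sum.reindex)
  have sumt: "(\<Sum>u\<in>U. t (\<psi> u)) = 1" using St(4) by (simp add: red)
  have eqp: "(\<Sum>u\<in>U. t (\<psi> u) *\<^sub>R \<psi> u) = p" using St(5) by (simp add: red)
  have "(\<Sum>u\<in>U. t (\<psi> u) *\<^sub>R u) = snd (\<Sum>u\<in>U. t (\<psi> u) *\<^sub>R \<psi> u)" by (simp add: snd_sum \<psi>_def)
  then have sum0: "(\<Sum>u\<in>U. t (\<psi> u) *\<^sub>R u) = 0" unfolding eqp by (simp add: p_def)
  have "(\<Sum>u\<in>U. t (\<psi> u) *\<^sub>R revolution_moment P u) = fst (\<Sum>u\<in>U. t (\<psi> u) *\<^sub>R \<psi> u)" by (simp add: fst_sum \<psi>_def)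
  then have Q: "(\<Sum>u\<in>U. t (\<psi> u) *\<^sub>R revolution_moment P u) = (1 / n) *\<^sub>R mat 1" unfolding eqp by (simp add: p_def)
  have Qij: "(\<Sum>u\<in>U. \<mu> u * revolution_moment P u $ i $ j) = (if i = j then 1 else 0)" for i j
  proof -
    have "(\<Sum>u\<in>U. t (\<psi> u) * revolution_moment P u $ i $ j) = (\<Sum>u\<in>U. t (\<psi> u) *\<^sub>R revolution_moment P u) $ i $ j"
      by simp
    then have "n * (\<Sum>u\<in>U. t (\<psi> u) * revolution_moment P u $ i $ j) = (if i = j then 1 else 0)"
      unfolding Q using n by (simp add: mat_def)
    then show ?thesis by (simp add: \<mu>_def sum_distrib_left mult.assoc)
  qed
  show ?thesis
  proof (rule that[of U \<mu>])
    show "finite U" by (rule finU)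
    show "norm u = 1" if "u \<in> U" for u using that by (simp add: U_def X_def)
    show "x \<bullet> u \<le> 1" if "u \<in> U" "x \<in> K" for u x using that by (simp add: U_def X_def)
    show "0 \<le> \<mu> u" if "u \<in> U" for u using that St(3) n by (simp add: U_def \<mu>_def)
    show "(\<Sum>u\<in>U. \<mu> u) = real CARD('n)" using sumt by (simp add: \<mu>_def sum_distrib_left[symmetric] n_def)
    show "(\<Sum>u\<in>U. \<mu> u *\<^sub>R u) = 0"
      using sum0 by (simp add: \<mu>_def scaleR_scaleR[symmetric] scaleR_sum_right[symmetric] del: scaleR_scaleR)
    show "(\<Sum>u\<in>U. \<mu> u * (u $ i * u $ j)) = (if i = j then 1 else 0)" if "i \<in> P" "j \<in> P" for i j
      using Qij[of i j] that by (simp add: revolution_moment_def)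
    obtain k where k: "k \<notin> P" using P by blast
    have "(\<Sum>u\<in>U. \<mu> u * ((\<Sum>i\<in>-P. (u $ i)^2) / m)) = 1"
      using Qij[of k k] k by (simp add: revolution_moment_def m_def)
    then have "(\<Sum>u\<in>U. \<mu> u * (\<Sum>i\<in>-P. (u $ i)^2)) / m = 1"
      by (simp only: times_divide_eq_right sum_divide_distrib[where f = "\<lambda>u. \<mu> u * _ u"])
    then show "(\<Sum>u\<in>U. \<mu> u * (\<Sum>i\<in>-P. (u $ i)^2)) = real (card (-P))" using m by (simp add: m_def)
  qed
qed

section \<open>Volumes of polytopes: the general case\<close>

text \<open>The volume is read off from the cone over the polytope, which lies in the region where all
  \<open>\<langle>q\<^sub>u, y\<rangle>\<close> are positive; \<open>q\<^sub>u\<close> is the normalisation of \<open>(-v\<^sub>u, 1 / sqrt d)\<close>. The exponential densities have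
  the mean \<open>M u\<close>, and the moment conditions on \<open>b\<close> make their product a function of the height only.\<close>

lemma polytope_volume_le:
  fixes h :: "nat \<Rightarrow> 'n::{finite,wellorder}" and v :: "'i \<Rightarrow> nat \<Rightarrow> real"
  assumes h: "bij_betw h {..<CARD('n)} UNIV" and s: "1 \<le> s" "Suc s \<le> CARD('n)"
    and fin: "finite U" and l: "\<And>u. u \<in> U \<Longrightarrow> 0 \<le> l u" "(\<Sum>u\<in>U. l u) = d" and d: "real s + 1 \<le> d"
    and frame: "\<And>x. (\<Sum>u\<in>U. l u * (\<Sum>a<s. v u a * x a)^2) = (\<Sum>a<s. (x a)^2)"
    and mean: "\<And>a. a < s \<Longrightarrow> (\<Sum>u\<in>U. l u * v u a) = 0"
    and le1: "\<And>u. u \<in> U \<Longrightarrow> (\<Sum>a<s. (v u a)^2) \<le> 1"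
  shows "emeasure (PiL s) {x \<in> space (PiL s). \<forall>u\<in>U. (\<Sum>a<s. v u a * x a) \<le> 1}
     \<le> ennreal (sqrt (d * (d + 1)) ^ s * (real s + 1) powr ((real s + 1) / (2 * (d + 1))) / fact s)"
proof -
  have s': "s \<le> CARD('n)" using s by simp
  have d0: "d > 0" using d by simp
  define \<rho> where "\<rho> = (\<lambda>u. l u / d)"
  \<comment> \<open>The weights \<open>l / d\<close> have total \<open>1\<close>, and the factor
    \<open>sqrt d\<close> restores isotropy. The condition \<open>|v| \<le> 1\<close> becomes
    \<open>|w|^2 \<le> d\<close>, so the entropy estimate is used with \<open>N = d\<close>.\<close>
  define w :: "'i \<Rightarrow> real^('n::{finite,wellorder})" where "w = (\<lambda>u. sqrt d *\<^sub>R embed_vec h s (v u))"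
  define V :: "(real^('n::{finite,wellorder})) set" where "V = {x. \<forall>b\<in>{s..<CARD('n)}. x $ h b = 0}"
  have w_inner: "w u \<bullet> y = sqrt d * (\<Sum>a<s. v u a * y $ h a)" for u y
    by (simp add: w_def inner_embed_vec)
  have w_norm: "(norm (w u))^2 = d * (\<Sum>a<s. (v u a)^2)" for u
  proof -
    have "(norm (w u))^2 = (sqrt d)^2 * (embed_vec h s (v u) \<bullet> embed_vec h s (v u))"
      by (simp add: power2_norm_eq_inner[symmetric] w_def power_mult_distrib)
    also have "embed_vec h s (v u) \<bullet> embed_vec h s (v u) = (\<Sum>a<s. (v u a)^2)"
      by (subst inner_embed_embed[OF h s']) (simp add: power2_eq_square)
    finally show ?thesis using d0 by simp
  qed
  obtain b where b: "\<And>u. u \<in> U \<Longrightarrow> b u > 0" "(\<Sum>u\<in>U. \<rho> u * b u) = 1"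
    "(\<Sum>u\<in>U. (\<rho> u * b u) *\<^sub>R w u) = 0"
    "(\<Sum>u\<in>U. \<rho> u * ((1 + (norm (w u))^2) * ln (1 + (norm (w u))^2)))
       - 2 * (\<Sum>u\<in>U. \<rho> u * ((1 + (norm (w u))^2) * ln (b u)))
     \<le> real s * ln (d + 1) + (real s + 1) / (d + 1) * ln (real s + 1)"
  proof (rule isotropic_weights_exist[of U \<rho> V w "real s" d])
    show "finite U" by (rule fin)
    show "0 \<le> \<rho> u" if "u \<in> U" for u using l(1)[OF that] d0 by (simp add: \<rho>_def)
    show "(\<Sum>u\<in>U. \<rho> u) = 1" using l(2) d0 by (simp add: \<rho>_def sum_divide_distrib[symmetric])
    show "subspace V" by (auto simp: V_def subspace_def)
    show "w u \<in> V" if "u \<in> U" for u using s' by (auto simp: V_def w_def embed_vec_nth[OF h s'])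
    show "(\<Sum>u\<in>U. \<rho> u *\<^sub>R w u) = 0"
    proof -
      have "(\<Sum>u\<in>U. \<rho> u *\<^sub>R w u) \<bullet> x = 0" for x
      proof -
        have "(\<Sum>u\<in>U. \<rho> u *\<^sub>R w u) \<bullet> x = (\<Sum>u\<in>U. \<Sum>a<s. sqrt d / d * x $ h a * (l u * v u a))"
          by (simp add: inner_sum_left w_inner \<rho>_def sum_distrib_left algebra_simps)
        also have "\<dots> = (\<Sum>a<s. sqrt d / d * x $ h a * (\<Sum>u\<in>U. l u * v u a))"
          unfolding sum_distrib_left by (rule sum.swap)
        finally show ?thesis using mean by simp
      qed
      from this[of "\<Sum>u\<in>U. \<rho> u *\<^sub>R w u"] show ?thesis by simp
    qed
    show "(\<Sum>u\<in>U. \<rho> u * (w u \<bullet> y)^2) = y \<bullet> y" if y: "y \<in> V" for y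
    proof -
      have "(\<Sum>u\<in>U. \<rho> u * (w u \<bullet> y)^2) = (\<Sum>u\<in>U. l u * (\<Sum>a<s. v u a * y $ h a)^2)"
        using d0 by (simp add: w_inner power_mult_distrib \<rho>_def)
      also have "\<dots> = (\<Sum>a<s. (y $ h a)^2)" by (rule frame)
      also have "\<dots> = y \<bullet> y" unfolding inner_vec_def
        by (subst sum_over_enumeration[OF h s']) (use y in \<open>simp add: V_def power2_eq_square\<close>)
      finally show ?thesis .
    qed
    show "(\<Sum>u\<in>U. \<rho> u * (norm (w u))^2) = real s"
      using frame_trace[OF frame] d0 by (simp add: w_norm \<rho>_def)
    show "(norm (w u))^2 \<le> d" if "u \<in> U" for u
      unfolding w_norm using le1[OF that] d0 by (simp add: mult_left_le)
  qed (use s d in \<open>auto intro: that\<close>)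
  define r where "r = (\<lambda>u. 1 + d * (\<Sum>a<s. (v u a)^2))"
  have r: "r u \<ge> 1" for u using d0 by (simp add: r_def sum_nonneg)
  define sq where "sq = (\<lambda>u. sqrt (r u / d))"
  have sq: "sq u > 0" "(sq u)^2 = r u / d" for u using r[of u] d0 by (auto simp: sq_def)
  \<comment> \<open>\<open>sq u\<close> is the length of the lift
    \<open>(- v u, 1 / sqrt d)\<close>. Mean zero removes the mixed terms, so the lifts form a frame
    in dimension \<open>s + 1\<close>.\<close>
  define q where "q = (\<lambda>u a. if a < s then - v u a / sq u else 1 / (sqrt d * sq u))"
  define c where "c = (\<lambda>u. l u * (r u / d))"
  have c: "c u \<ge> 0" if "u \<in> U" for u using l(1)[OF that] r[of u] d0 by (simp add: c_def)
  \<comment> \<open>The choice makes \<open>c u / M u / sq u = l u * b u\<close>: the exponent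
    becomes linear in \<open>b\<close>, and the conditions on \<open>b\<close> can act on
    it.\<close>
  define M where "M = (\<lambda>u. sq u / b u)"
  have M: "M u > 0" if "u \<in> U" for u using sq b(1)[OF that] by (simp add: M_def)
  have qdot: "(\<Sum>a<Suc s. q u a * y a) = (y s / sqrt d - (\<Sum>a<s. v u a * y a)) / sq u" for u and y :: "nat \<Rightarrow> real"
  proof -
    have "(\<Sum>a<s. q u a * y a) = - (\<Sum>a<s. v u a * y a) / sq u"
      by (simp add: q_def sum_divide_distrib sum_negf)
    then show ?thesis by (simp add: q_def diff_divide_distrib)
  qed
  let ?O = "{y. \<forall>u\<in>U. (\<Sum>a<Suc s. q u a * y a) \<in> {0<..}}"
  have BL: "(\<integral>\<^sup>+y. ennreal (\<Prod>u\<in>U. (exp (- (\<Sum>a<Suc s. q u a * y a) / M u) / M u) powr c u) * indicator ?O y \<partial>PiL (Suc s)) \<le> 1"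
  proof (rule brascamp_lieb_PiL[OF h s(2) fin c, where f = "\<lambda>u t. exp (- t / M u) / M u"])
    show "(\<Sum>a<Suc s. (q u a)^2) = 1" if "u \<in> U" for u
    proof -
      have "(\<Sum>a<s. (q u a)^2) = (\<Sum>a<s. (v u a)^2) / (sq u)^2"
        by (simp add: q_def power_divide sum_divide_distrib)
      then have "(\<Sum>a<Suc s. (q u a)^2) = ((\<Sum>a<s. (v u a)^2) + 1 / d) / (sq u)^2"
        using d0 by (simp add: q_def power_divide power_mult_distrib add_divide_distrib)
      also have "(\<Sum>a<s. (v u a)^2) + 1 / d = r u / d" using d0 by (simp add: r_def field_simps)
      finally show ?thesis using sq[of u] r[of u] d0 by simp
    qed
    show "(\<Sum>u\<in>U. c u * (\<Sum>a<Suc s. q u a * y a)^2) = (\<Sum>a<Suc s. (y a)^2)" for y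
    proof -
      have "(\<Sum>u\<in>U. c u * (\<Sum>a<Suc s. q u a * y a)^2) = (\<Sum>u\<in>U. l u * (y s / sqrt d - (\<Sum>a<s. v u a * y a))^2)"
        unfolding qdot c_def sq(2)[symmetric] power_divide using sq(1) by (simp add: less_imp_neq[symmetric])
      also have "\<dots> = (\<Sum>u\<in>U. l u) * (y s / sqrt d)^2 - 2 * (y s / sqrt d) * (\<Sum>u\<in>U. l u * (\<Sum>a<s. v u a * y a))
          + (\<Sum>u\<in>U. l u * (\<Sum>a<s. v u a * y a)^2)"
        by (simp add: power2_diff algebra_simps sum.distrib sum_subtractf sum_distrib_left sum_distrib_right)
      also have "(\<Sum>u\<in>U. l u * (\<Sum>a<s. v u a * y a)) = (\<Sum>a<s. y a * (\<Sum>u\<in>U. l u * v u a))"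
        unfolding sum_distrib_left by (subst sum.swap) (simp add: algebra_simps)
      also have "\<dots> = 0" using mean by simp
      finally show ?thesis using d0 by (simp add: frame l(2) power_divide)
    qed
    show "gauss_transport {0<..} (\<lambda>t. exp (- t / M u) / M u)" if "u \<in> U" for u
      using M[OF that] by (rule gauss_transport_exponential)
  qed auto
  \<comment> \<open>At height \<open>sqrt d\<close> the last entry \<open>1 / sqrt d\<close> of the
    lifts contributes exactly \<open>1\<close>, so this slice of the cone is the polytope
    itself.\<close>
  define \<theta> where "\<theta> = sqrt d"
  have th: "\<theta> > 0" using d0 by (simp add: \<theta>_def)
  let ?P = "{x \<in> space (PiL s). \<forall>u\<in>U. (\<Sum>a<s. v u a * x a) < 1}"
  have Psets: "?P \<in> sets (PiL s)" by (rule polytope_sets[OF fin])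
  let ?C = "{y. 0 < y s \<and> (\<lambda>i\<in>{..<s}. y i * (\<theta> / y s)) \<in> ?P}"
  have CO: "y \<in> ?O" if "y \<in> ?C" for y
  proof -
    have ys: "y s > 0" using that by simp
    have "0 < (\<Sum>a<Suc s. q u a * y a)" if u: "u \<in> U" for u
    proof -
      have "(\<Sum>a<s. v u a * (\<lambda>i\<in>{..<s}. y i * (\<theta> / y s)) a) < 1" using \<open>y \<in> ?C\<close> u by blast
      also have "(\<Sum>a<s. v u a * (\<lambda>i\<in>{..<s}. y i * (\<theta> / y s)) a) = (\<Sum>a<s. v u a * y a) * (\<theta> / y s)"
        unfolding sum_distrib_right by (intro sum.cong) (auto simp: mult.assoc)
      finally have "(\<Sum>a<s. v u a * y a) * (\<theta> / y s) < 1" .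
      then have "(\<Sum>a<s. v u a * y a) < y s / \<theta>" using ys th by (simp add: field_simps)
      then show ?thesis unfolding qdot using sq(1)[of u] by (simp add: \<theta>_def)
    qed
    then show ?thesis by simp
  qed
  have lb: "(\<Sum>u\<in>U. l u * b u) = d" using b(2) d0 by (simp add: \<rho>_def sum_divide_distrib[symmetric])
  have lbv: "(\<Sum>u\<in>U. l u * b u * (\<Sum>a<s. v u a * y a)) = 0" for y
  proof -
    have "(\<Sum>u\<in>U. (\<rho> u * b u) *\<^sub>R w u) \<bullet> embed_vec h s y = 0" using b(3) by simp
    then have "(\<Sum>u\<in>U. sqrt d / d * (l u * b u * (\<Sum>a<s. v u a * y a))) = 0"
      unfolding inner_sum_left using s'
      by (simp add: w_inner embed_vec_nth[OF h s'] \<rho>_def algebra_simps)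
    then show ?thesis unfolding sum_distrib_left[symmetric] using d0 by simp
  qed
  define Q where "Q = (\<Prod>u\<in>U. (1 / M u) powr c u)"
  have Q: "Q > 0" unfolding Q_def using M by (intro prod_pos) (auto dest: M)
  \<comment> \<open>The horizontal part of the exponent vanishes by \<open>lbv\<close> and the
    vertical part has total weight \<open>d\<close> by \<open>lb\<close>. What remains is the
    exponential of the height integrated in \<open>nn_integral_cone\<close>.\<close>
  have prodeq: "(\<Prod>u\<in>U. (exp (- (\<Sum>a<Suc s. q u a * y a) / M u) / M u) powr c u) = Q * exp (- (\<theta> * y s))" for y
  proof -
    have "(\<Prod>u\<in>U. (exp (- (\<Sum>a<Suc s. q u a * y a) / M u) / M u) powr c u)
        = (\<Prod>u\<in>U. (1 / M u) powr c u * exp (- (c u / M u * (\<Sum>a<Suc s. q u a * y a))))"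
    proof (rule prod.cong[OF refl])
      fix u assume u: "u \<in> U"
      have "(exp (- (\<Sum>a<Suc s. q u a * y a) / M u) / M u) powr c u
         = (1 / M u * exp (- (\<Sum>a<Suc s. q u a * y a) / M u)) powr c u" by simp
      also have "\<dots> = (1 / M u) powr c u * exp (- (\<Sum>a<Suc s. q u a * y a) / M u) powr c u" by (rule powr_mult)
      finally show "(exp (- (\<Sum>a<Suc s. q u a * y a) / M u) / M u) powr c u
         = (1 / M u) powr c u * exp (- (c u / M u * (\<Sum>a<Suc s. q u a * y a)))"
        by (simp add: exp_powr_real mult.commute del: sum.lessThan_Suc)
    qed
    also have "\<dots> = Q * exp (- (\<Sum>u\<in>U. c u / M u * (\<Sum>a<Suc s. q u a * y a)))"
      by (simp add: prod.distrib Q_def exp_sum[OF fin] sum_negf[symmetric] del: sum.lessThan_Suc)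
    also have "(\<Sum>u\<in>U. c u / M u * (\<Sum>a<Suc s. q u a * y a)) = (\<Sum>u\<in>U. l u * b u * (y s / sqrt d) - l u * b u * (\<Sum>a<s. v u a * y a))"
    proof (rule sum.cong[OF refl])
      fix u assume u: "u \<in> U"
      have "c u / M u / sq u = l u * b u"
        unfolding c_def M_def sq(2)[symmetric] using sq(1)[of u] b(1)[OF u] by (simp add: power2_eq_square)
      then show "c u / M u * (\<Sum>a<Suc s. q u a * y a) = l u * b u * (y s / sqrt d) - l u * b u * (\<Sum>a<s. v u a * y a)"
        unfolding qdot by (metis (no_types, lifting) right_diff_distrib times_divide_eq_left times_divide_eq_right)
    qed
    also have "\<dots> = \<theta> * y s" unfolding sum_subtractf lbv sum_distrib_right[symmetric] lb
      using d0 real_div_sqrt[of d] by (simp add: \<theta>_def times_divide_eq_left[symmetric] del: times_divide_eq_left)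
    finally show ?thesis .
  qed
  have "ennreal Q * (emeasure (PiL s) ?P * ennreal (fact s / \<theta> ^ (2 * s + 1)))
     = (\<integral>\<^sup>+y. ennreal Q * (indicator ?C y * ennreal (exp (- (\<theta> * y s)))) \<partial>PiL (Suc s))"
  proof -
    have "(\<lambda>y. indicator ?C y * ennreal (exp (- (\<theta> * y s)))) \<in> borel_measurable (PiL (Suc s))"
      by (rule measurable_cone_density[OF Psets])
    then show ?thesis unfolding nn_integral_cone[OF th Psets, symmetric] by (simp add: nn_integral_cmult)
  qed
  also have "\<dots> \<le> (\<integral>\<^sup>+y. ennreal (\<Prod>u\<in>U. (exp (- (\<Sum>a<Suc s. q u a * y a) / M u) / M u) powr c u) * indicator ?O y \<partial>PiL (Suc s))"
  proof (rule nn_integral_mono)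
    fix y
    show "ennreal Q * (indicator ?C y * ennreal (exp (- (\<theta> * y s))))
       \<le> ennreal (\<Prod>u\<in>U. (exp (- (\<Sum>a<Suc s. q u a * y a) / M u) / M u) powr c u) * indicator ?O y"
    proof (cases "y \<in> ?C")
      case True
      then have "y \<in> ?O" by (rule CO)
      with True show ?thesis unfolding prodeq using Q by (simp add: ennreal_mult del: mem_Collect_eq)
    qed simp
  qed
  also note BL
  finally have main: "ennreal Q * (emeasure (PiL s) ?P * ennreal (fact s / \<theta> ^ (2 * s + 1))) \<le> 1" .
  define R where "R = \<theta> ^ (2 * s + 1) / (fact s * Q)"
  have R: "R \<ge> 0" using th Q by (simp add: R_def)
  have "ennreal R * (ennreal Q * (emeasure (PiL s) ?P * ennreal (fact s / \<theta> ^ (2 * s + 1)))) \<le> ennreal R * 1"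
    using main by (intro mult_left_mono) auto
  moreover have "ennreal R * (ennreal Q * (emeasure (PiL s) ?P * ennreal (fact s / \<theta> ^ (2 * s + 1)))) = emeasure (PiL s) ?P"
  proof -
    have "R * Q * (fact s / \<theta> ^ (2 * s + 1)) = 1" using th Q by (simp add: R_def)
    moreover have "ennreal (R * Q * z) = ennreal R * ennreal Q * ennreal z" if "z \<ge> 0" for z
      using R Q that by (simp add: ennreal_mult)
    moreover have "fact s / \<theta> ^ (2 * s + 1) \<ge> 0" using th by simp
    ultimately have "ennreal R * ennreal Q * ennreal (fact s / \<theta> ^ (2 * s + 1)) = 1" by (metis ennreal_1)
    moreover have "ennreal R * (ennreal Q * (emeasure (PiL s) ?P * ennreal (fact s / \<theta> ^ (2 * s + 1))))
      = (ennreal R * ennreal Q * ennreal (fact s / \<theta> ^ (2 * s + 1))) * emeasure (PiL s) ?P"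
      by (simp only: ac_simps)
    ultimately show ?thesis by simp
  qed
  ultimately have P_le: "emeasure (PiL s) ?P \<le> ennreal R" by simp
  have R_le: "R \<le> sqrt (d * (d + 1)) ^ s * (real s + 1) powr ((real s + 1) / (2 * (d + 1))) / fact s"
  proof -
    have rw: "1 + (norm (w u))^2 = r u" for u by (simp add: w_norm r_def)
    have csum: "(\<Sum>u\<in>U. c u) = real s + 1"
    proof -
      have "(\<Sum>u\<in>U. c u) = (\<Sum>u\<in>U. l u) / d + (\<Sum>u\<in>U. l u * (\<Sum>a<s. (v u a)^2))"
        using d0 by (simp add: c_def r_def add_divide_distrib distrib_left sum.distrib sum_divide_distrib)
      then show ?thesis using d0 by (simp add: l(2) frame_trace[OF frame])
    qed
    have "ln Q = (\<Sum>u\<in>U. c u * ln (1 / M u))"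
      unfolding Q_def by (subst ln_prod[OF fin]) (auto simp: ln_powr dest: M)
    also have "\<dots> = (\<Sum>u\<in>U. c u * (ln (b u) - ln (r u) / 2 + ln d / 2))"
    proof (rule sum.cong[OF refl])
      fix u assume u: "u \<in> U"
      have "ln (sq u) = (ln (r u) - ln d) / 2" using r[of u] d0 by (simp add: sq_def ln_sqrt ln_div)
      then show "c u * ln (1 / M u) = c u * (ln (b u) - ln (r u) / 2 + ln d / 2)"
        using sq(1)[of u] b(1)[OF u] by (simp add: M_def ln_div diff_divide_distrib)
    qed
    also have "\<dots> = (\<Sum>u\<in>U. c u * ln (b u)) - (\<Sum>u\<in>U. c u * ln (r u)) / 2 + (real s + 1) * ln d / 2"
      unfolding csum[symmetric] by (simp add: algebra_simps sum.distrib sum_subtractf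
        sum_divide_distrib[symmetric] sum_distrib_left[symmetric] sum_distrib_right[symmetric])
    finally have lnQ: "ln Q = \<dots>" .
    have "(\<Sum>u\<in>U. c u * ln (r u)) - 2 * (\<Sum>u\<in>U. c u * ln (b u))
        \<le> real s * ln (d + 1) + (real s + 1) / (d + 1) * ln (real s + 1)"
      using b(4) unfolding rw by (simp add: \<rho>_def c_def mult.assoc)
    then have "- ln Q \<le> (real s * ln (d + 1) + (real s + 1) / (d + 1) * ln (real s + 1)) / 2 - (real s + 1) * ln d / 2"
      unfolding lnQ by simp
    moreover have "ln R = (2 * s + 1) * (ln d / 2) - ln (fact s) - ln Q"
      unfolding R_def using th Q d0 by (simp add: ln_div ln_mult ln_realpow \<theta>_def ln_sqrt algebra_simps)
    ultimately
    have "ln R \<le> real s * (ln d / 2 + ln (d + 1) / 2) + (real s + 1) / (2 * (d + 1)) * ln (real s + 1) - ln (fact s)"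
    proof -
      define T where "T = (real s + 1) / (d + 1) * ln (real s + 1)"
      have half: "(real s + 1) / (2 * (d + 1)) * ln (real s + 1) = T / 2" by (simp add: T_def mult.commute)
      show ?thesis
        using \<open>- ln Q \<le> _\<close> \<open>ln R = _\<close> unfolding half T_def[symmetric]
        by (simp add: algebra_simps add_divide_distrib diff_divide_distrib)
    qed
    also have "\<dots> = ln (sqrt (d * (d + 1)) ^ s * (real s + 1) powr ((real s + 1) / (2 * (d + 1))) / fact s)"
    proof -
      define A where "A = sqrt (d * (d + 1))"
      have A: "A > 0" "ln A = ln d / 2 + ln (d + 1) / 2" using d0 by (auto simp: A_def ln_sqrt ln_mult add_divide_distrib)
      then show ?thesis unfolding A(2)[symmetric] A_def[symmetric]
        by (simp add: ln_div ln_mult ln_realpow ln_powr)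
    qed
    finally have "ln R \<le> ln (sqrt (d * (d + 1)) ^ s * (real s + 1) powr ((real s + 1) / (2 * (d + 1))) / fact s)" .
    moreover have "R > 0" using th Q by (simp add: R_def)
    ultimately show ?thesis using d0 by (subst (asm) ln_le_cancel_iff) auto
  qed
  have "emeasure (PiL s) {x \<in> space (PiL s). \<forall>u\<in>U. (\<Sum>a<s. v u a * x a) \<le> 1} \<le> ennreal R"
    using fin R P_le by (rule emeasure_closed_polytope_le)
  then show ?thesis using R_le by (meson ennreal_leI order_trans)
qed

section \<open>The regular simplex and the cube\<close>

lemma distr_lborel_orthogonal:
  fixes T :: "real^('n::{finite,wellorder}) \<Rightarrow> real^('n::{finite,wellorder})"
  assumes T: "orthogonal_transformation T"
  shows "distr lborel lborel T = lborel"
proof (rule lborel_eqI[symmetric])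
  fix l u :: "real^('n::{finite,wellorder})" assume lu: "\<And>b. b \<in> Basis \<Longrightarrow> l \<bullet> b \<le> u \<bullet> b"
  have lin: "linear T" and bij: "bij T"
    using T by (auto simp: orthogonal_transformation_linear orthogonal_transformation_bij)
  have inv: "orthogonal_transformation (inv T)" using T by (rule orthogonal_transformation_inv)
  have [measurable]: "T \<in> borel_measurable borel"
    using linear_continuous_on[OF linear_conv_bounded_linear[THEN iffD1, OF lin]]
    by (intro borel_measurable_continuous_onI)
  have vim: "T -` box l u = inv T ` box l u" using bij by (simp add: bij_vimage_eq_inv_image)
  have lm: "inv T ` box l u \<in> lmeasurable" using inv by (intro measurable_orthogonal_image) auto
  have bs: "T -` box l u \<in> sets borel" using measurable_sets[of T borel borel "box l u"] by simp
  have "emeasure (distr lborel lborel T) (box l u) = emeasure lborel (T -` box l u)"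
    by (subst emeasure_distr) auto
  also have "\<dots> = emeasure lebesgue (T -` box l u)" using bs by simp
  also have "\<dots> = ennreal (measure lebesgue (inv T ` box l u))"
    unfolding vim using lm by (intro emeasure_eq_measure2) (auto simp: fmeasurable_def)
  also have "measure lebesgue (inv T ` box l u) = measure lebesgue (box l u)"
    by (rule measure_orthogonal_image[OF inv]) auto
  also have "ennreal (measure lebesgue (box l u)) = emeasure lborel (box l u)"
    using emeasure_lborel_box_finite[of l u] by (simp add: measure_def)
  also have "\<dots> = ennreal (\<Prod>b\<in>Basis. (u - l) \<bullet> b)" using lu by (simp add: emeasure_lborel_box_eq)
  finally show "emeasure (distr lborel lborel T) (box l u) = ennreal (\<Prod>b\<in>Basis. (u - l) \<bullet> b)" .
qed auto

text \<open>\<open>T\<close> is the inverse rotation on the first \<open>m\<close> coordinates and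
  the identity on the others. It therefore preserves the unit slab, and invariance of Lebesgue
  measure on vectors descends to the model space.\<close>

lemma nn_integral_PiL_orthonormal:
  fixes h :: "nat \<Rightarrow> 'n::{finite,wellorder}" and e :: "nat \<Rightarrow> nat \<Rightarrow> real"
  assumes h: "bij_betw h {..<CARD('n)} UNIV" and m: "m \<le> CARD('n)"
    and on: "\<And>i j. i < m \<Longrightarrow> j < m \<Longrightarrow> (\<Sum>a<m. e i a * e j a) = (if i = j then 1 else 0)"
    and g[measurable]: "g \<in> borel_measurable (PiL m)"
  shows "(\<integral>\<^sup>+x. g (\<lambda>i\<in>{..<m}. \<Sum>a<m. e i a * x a) \<partial>PiL m) = (\<integral>\<^sup>+x. g x \<partial>PiL m)"
proof -
  let ?n = "CARD('n)"
  define T :: "real^('n::{finite,wellorder}) \<Rightarrow> real^('n::{finite,wellorder})" where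
    "T = (\<lambda>y. embed_vec h ?n (\<lambda>a. if a < m then \<Sum>i<m. y $ h i * e i a else y $ h a))"
  have Tn: "T y $ h a = (if a < m then \<Sum>i<m. y $ h i * e i a else y $ h a)" if "a < ?n" for y a
    unfolding T_def using that by (simp add: embed_vec_nth[OF h])
  have surj: "\<exists>a<?n. l = h a" for l using h by (metis bij_betw_iff_bijections lessThan_iff UNIV_I)
  have lin: "linear T"
  proof (rule linearI)
    show "T (x + y) = T x + T y" for x y
    proof (rule vec_eq_iff[THEN iffD2], rule allI)
      fix l obtain a where a: "a < ?n" "l = h a" using surj by blast
      show "T (x + y) $ l = (T x + T y) $ l" using a by (simp add: Tn algebra_simps sum.distrib)
    qed
    show "T (r *\<^sub>R x) = r *\<^sub>R T x" for r x
    proof (rule vec_eq_iff[THEN iffD2], rule allI)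
      fix l obtain a where a: "a < ?n" "l = h a" using surj by blast
      show "T (r *\<^sub>R x) $ l = (r *\<^sub>R T x) $ l" using a by (simp add: Tn sum_distrib_left mult.assoc)
    qed
  qed
  have nrm: "T y \<bullet> T y = y \<bullet> y" for y
  proof -
    have "(\<Sum>a<m. (\<Sum>i<m. y $ h i * e i a) * (\<Sum>j<m. y $ h j * e j a))
        = (\<Sum>a<m. \<Sum>i<m. \<Sum>j<m. y $ h i * y $ h j * (e i a * e j a))"
      by (simp add: sum_product algebra_simps)
    also have "\<dots> = (\<Sum>i<m. \<Sum>a<m. \<Sum>j<m. y $ h i * y $ h j * (e i a * e j a))" by (rule sum.swap)
    also have "\<dots> = (\<Sum>i<m. \<Sum>j<m. \<Sum>a<m. y $ h i * y $ h j * (e i a * e j a))"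
      by (intro sum.cong refl sum.swap)
    also have "\<dots> = (\<Sum>i<m. \<Sum>j<m. if i = j then y $ h i * y $ h j else 0)"
      unfolding sum_distrib_left[symmetric] by (intro sum.cong refl) (simp add: on)
    also have "\<dots> = (\<Sum>a<m. y $ h a * y $ h a)" by simp
    finally show ?thesis
      unfolding inner_vec_def by (simp add: sum_over_enumeration[OF h m] Tn m less_le_trans[OF _ m])
  qed
  then have orth: "orthogonal_transformation T"
    unfolding orthogonal_transformation using lin by (simp add: norm_eq_sqrt_inner)
  have [measurable]: "T \<in> lborel \<rightarrow>\<^sub>M lborel"
    using linear_continuous_on[OF linear_conv_bounded_linear[THEN iffD1, OF lin]]
    by (simp add: borel_measurable_continuous_onI)
  let ?E = "\<lambda>x. \<lambda>i\<in>{..<m}. \<Sum>a<m. e i a * x a"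
  have [measurable]: "?E \<in> PiL m \<rightarrow>\<^sub>M PiL m"
  proof (rule measurable_restrict)
    have "(\<lambda>x. \<Sum>a<m. e i a * x a) \<in> borel_measurable (PiL m)" for i
      by (intro borel_measurable_sum borel_measurable_times) auto
    then show "(\<lambda>x. \<Sum>a<m. e i a * x a) \<in> PiL m \<rightarrow>\<^sub>M lborel" for i by simp
  qed
  have E: "?E (coords h m (T y)) = coords h m y" for y
  proof
    fix i
    show "?E (coords h m (T y)) i = coords h m y i"
    proof (cases "i < m")
      case True
      have "(\<Sum>a<m. e i a * coords h m (T y) a) = (\<Sum>a<m. \<Sum>j<m. y $ h j * (e i a * e j a))"
        using m by (simp add: coords_def Tn less_le_trans[OF _ m] sum_distrib_left algebra_simps)
      also have "\<dots> = (\<Sum>j<m. y $ h j * (\<Sum>a<m. e i a * e j a))"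
        unfolding sum_distrib_left by (rule sum.swap)
      also have "\<dots> = (\<Sum>j<m. if j = i then y $ h j else 0)"
        using True by (intro sum.cong refl) (auto simp: on)
      finally show ?thesis using True by (simp add: coords_def)
    qed (simp add: coords_def)
  qed
  have slab: "T y \<in> unit_slab h m \<longleftrightarrow> y \<in> unit_slab h m" for y
    by (auto simp: unit_slab_def Tn)
  have "(\<integral>\<^sup>+x. g (?E x) \<partial>PiL m) = (\<integral>\<^sup>+y. g (?E (coords h m y)) * indicator (unit_slab h m) y \<partial>lborel)"
    by (rule nn_integral_PiL[OF h m]) measurable
  also have "\<dots> = (\<integral>\<^sup>+y. g (?E (coords h m y)) * indicator (unit_slab h m) y \<partial>distr lborel lborel T)"
    by (simp add: distr_lborel_orthogonal[OF orth])
  also have "\<dots> = (\<integral>\<^sup>+y. g (?E (coords h m (T y))) * indicator (unit_slab h m) (T y) \<partial>lborel)"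
    by (rule nn_integral_distr) measurable
  also have "\<dots> = (\<integral>\<^sup>+y. g (coords h m y) * indicator (unit_slab h m) y \<partial>lborel)"
    unfolding E by (simp add: indicator_def slab)
  also have "\<dots> = (\<integral>\<^sup>+x. g x \<partial>PiL m)" by (rule nn_integral_PiL[OF h m g, symmetric])
  finally show ?thesis .
qed

text \<open>The inductive step shrinks the old normals by \<open>c\<close>, puts them at height
  \<open>- 1 / (s + 1)\<close> and adds the vertical unit vector. Existence gives content to the
  choice operator in \<open>simplexS\<close>.\<close>

lemma regular_simplex_normals_exist: "1 \<le> s \<Longrightarrow> \<exists>u. regular_simplex_normals s u"
proof (induction s rule: dec_induct)
  case base
  have "regular_simplex_normals 1 (\<lambda>i a. if i = 0 then 1 else - 1)"
    by (auto simp: regular_simplex_normals_def)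
  then show ?case by blast
next
  case (step s)
  then obtain u where u: "\<And>i j. i \<le> s \<Longrightarrow> j \<le> s \<Longrightarrow> (\<Sum>k<s. u i k * u j k) = (if i = j then 1 else - 1 / real s)"
    by (auto simp: regular_simplex_normals_def)
  define c where "c = sqrt (1 - 1 / (real s + 1)^2)"
  have s1: "real s \<ge> 1" using step by simp
  have "1 / (real s + 1)^2 \<le> 1" using s1 one_le_power[of "real s + 1" 2] by (simp add: divide_le_eq_1)
  then have c2: "c * c = 1 - 1 / (real s + 1)^2" by (simp add: c_def)
  define w where "w = (\<lambda>i a. if i \<le> s then (if a < s then c * u i a else - 1 / (real s + 1)) else (if a < s then 0 else 1))"
  have "regular_simplex_normals (Suc s) w"
    unfolding regular_simplex_normals_def
  proof (intro allI impI)
    fix i j assume ij: "i \<le> Suc s" "j \<le> Suc s"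
    have main: "(\<Sum>k<Suc s. w i k * w j k) = c * c * (\<Sum>k<s. u i k * u j k) + 1 / (real s + 1)^2" if "i \<le> s" "j \<le> s"
      using that by (simp add: w_def sum_distrib_left power2_eq_square algebra_simps)
    have off: "(1 - 1 / (real s + 1)^2) * (- 1 / real s) + 1 / (real s + 1)^2 = - 1 / (real s + 1)"
      using s1 by (simp add: divide_simps power2_eq_square) algebra
    consider "i \<le> s" "j \<le> s" | "i = Suc s" "j \<le> s" | "i \<le> s" "j = Suc s" | "i = Suc s" "j = Suc s"
      using ij by linarith
    then show "(\<Sum>k<Suc s. w i k * w j k) = (if i = j then 1 else - 1 / real (Suc s))"
    proof cases
      case 1 then show ?thesis using main u[OF 1] c2 off by (simp add: add.commute)
    qed (auto simp: w_def add.commute)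
  qed
  then show ?case by blast
qed

text \<open>For the regular simplex the cone is an orthant in a suitable orthonormal basis, so its volume is a
  product of one-dimensional integrals. Finiteness of the emeasure is needed as well, since \<open>measure\<close> is
  0 on sets of infinite measure.\<close>

lemma simplex_volume_ge:
  fixes h :: "nat \<Rightarrow> 'n::{finite,wellorder}"
  assumes h: "bij_betw h {..<CARD('n)} UNIV" and s: "1 \<le> s" "Suc s \<le> CARD('n)"
    and u: "regular_simplex_normals s u"
  shows "sqrt s ^ s * sqrt (s + 1) ^ (s + 1) / fact s
     \<le> measure (PiL s) {x \<in> space (PiL s). \<forall>i\<in>{..s}. (\<Sum>a<s. u i a * x a) \<le> 1}"
proof -
  let ?P = "{x \<in> space (PiL s). \<forall>i\<in>{..s}. (\<Sum>a<s. u i a * x a) \<le> 1}"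
  have s0: "real s > 0" using s by simp
  have gram: "(\<Sum>k<s. u i k * u j k) = (if i = j then 1 else - 1 / real s)" if "i \<le> s" "j \<le> s" for i j
    using u that by (simp add: regular_simplex_normals_def)
  \<comment> \<open>The Gram matrix alone forces this: its entries add up to zero, and their sum is
    the squared length of the sum of the normals.\<close>
  have usum: "(\<Sum>i\<le>s. u i a) = 0" if a: "a < s" for a
  proof -
    have "(\<Sum>k<s. (\<Sum>i\<le>s. u i k)^2) = (\<Sum>k<s. \<Sum>i\<le>s. \<Sum>j\<le>s. u i k * u j k)"
      by (simp add: power2_eq_square sum_product)
    also have "\<dots> = (\<Sum>i\<le>s. \<Sum>j\<le>s. \<Sum>k<s. u i k * u j k)"
      by (subst sum.swap) (intro sum.cong refl sum.swap)
    also have "\<dots> = (\<Sum>i\<le>s. \<Sum>j\<le>s. (if i = j then 1 + 1 / real s else 0) - 1 / real s)"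
      by (intro sum.cong refl) (auto simp: gram)
    also have "\<dots> = (\<Sum>i\<le>s. (1 + 1 / real s) - (real s + 1) / real s)"
      by (intro sum.cong refl) (simp add: sum_subtractf)
    also have "\<dots> = 0" using s0 by (simp add: add_divide_distrib)
    finally have "(\<Sum>k<s. (\<Sum>i\<le>s. u i k)^2) = 0" .
    then have "\<forall>k\<in>{..<s}. (\<Sum>i\<le>s. u i k)^2 = 0" by (subst (asm) sum_nonneg_eq_0_iff) auto
    then show ?thesis using a by simp
  qed
  define \<alpha> where "\<alpha> = sqrt (s / (s + 1))"
  have al: "\<alpha> > 0" "\<alpha> * \<alpha> = s / (s + 1)" using s0 by (auto simp: \<alpha>_def)
  define \<theta> where "\<theta> = sqrt s"
  have th: "\<theta> > 0" "\<theta> * \<theta> = s" using s0 by (auto simp: \<theta>_def)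
  \<comment> \<open>The height is chosen so that \<open>1 / \<theta>^2 = 1 / s\<close> cancels the
    inner products \<open>- 1 / s\<close> of distinct normals. The lifts are then orthogonal, all of
    squared length \<open>1 + 1 / s\<close>, and \<alpha> normalises them.\<close>
  define e where "e = (\<lambda>i a. if a < s then - \<alpha> * u i a else \<alpha> / \<theta>)"
  have edot: "(\<Sum>a<Suc s. e i a * y a) = \<alpha> * (y s / \<theta> - (\<Sum>a<s. u i a * y a))" for i and y :: "nat \<Rightarrow> real"
    by (simp add: e_def sum_distrib_left sum_negf algebra_simps)
  have on: "(\<Sum>a<Suc s. e i a * e j a) = (if i = j then 1 else 0)" if "i < Suc s" "j < Suc s" for i j
  proof -
    have "(\<Sum>a<Suc s. e i a * e j a) = \<alpha> * \<alpha> * (\<Sum>a<s. u i a * u j a) + (\<alpha> * \<alpha>) / (\<theta> * \<theta>)"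
      by (simp add: e_def sum_distrib_left algebra_simps)
    also have "\<dots> = (if i = j then 1 else 0)"
    proof -
      have "s / (s + 1) * (- 1 / s) + s / (s + 1) / s = 0" "s / (s + 1) + s / (s + 1) / s = 1"
        using s0 by (auto simp: divide_simps add_pos_pos)
      then show ?thesis unfolding al th using that by (simp add: gram)
    qed
    finally show ?thesis .
  qed
  let ?w = "\<lambda>y i. \<Sum>a<Suc s. e i a * y a"
  have ws: "(\<Sum>i<Suc s. ?w y i) = \<alpha> * ((s + 1) * (y s / \<theta>))" for y
  proof -
    have "(\<Sum>i<Suc s. ?w y i) = \<alpha> * (\<Sum>i\<le>s. y s / \<theta> - (\<Sum>a<s. u i a * y a))"
      by (simp only: edot sum_distrib_left[symmetric] lessThan_Suc_atMost[symmetric])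
    also have "(\<Sum>i\<le>s. y s / \<theta> - (\<Sum>a<s. u i a * y a)) = (s + 1) * (y s / \<theta>) - (\<Sum>i\<le>s. \<Sum>a<s. u i a * y a)"
      by (simp add: sum_subtractf)
    also have "(\<Sum>i\<le>s. \<Sum>a<s. u i a * y a) = (\<Sum>a<s. (\<Sum>i\<le>s. u i a) * y a)"
      unfolding sum_distrib_right by (rule sum.swap)
    finally show ?thesis using usum by simp
  qed
  have expo: "(\<Prod>i<Suc s. ennreal (exp (- (\<alpha> * ?w y i)))) = ennreal (exp (- (\<theta> * y s)))" for y
  proof -
    have "(\<Prod>i<Suc s. ennreal (exp (- (\<alpha> * ?w y i)))) = ennreal (exp (- (\<alpha> * (\<Sum>i<Suc s. ?w y i))))"
      by (simp add: prod_ennreal exp_sum[symmetric] sum_negf sum_distrib_left del: sum.lessThan_Suc prod.lessThan_Suc)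
    also have "\<alpha> * (\<Sum>i<Suc s. ?w y i) = (\<alpha> * \<alpha>) * (s + 1) * (y s / \<theta>)" unfolding ws by simp
    also have "\<dots> = (\<theta> * \<theta>) * (y s / \<theta>)" unfolding al th using s0 by simp
    also have "\<dots> = \<theta> * y s" using th(1) by simp
    finally show ?thesis .
  qed
  have Psets: "?P \<in> sets (PiL s)" by (rule polytope_sets) simp
  let ?C = "{y. 0 < y s \<and> (\<lambda>i\<in>{..<s}. y i * (\<theta> / y s)) \<in> ?P}"
  have C_iff: "y \<in> ?C \<longleftrightarrow> 0 < y s \<and> (\<forall>i<Suc s. ?w y i \<ge> 0)" for y
  proof -
    have "(\<Sum>a<s. u i a * (\<lambda>i\<in>{..<s}. y i * (\<theta> / y s)) a) \<le> 1 \<longleftrightarrow> ?w y i \<ge> 0" if ys: "y s > 0" for i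
    proof -
      have eq: "(\<Sum>a<s. u i a * (\<lambda>i\<in>{..<s}. y i * (\<theta> / y s)) a) = (\<Sum>a<s. u i a * y a) * (\<theta> / y s)"
        unfolding sum_distrib_right by (intro sum.cong) (auto simp: mult.assoc)
      show ?thesis unfolding eq edot using ys th al by (simp add: zero_le_mult_iff field_simps)
    qed
    then show ?thesis by (auto simp: space_PiM less_Suc_eq_le simp del: sum.lessThan_Suc)
  qed
  have cone: "(\<integral>\<^sup>+y. indicator ?C y * ennreal (exp (- (\<theta> * y s))) \<partial>PiL (Suc s))
     = emeasure (PiL s) ?P * ennreal (fact s / \<theta> ^ (2 * s + 1))"
    by (rule nn_integral_cone[OF th(1) Psets])
  define f where "f = (\<lambda>I t. ennreal (exp (- (\<alpha> * t))) * indicator I t)"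
  have fm[measurable]: "f I \<in> borel_measurable borel" if [measurable]: "I \<in> sets borel" for I
    unfolding f_def by measurable
  define g where "g = (\<lambda>I (w::nat \<Rightarrow> real). \<Prod>i<Suc s. f I (w i))"
  have gm: "g I \<in> borel_measurable (PiL (Suc s))" if I: "I \<in> sets borel" for I
    unfolding g_def by (intro borel_measurable_prod_ennreal measurable_compose[OF _ fm[OF I]]) auto
  have f1: "(\<integral>\<^sup>+t. f {0..} t \<partial>lborel) = ennreal (1 / \<alpha>)"
  proof -
    have "(\<integral>\<^sup>+t. f {0..} t \<partial>lborel) = (\<integral>\<^sup>+t. ennreal (exp (- (\<alpha> * t))) * indicator {0..} t \<partial>lborel)"
      by (simp add: f_def)
    also have "\<dots> = ennreal (1 / \<alpha>) * (\<integral>\<^sup>+t. ennreal (exp (- (\<alpha> * (0 + (1 / \<alpha>) * t)))) * indicator {0..} (0 + (1 / \<alpha>) * t) \<partial>lborel)"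
      using al by (subst nn_integral_real_affine[where c = "1 / \<alpha>" and t = 0]) auto
    also have "(\<integral>\<^sup>+t. ennreal (exp (- (\<alpha> * (0 + (1 / \<alpha>) * t)))) * indicator {0..} (0 + (1 / \<alpha>) * t) \<partial>lborel)
        = (\<integral>\<^sup>+t. ennreal (t ^ 0 * exp (- t)) * indicator {0..} t \<partial>lborel)"
      using al by (intro nn_integral_cong) (auto simp: indicator_def zero_le_divide_iff)
    also have "\<dots> = 1" using nn_intergal_power_times_exp_Ici[of 0] by simp
    finally show ?thesis by simp
  qed
  have f2: "(\<integral>\<^sup>+t. f {0<..} t \<partial>lborel) = ennreal (1 / \<alpha>)"
  proof -
    have "(\<integral>\<^sup>+t. f {0<..} t \<partial>lborel) = (\<integral>\<^sup>+t. f {0..} t \<partial>lborel)"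
    proof (rule nn_integral_cong_AE)
      show "AE t in lborel. f {0<..} t = f {0..} t"
        using AE_lborel_singleton[of 0] by eventually_elim (auto simp: f_def indicator_def)
    qed
    then show ?thesis by (simp add: f1)
  qed
  have gint: "(\<integral>\<^sup>+y. g I (\<lambda>i\<in>{..<Suc s}. ?w y i) \<partial>PiL (Suc s)) = ennreal ((1 / \<alpha>) ^ Suc s)"
    if I: "I \<in> {{0..}, {0<..}}" for I
  proof -
    have Ib: "I \<in> sets borel" using I by auto
    have "(\<integral>\<^sup>+y. g I (\<lambda>i\<in>{..<Suc s}. ?w y i) \<partial>PiL (Suc s)) = (\<integral>\<^sup>+w. g I w \<partial>PiL (Suc s))"
      by (rule nn_integral_PiL_orthonormal[OF h s(2) on gm[OF Ib]])
    also have "\<dots> = (\<Prod>i<Suc s. \<integral>\<^sup>+t. f I t \<partial>lborel)"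
      unfolding g_def using fm[OF Ib] by (intro PiL.product_nn_integral_prod) auto
    also have "\<dots> = (\<Prod>i<Suc s. ennreal (1 / \<alpha>))" using I f1 f2 by auto
    finally show ?thesis using al by (simp add: prod_constant ennreal_power del: power_Suc prod.lessThan_Suc)
  qed
  \<comment> \<open>The cone lies between the open and the closed orthant of the new basis. Both
    have the same integral, so its boundary and the condition \<open>0 < y s\<close> need no
    separate treatment. \<open>upper\<close> provides finiteness, \<open>lower\<close> the
    estimate.\<close>
  have lower: "g {0<..} (\<lambda>i\<in>{..<Suc s}. ?w y i) \<le> indicator ?C y * ennreal (exp (- (\<theta> * y s)))" for y
  proof (cases "\<forall>i<Suc s. ?w y i > 0")
    case True
    have "(\<Sum>i<Suc s. ?w y i) > 0" by (rule sum_pos) (use True in \<open>auto simp del: sum.lessThan_Suc\<close>)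
    then have "y s > 0" unfolding ws using al th s0 by (auto simp: zero_less_mult_iff zero_less_divide_iff)
    then have "y \<in> ?C" unfolding C_iff using True less_imp_le by blast
    then have C: "indicator ?C y = (1 :: ennreal)" by (rule indicator_simps(1))
    have "g {0<..} (\<lambda>i\<in>{..<Suc s}. ?w y i) = (\<Prod>i<Suc s. ennreal (exp (- (\<alpha> * ?w y i))))"
      unfolding g_def f_def using True by (intro prod.cong) auto
    then show ?thesis unfolding expo C by (simp only: mult_1 order_refl)
  next
    case False
    then obtain i where i: "i < Suc s" "\<not> ?w y i > 0" by blast
    then have "g {0<..} (\<lambda>i\<in>{..<Suc s}. ?w y i) = 0"
      unfolding g_def f_def by (intro prod_zero bexI[of _ i]) (auto simp del: sum.lessThan_Suc)
    then show ?thesis by simp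
  qed
  have upper: "indicator ?C y * ennreal (exp (- (\<theta> * y s))) \<le> g {0..} (\<lambda>i\<in>{..<Suc s}. ?w y i)" for y
  proof (cases "y \<in> ?C")
    case True
    then have C: "indicator ?C y = (1 :: ennreal)" by (rule indicator_simps(1))
    have "g {0..} (\<lambda>i\<in>{..<Suc s}. ?w y i) = (\<Prod>i<Suc s. ennreal (exp (- (\<alpha> * ?w y i))))"
      unfolding g_def f_def using True[unfolded C_iff] by (intro prod.cong) (auto simp del: sum.lessThan_Suc)
    then show ?thesis unfolding expo C by (simp only: mult_1 order_refl)
  qed simp
  have "emeasure (PiL s) ?P * ennreal (fact s / \<theta> ^ (2 * s + 1)) \<le> ennreal ((1 / \<alpha>) ^ Suc s)"
  proof -
    have "emeasure (PiL s) ?P * ennreal (fact s / \<theta> ^ (2 * s + 1))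
       \<le> (\<integral>\<^sup>+y. g {0..} (\<lambda>i\<in>{..<Suc s}. ?w y i) \<partial>PiL (Suc s))"
      unfolding cone[symmetric] by (rule nn_integral_mono) (rule upper)
    also have "\<dots> = ennreal ((1 / \<alpha>) ^ Suc s)" by (rule gint) simp
    finally show ?thesis .
  qed
  moreover have "ennreal (fact s / \<theta> ^ (2 * s + 1)) \<noteq> 0"
  proof -
    have "fact s / \<theta> ^ (2 * s + 1) > 0" using th(1) by (intro divide_pos_pos) simp_all
    then show ?thesis by (simp only: ennreal_eq_0_iff not_le)
  qed
  ultimately have fin: "emeasure (PiL s) ?P \<noteq> \<infinity>"
    by (auto simp: ennreal_top_mult top_unique simp del: power_Suc)
  have "ennreal ((1 / \<alpha>) ^ Suc s) \<le> (\<integral>\<^sup>+y. indicator ?C y * ennreal (exp (- (\<theta> * y s))) \<partial>PiL (Suc s))"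
  proof -
    have "ennreal ((1 / \<alpha>) ^ Suc s) = (\<integral>\<^sup>+y. g {0<..} (\<lambda>i\<in>{..<Suc s}. ?w y i) \<partial>PiL (Suc s))"
      by (rule gint[symmetric]) simp
    also have "\<dots> \<le> (\<integral>\<^sup>+y. indicator ?C y * ennreal (exp (- (\<theta> * y s))) \<partial>PiL (Suc s))"
      by (rule nn_integral_mono) (rule lower)
    finally show ?thesis .
  qed
  also have "\<dots> = emeasure (PiL s) ?P * ennreal (fact s / \<theta> ^ (2 * s + 1))"
    by (rule cone)
  finally have main: "ennreal ((1 / \<alpha>) ^ Suc s) \<le> emeasure (PiL s) ?P * ennreal (fact s / \<theta> ^ (2 * s + 1))" .
  have "ennreal (\<theta> ^ (2 * s + 1) / fact s) * ennreal ((1 / \<alpha>) ^ Suc s)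
     \<le> ennreal (\<theta> ^ (2 * s + 1) / fact s) * (emeasure (PiL s) ?P * ennreal (fact s / \<theta> ^ (2 * s + 1)))"
    using main by (rule mult_left_mono) simp
  also have "\<dots> = emeasure (PiL s) ?P"
  proof -
    have "ennreal (\<theta> ^ (2 * s + 1) / fact s) * ennreal (fact s / \<theta> ^ (2 * s + 1)) = 1"
      using th by (simp add: ennreal_mult[symmetric] del: power_Suc)
    moreover have "ennreal (\<theta> ^ (2 * s + 1) / fact s) * (emeasure (PiL s) ?P * ennreal (fact s / \<theta> ^ (2 * s + 1)))
      = (ennreal (\<theta> ^ (2 * s + 1) / fact s) * ennreal (fact s / \<theta> ^ (2 * s + 1))) * emeasure (PiL s) ?P"
      by (simp only: ac_simps)
    ultimately show ?thesis by simp
  qed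
  also have "ennreal (\<theta> ^ (2 * s + 1) / fact s) * ennreal ((1 / \<alpha>) ^ Suc s) = ennreal (sqrt s ^ s * sqrt (s + 1) ^ (s + 1) / fact s)"
  proof -
    have "1 / \<alpha> = sqrt (s + 1) / \<theta>" using s0 by (simp add: \<alpha>_def \<theta>_def real_sqrt_divide)
    then have "\<theta> ^ (2 * s + 1) / fact s * (1 / \<alpha>) ^ Suc s = sqrt s ^ s * sqrt (s + 1) ^ (s + 1) / fact s * (\<theta> ^ (s + 1) / \<theta> ^ (s + 1))"
      by (simp add: power_divide \<theta>_def power_add mult_2)
    also have "\<theta> ^ (s + 1) / \<theta> ^ (s + 1) = 1" using th by simp
    finally have "\<theta> ^ (2 * s + 1) / fact s * (1 / \<alpha>) ^ Suc s = sqrt s ^ s * sqrt (s + 1) ^ (s + 1) / fact s" by simp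
    then show ?thesis using th al by (simp add: ennreal_mult[symmetric] del: power_Suc)
  qed
  finally have "ennreal (sqrt s ^ s * sqrt (s + 1) ^ (s + 1) / fact s) \<le> emeasure (PiL s) ?P" .
  then show ?thesis using fin by (simp add: emeasure_eq_ennreal_measure)
qed

lemma volS_cubeS: "volS s (cubeS s) = 2 ^ s"
proof -
  have "cubeS s = Pi\<^sub>E {..<s} (\<lambda>_. {-1..1})"
    unfolding cubeS_def by (intro set_eqI iffI) (auto simp: PiE_iff abs_le_iff; force)+
  moreover have "emeasure (PiL s) (Pi\<^sub>E {..<s} (\<lambda>_. {-1..1})) = (\<Prod>i<s. emeasure lborel {-1..1::real})"
    by (rule PiL.emeasure_PiM) simp_all
  ultimately show ?thesis by (simp add: volS_def measure_def prod_constant ennreal_power[symmetric])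
qed

section \<open>Adapted coordinates\<close>

lemma onb_orthonormal:
  fixes V :: "'a::euclidean_space set"
  assumes "subspace V"
  shows "\<And>i j. i < dim V \<Longrightarrow> j < dim V \<Longrightarrow> onb V i \<bullet> onb V j = (if i = j then 1 else 0)"
    and "span (onb V ` {..<dim V}) = V"
proof -
  obtain B where B: "B \<subseteq> V" "pairwise orthogonal B" "\<And>x. x \<in> B \<Longrightarrow> norm x = 1"
    "independent B" "card B = dim V" "span B = V"
    using orthonormal_basis_subspace[OF assms] by metis
  obtain b where b: "bij_betw b {0..<card B} B"
    using ex_bij_betw_nat_finite[OF independent_imp_finite[OF B(4)]] by blast
  have "b i \<bullet> b j = (if i = j then 1 else 0)" if "i < dim V" "j < dim V" for i j
  proof (cases "i = j")
    case True
    have "b i \<in> B" using b that B(5) by (auto simp: bij_betw_def)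
    then show ?thesis using B(3)[of "b i"] True by (simp add: norm_eq_1)
  next
    case False
    have "b i \<in> B" "b j \<in> B" "b i \<noteq> b j" using b that B(5) False by (auto simp: bij_betw_def inj_on_def)
    then show ?thesis using B(2) False by (auto simp: pairwise_def orthogonal_def)
  qed
  moreover have "span (b ` {..<dim V}) = V" using b B(5,6) by (simp add: bij_betw_def lessThan_atLeast0)
  ultimately have "(\<forall>i<dim V. \<forall>j<dim V. onb V i \<bullet> onb V j = (if i = j then 1 else 0)) \<and> span (onb V ` {..<dim V}) = V"
    unfolding onb_def by (intro someI_ex[where P = "\<lambda>b. (\<forall>i<dim V. \<forall>j<dim V. b i \<bullet> b j = (if i = j then 1 else 0)) \<and> span (b ` {..<dim V}) = V"]) blast
  then show "\<And>i j. i < dim V \<Longrightarrow> j < dim V \<Longrightarrow> onb V i \<bullet> onb V j = (if i = j then 1 else 0)"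
    "span (onb V ` {..<dim V}) = V" by blast+
qed

lemma dim_orthogonal_comp:
  fixes V :: "'a::euclidean_space set"
  assumes "subspace V"
  shows "dim V + dim (orthogonal_comp V) = DIM('a)"
proof -
  have "{y \<in> UNIV. \<forall>x\<in>V. orthogonal x y} = orthogonal_comp V" by (auto simp: orthogonal_comp_def)
  then show ?thesis
    using dim_subspace_orthogonal_to_vectors[OF assms subspace_UNIV subset_UNIV] by (simp only: dim_UNIV add.commute)
qed

text \<open>The first \<open>dim F\<close> coordinates refer to the very basis \<open>onb F\<close>
  chosen in \<open>subvol\<close>, so that the volumes of the theorem become volumes of coordinate
  sections. A basis of the orthogonal complement fills the rest.\<close>

lemma adapted_isometry_exists:
  fixes F :: "'a::euclidean_space set" and h :: "nat \<Rightarrow> 'n::finite"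
  assumes F: "subspace F" and h: "bij_betw h {..<CARD('n)} UNIV" and n: "CARD('n) = DIM('a)"
  obtains \<Phi> :: "real^'n \<Rightarrow> 'a" where
    "linear \<Phi>" "bij \<Phi>" "\<And>x y. \<Phi> x \<bullet> \<Phi> y = x \<bullet> y"
    "\<And>w. \<Phi> (embed_vec h (dim F) w) = (\<Sum>i<dim F. w i *\<^sub>R onb F i)"
    "\<And>y. \<Phi> y \<in> F \<longleftrightarrow> (\<forall>i\<in>-h ` {..<dim F}. y $ i = 0)"
    "\<And>y. \<Phi> y \<in> orthogonal_comp F \<longleftrightarrow> (\<forall>i\<in>h ` {..<dim F}. y $ i = 0)"
proof -
  define s where "s = dim F"
  let ?G = "orthogonal_comp F"
  have G: "subspace ?G" by (rule subspace_orthogonal_comp)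
  have dims: "s + dim ?G = DIM('a)" unfolding s_def by (rule dim_orthogonal_comp[OF F])
  have s: "s \<le> CARD('n)" using dims n by simp
  define b where "b = (\<lambda>i. if i < s then onb F i else onb ?G (i - s))"
  have bF: "b i \<in> F" if "i < s" for i
    using onb_orthonormal(2)[OF F] that span_base[of "onb F i" "onb F ` {..<dim F}"] by (auto simp: b_def s_def)
  have bG: "b i \<in> ?G" if "s \<le> i" "i < DIM('a)" for i
  proof -
    have "i - s < dim ?G" using that dims by simp
    then show ?thesis
      using onb_orthonormal(2)[OF G] that span_base[of "onb ?G (i - s)" "onb ?G ` {..<dim ?G}"] by (auto simp: b_def)
  qed
  have FG: "x \<bullet> y = 0" if "x \<in> F" "y \<in> ?G" for x y
    using that by (auto simp: orthogonal_comp_def orthogonal_def)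
  have bb: "b i \<bullet> b j = (if i = j then 1 else 0)" if ij: "i < DIM('a)" "j < DIM('a)" for i j
  proof -
    consider "i < s" "j < s" | "i < s" "s \<le> j" | "s \<le> i" "j < s" | "s \<le> i" "s \<le> j" by linarith
    then show ?thesis
    proof cases
      case 1 then show ?thesis using onb_orthonormal(1)[OF F] by (simp add: b_def s_def)
    next
      case 2 then show ?thesis using FG[OF bF bG] ij by simp
    next
      case 3 then show ?thesis using FG[OF bF[of j] bG[of i]] ij by (simp add: inner_commute)
    next
      case 4
      then have "i - s < dim ?G" "j - s < dim ?G" "(i - s = j - s) = (i = j)" using ij dims by auto
      then show ?thesis using onb_orthonormal(1)[OF G] 4 by (simp add: b_def)
    qed
  qed
  define \<Phi> where "\<Phi> = (\<lambda>y::real^'n. \<Sum>i<CARD('n). y $ h i *\<^sub>R b i)"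
  have \<Phi>b: "\<Phi> y \<bullet> b j = y $ h j" if "j < CARD('n)" for y j
  proof -
    have "\<Phi> y \<bullet> b j = (\<Sum>i<CARD('n). if i = j then y $ h i else 0)"
      unfolding \<Phi>_def inner_sum_left using that n by (intro sum.cong) (auto simp: bb)
    then show ?thesis using that by simp
  qed
  have lin: "linear \<Phi>"
    by (rule linearI) (simp_all add: \<Phi>_def scaleR_add_left sum.distrib scaleR_sum_right)
  have inn: "\<Phi> x \<bullet> \<Phi> y = x \<bullet> y" for x y
  proof -
    have "\<Phi> x \<bullet> \<Phi> y = (\<Sum>i<CARD('n). x $ h i * y $ h i)"
    proof -
      have "\<Phi> x \<bullet> \<Phi> y = (\<Sum>i<CARD('n). x $ h i *\<^sub>R b i) \<bullet> \<Phi> y" by (simp only: \<Phi>_def)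
      also have "\<dots> = (\<Sum>i<CARD('n). x $ h i * (\<Phi> y \<bullet> b i))" by (simp add: inner_sum_left inner_commute[of "\<Phi> y"])
      finally show ?thesis by (simp add: \<Phi>b)
    qed
    also have "\<dots> = x \<bullet> y" unfolding inner_vec_def by (subst sum_over_enumeration[OF h order_refl]) simp
    finally show ?thesis .
  qed
  have inj: "inj \<Phi>"
  proof (rule injI)
    fix x y assume "\<Phi> x = \<Phi> y"
    then have "\<Phi> (x - y) = 0" using lin by (simp add: linear_diff)
    then have "(x - y) \<bullet> (x - y) = 0" unfolding inn[symmetric] by simp
    then show "x = y" by simp
  qed
  have "dim (range \<Phi>) = DIM('a)"
    using dim_image_eq[OF lin, of UNIV] inj n by simp
  then have "span (range \<Phi>) = UNIV" by (simp only: dim_eq_full)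
  then have surj: "surj \<Phi>" using linear_subspace_image[OF lin subspace_UNIV] by (metis span_eq_iff)
  have surjh: "\<exists>a<CARD('n). i = h a" for i
    using h unfolding bij_betw_def by (metis UNIV_I imageE lessThan_iff)
  have injh: "h a = h a' \<longleftrightarrow> a = a'" if "a < CARD('n)" "a' < CARD('n)" for a a'
    using h that by (auto simp: bij_betw_def inj_on_def)
  have co: "i \<in> - h ` {..<s} \<longleftrightarrow> (\<exists>a\<in>{s..<CARD('n)}. i = h a)" for i
  proof -
    obtain a where a: "a < CARD('n)" "i = h a" using surjh by blast
    have "i \<in> h ` {..<s} \<longleftrightarrow> a < s"
      unfolding a(2) using inj_on_image_mem_iff[of h "{..<CARD('n)}" a "{..<s}"] h a s by (auto simp: bij_betw_def)
    then show ?thesis using a injh[OF a(1)] by (auto simp: not_less)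
  qed
  show ?thesis
  proof (rule that[of \<Phi>])
    show "linear \<Phi>" by (rule lin)
    show "bij \<Phi>" using inj surj by (simp add: bij_def)
    show "\<Phi> x \<bullet> \<Phi> y = x \<bullet> y" for x y by (rule inn)
    show "\<Phi> (embed_vec h (dim F) w) = (\<Sum>i<dim F. w i *\<^sub>R onb F i)" for w
    proof -
      have "\<Phi> (embed_vec h s w) = (\<Sum>i<CARD('n). if i < s then w i *\<^sub>R b i else 0)"
        unfolding \<Phi>_def using s by (intro sum.cong) (auto simp: embed_vec_nth[OF h])
      also have "\<dots> = (\<Sum>i<s. w i *\<^sub>R b i)"
        using s by (intro sum.mono_neutral_cong_right) auto
      finally show ?thesis by (simp add: s_def b_def)
    qed
    show "\<Phi> y \<in> F \<longleftrightarrow> (\<forall>i\<in>-h ` {..<dim F}. y $ i = 0)" for y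
    proof
      assume "\<Phi> y \<in> F"
      then have "\<Phi> y \<bullet> b a = 0" if "s \<le> a" "a < CARD('n)" for a using FG bG that n by simp
      then show "\<forall>i\<in>-h ` {..<dim F}. y $ i = 0" using co by (auto simp: s_def \<Phi>b)
    next
      assume "\<forall>i\<in>-h ` {..<dim F}. y $ i = 0"
      then have z: "y $ h a = 0" if "s \<le> a" "a < CARD('n)" for a using co[of "h a"] that by (auto simp: s_def)
      have "y $ h a *\<^sub>R b a \<in> F" if "a < CARD('n)" for a
        using z[of a] bF[of a] that F by (cases "a < s") (auto simp: subspace_scale subspace_0)
      then show "\<Phi> y \<in> F" unfolding \<Phi>_def by (intro subspace_sum[OF F]) auto
    qed
    show "\<Phi> y \<in> ?G \<longleftrightarrow> (\<forall>i\<in>h ` {..<dim F}. y $ i = 0)" for y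
    proof
      assume "\<Phi> y \<in> ?G"
      then have "b a \<bullet> \<Phi> y = 0" if "a < s" for a using FG bF that by simp
      then show "\<forall>i\<in>h ` {..<dim F}. y $ i = 0" using s by (auto simp: s_def \<Phi>b inner_commute[of "b _"])
    next
      assume "\<forall>i\<in>h ` {..<dim F}. y $ i = 0"
      then have z: "y $ h a = 0" if "a < s" for a using that by (auto simp: s_def)
      have "y $ h a *\<^sub>R b a \<in> ?G" if "a < CARD('n)" for a
        using z[of a] bG[of a] that G n by (cases "a < s") (auto simp: subspace_scale subspace_0)
      then show "\<Phi> y \<in> ?G" unfolding \<Phi>_def by (intro subspace_sum[OF G]) auto
    qed
  qed
qed

text \<open>Only a common factor matters, since volumes of ellipsoids are merely compared. The map
  is split into a linear map of vectors, which has a determinant, and the identification of the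
  standard bases, which preserves Lebesgue measure.\<close>

lemma linear_bijection_scales_measure:
  fixes L :: "real^('n::{finite,wellorder}) \<Rightarrow> 'a::euclidean_space"
  assumes L: "linear L" "bij L" and n: "CARD('n) = DIM('a)"
  obtains \<kappa> where "\<kappa> > 0" "\<And>S. compact S \<Longrightarrow> measure lebesgue (L ` S) = \<kappa> * measure lebesgue S"
proof -
  obtain \<beta> :: "'n \<Rightarrow> 'a" where \<beta>: "bij_betw \<beta> UNIV Basis"
    using finite_same_card_bij[of "UNIV :: 'n set" "Basis :: 'a set"] n by auto
  define \<Psi> where "\<Psi> = (\<lambda>y::real^('n::{finite,wellorder}). \<Sum>k\<in>UNIV. y $ k *\<^sub>R \<beta> k)"
  have \<beta>\<beta>: "\<beta> j \<bullet> \<beta> k = (if j = k then 1 else 0)" for j k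
  proof -
    have "\<beta> j \<in> Basis" "\<beta> k \<in> Basis" "(\<beta> j = \<beta> k) = (j = k)" using \<beta> by (auto simp: bij_betw_def inj_eq)
    then show ?thesis by (simp add: inner_Basis)
  qed
  have \<Psi>\<beta>: "\<Psi> y \<bullet> \<beta> k = y $ k" for y k
    by (simp add: \<Psi>_def inner_sum_left \<beta>\<beta> if_distrib[of "\<lambda>t. _ * t"] cong: if_cong)
  have lin: "linear \<Psi>"
    by (rule linearI) (simp_all add: \<Psi>_def scaleR_add_left sum.distrib scaleR_sum_right)
  have B: "b \<in> Basis \<longleftrightarrow> (\<exists>k. b = \<beta> k)" for b using \<beta> by (auto simp: bij_betw_def)
  define \<Theta> where "\<Theta> = (\<lambda>x::'a. (\<chi> k. x \<bullet> \<beta> k) :: real^('n::{finite,wellorder}))"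
  have inv: "\<Theta> (\<Psi> y) = y" "\<Psi> (\<Theta> x) = x" for x y
  proof -
    show "\<Theta> (\<Psi> y) = y" by (simp add: \<Theta>_def \<Psi>\<beta> vec_eq_iff)
    show "\<Psi> (\<Theta> x) = x" by (rule euclidean_eqI) (auto simp: B \<Psi>\<beta> \<Theta>_def)
  qed
  have lin\<Theta>: "linear \<Theta>" by (rule linearI) (simp_all add: \<Theta>_def vec_eq_iff inner_add_left)
  have [measurable]: "\<Psi> \<in> borel_measurable borel"
    using linear_continuous_on[OF linear_conv_bounded_linear[THEN iffD1, OF lin]]
    by (intro borel_measurable_continuous_onI)
  have distr: "lborel = distr lborel borel \<Psi>"
  proof (rule lborel_eqI)
    fix l u :: 'a assume lu: "\<And>b. b \<in> Basis \<Longrightarrow> l \<bullet> b \<le> u \<bullet> b"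
    have lu': "l \<bullet> \<beta> k \<le> u \<bullet> \<beta> k" for k by (rule lu) (use B in blast)
    have vim: "\<Psi> -` box l u = box (\<Theta> l) (\<Theta> u)"
    proof (intro set_eqI iffI)
      show "x \<in> box (\<Theta> l) (\<Theta> u)" if "x \<in> \<Psi> -` box l u" for x
      proof -
        have "\<forall>k. l \<bullet> \<beta> k < \<Psi> x \<bullet> \<beta> k \<and> \<Psi> x \<bullet> \<beta> k < u \<bullet> \<beta> k" using that B by (auto simp: mem_box)
        then show ?thesis by (simp add: mem_box_cart \<Psi>\<beta> \<Theta>_def)
      qed
    qed (auto simp: mem_box_cart mem_box B \<Psi>\<beta> \<Theta>_def)
    have ax: "bij_betw (\<lambda>k::'n. axis k (1::real)) UNIV Basis"
      by (auto simp: bij_betw_def inj_on_def axis_eq_axis Basis_vec_def)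
    have "emeasure (distr lborel borel \<Psi>) (box l u) = emeasure lborel (box (\<Theta> l) (\<Theta> u))"
      by (subst emeasure_distr) (auto simp: vim)
    also have "\<dots> = ennreal (\<Prod>b\<in>Basis. (\<Theta> u - \<Theta> l) \<bullet> b)"
      by (rule emeasure_lborel_box) (use lu' in \<open>auto simp: Basis_vec_def inner_axis \<Theta>_def\<close>)
    also have "(\<Prod>b\<in>Basis. (\<Theta> u - \<Theta> l) \<bullet> b) = (\<Prod>k\<in>UNIV. (u - l) \<bullet> \<beta> k)"
      by (subst prod.reindex_bij_betw[OF ax, symmetric]) (simp add: inner_axis \<Theta>_def inner_diff_left)
    also have "\<dots> = (\<Prod>b\<in>Basis. (u - l) \<bullet> b)" by (rule prod.reindex_bij_betw[OF \<beta>])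
    finally show "emeasure (distr lborel borel \<Psi>) (box l u) = ennreal (\<Prod>b\<in>Basis. (u - l) \<bullet> b)" .
  qed simp
  have \<Psi>m: "measure lebesgue (\<Psi> ` S) = measure lebesgue S" if S: "compact S" for S
  proof -
    have c: "compact (\<Psi> ` S)" using S linear_continuous_on[OF linear_conv_bounded_linear[THEN iffD1, OF lin]]
      by (intro compact_continuous_image)
    have "emeasure lborel (\<Psi> ` S) = emeasure lborel (\<Psi> -` \<Psi> ` S)"
      using c by (subst distr, subst emeasure_distr) (auto simp: borel_compact)
    also have "\<Psi> -` \<Psi> ` S = S" using inv by (metis injI inj_vimage_image_eq)
    finally show ?thesis using c S by (simp add: measure_def borel_compact)
  qed
  define N where "N = (\<lambda>y. \<Theta> (L y))"
  have linN: "linear N" unfolding N_def using linear_compose[OF L(1) lin\<Theta>] by (simp add: o_def)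
  have injN: "inj N" unfolding N_def using L(2) inv by (metis (no_types, lifting) bij_def injD injI)
  have "measure lebesgue (L ` S) = \<bar>det (matrix N)\<bar> * measure lebesgue S" if S: "compact S" for S
  proof -
    have "L ` S = \<Psi> ` (N ` S)" unfolding N_def image_image inv ..
    moreover have "compact (N ` S)" using S linear_continuous_on[OF linear_conv_bounded_linear[THEN iffD1, OF linN]]
      by (intro compact_continuous_image)
    ultimately have "measure lebesgue (L ` S) = measure lebesgue (N ` S)" by (simp add: \<Psi>m)
    also have "\<dots> = \<bar>det (matrix N)\<bar> * measure lebesgue S"
      by (rule measure_linear_image[OF linN lmeasurable_compact[OF S]])
    finally show ?thesis .
  qed
  moreover have "\<bar>det (matrix N)\<bar> > 0" using det_nz_iff_inj[OF linN] injN by simp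
  ultimately show ?thesis by (rule that[rotated])
qed

section \<open>Volumes of coordinate sections\<close>

definition coord_section :: "(nat \<Rightarrow> 'n::finite) \<Rightarrow> nat \<Rightarrow> (real^'n) set \<Rightarrow> (nat \<Rightarrow> real) set" where
  "coord_section h s S = {c \<in> PiE {..<s} (\<lambda>_. UNIV). embed_vec h s c \<in> S}"

lemma continuous_embed_coords:
  fixes h :: "nat \<Rightarrow> 'n::finite"
  shows "continuous_on UNIV (\<lambda>x::real^'n. embed_vec h s (coords h s x))"
proof -
  have "(\<lambda>x::real^'n. embed_vec h s (coords h s x)) = (\<lambda>x. \<Sum>a<s. x $ h a *\<^sub>R axis (h a) 1)"
    by (simp add: embed_vec_def coords_def)
  then show ?thesis by (simp only:) (intro continuous_intros)
qed

lemma coord_section_sets: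
  fixes h :: "nat \<Rightarrow> 'n::finite"
  assumes S: "closed S"
  shows "coord_section h s S \<in> sets (PiL s)"
proof -
  have "(\<lambda>c. embed_vec h s c) \<in> borel_measurable (PiL s)"
    unfolding embed_vec_def by (intro borel_measurable_sum borel_measurable_scaleR) auto
  then have "embed_vec h s -` S \<inter> space (PiL s) \<in> sets (PiL s)"
    using borel_closed[OF S] by (rule measurable_sets)
  moreover have "embed_vec h s -` S \<inter> space (PiL s) = coord_section h s S"
    by (auto simp: coord_section_def space_PiM)
  ultimately show ?thesis by simp
qed

text \<open>Thickening by unit intervals in the remaining coordinates replaces the section by a
  bounded set of full dimension with the same volume.\<close>

lemma volS_coord_section:
  fixes h :: "nat \<Rightarrow> 'n::{finite,wellorder}"
  assumes h: "bij_betw h {..<CARD('n)} UNIV" and s: "s \<le> CARD('n)" and S: "compact S"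
  shows "{x \<in> unit_slab h s. embed_vec h s (coords h s x) \<in> S} \<in> lmeasurable"
    and "volS s (coord_section h s S) = measure lebesgue {x \<in> unit_slab h s. embed_vec h s (coords h s x) \<in> S}"
proof -
  let ?T = "{x \<in> unit_slab h s. embed_vec h s (coords h s x) \<in> S}"
  let ?p = "\<lambda>x::real^('n::{finite,wellorder}). embed_vec h s (coords h s x)"
  have "closed (?p -` S)"
    using continuous_closed_vimage[OF compact_imp_closed[OF S]] continuous_embed_coords[of h s]
    by (auto simp: continuous_on_eq_continuous_at)
  then have T[measurable]: "?T \<in> sets borel"
    using sets.Int[OF unit_slab_sets borel_closed, of "?p -` S" h s] by (simp add: Int_def)
  obtain B where B: "\<And>y. y \<in> S \<Longrightarrow> norm y \<le> B" using compact_imp_bounded[OF S] by (auto simp: bounded_iff)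
  have bound: "\<bar>x $ i\<bar> \<le> max B 1" if x: "x \<in> ?T" for x i
  proof -
    obtain a where a: "a < CARD('n)" "i = h a"
      using h unfolding bij_betw_def by (metis UNIV_I imageE lessThan_iff)
    show ?thesis
    proof (cases "a < s")
      case True
      then have "x $ i = ?p x $ i" using s by (simp add: a embed_vec_nth[OF h] coords_def)
      then show ?thesis using component_le_norm_cart[of "?p x" i] B[of "?p x"] x by simp
    next
      case False
      then have "x $ h a \<in> {0<..<1}" using x a by (simp add: unit_slab_def)
      then show ?thesis by (auto simp: a max_def)
    qed
  qed
  have "bounded ?T" unfolding bounded_iff
  proof (intro exI ballI)
    fix x assume x: "x \<in> ?T"
    have "norm x \<le> (\<Sum>i\<in>UNIV. \<bar>x $ i\<bar>)" by (rule norm_le_l1_cart)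
    also have "\<dots> \<le> (\<Sum>i\<in>(UNIV::'n set). max B 1)" by (intro sum_mono bound[OF x])
    finally show "norm x \<le> (\<Sum>i\<in>(UNIV::'n set). max B 1)" .
  qed
  then show "?T \<in> lmeasurable" by (intro bounded_set_imp_lmeasurable) auto
  have C: "coord_section h s S \<in> sets (PiL s)" using S by (intro coord_section_sets compact_imp_closed)
  have "emeasure (PiL s) (coord_section h s S) = (\<integral>\<^sup>+x. indicator (coord_section h s S) x \<partial>PiL s)"
    using C by simp
  also have "\<dots> = (\<integral>\<^sup>+x. indicator (coord_section h s S) (coords h s x) * indicator (unit_slab h s) x \<partial>lborel)"
    using C by (intro nn_integral_PiL[OF h s]) simp
  also have "\<dots> = (\<integral>\<^sup>+x. indicator ?T x \<partial>lborel)"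
    by (intro nn_integral_cong) (auto simp: indicator_def coord_section_def coords_def)
  also have "\<dots> = emeasure lebesgue ?T" using T by simp
  finally show "volS s (coord_section h s S) = measure lebesgue ?T" by (simp add: volS_def measure_def)
qed

text \<open>\<open>M\<close> acts as \<open>N\<close> on the coordinate subspace and leaves the
  other coordinates alone. It preserves the slab, and so the determinant of \<open>M\<close> on the
  full space gives the factor for sections.\<close>

lemma volS_section_linear_image:
  fixes h :: "nat \<Rightarrow> 'n::{finite,wellorder}" and N :: "real^('n::{finite,wellorder}) \<Rightarrow> real^('n::{finite,wellorder})"
  assumes h: "bij_betw h {..<CARD('n)} UNIV" and s: "s \<le> CARD('n)"
    and N: "linear N" "inj N"
    and inv: "\<And>y. (\<forall>i\<in>-h ` {..<s}. N y $ i = 0) \<longleftrightarrow> (\<forall>i\<in>-h ` {..<s}. y $ i = 0)"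
  obtains \<kappa> where "\<kappa> > 0" "\<And>S. compact S \<Longrightarrow> volS s (coord_section h s (N ` S)) = \<kappa> * volS s (coord_section h s S)"
proof -
  let ?p = "\<lambda>x::real^('n::{finite,wellorder}). embed_vec h s (coords h s x)"
  have pn: "?p x $ i = (if i \<in> h ` {..<s} then x $ i else 0)" for x i
  proof -
    obtain a where a: "a < CARD('n)" "i = h a"
      using h unfolding bij_betw_def by (metis UNIV_I imageE lessThan_iff)
    have "i \<in> h ` {..<s} \<longleftrightarrow> a < s"
      unfolding a(2) using inj_on_image_mem_iff[of h "{..<CARD('n)}" a "{..<s}"] h a s by (auto simp: bij_betw_def)
    then show ?thesis using a s by (simp add: embed_vec_nth[OF h] coords_def)
  qed
  have linp: "linear ?p" by (rule linearI) (auto simp: vec_eq_iff pn)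
  have Np: "N (?p x) $ i = 0" if "i \<notin> h ` {..<s}" for x i
  proof -
    have "\<forall>i\<in>-h ` {..<s}. N (?p x) $ i = 0" unfolding inv by (simp add: pn)
    then show ?thesis using that by blast
  qed
  define M where "M = (\<lambda>x. N (?p x) + (x - ?p x))"
  have linM: "linear M" unfolding M_def
    by (intro linear_compose_add linear_compose_sub linear_ident linp) (use linear_compose[OF linp N(1)] in \<open>simp add: o_def\<close>)
  have pM: "?p (M x) = N (?p x)" for x
    by (simp add: M_def vec_eq_iff pn Np)
  have qM: "M x $ i = x $ i" if "i \<notin> h ` {..<s}" for x i
    using that by (simp add: M_def pn Np)
  have injM: "inj M"
  proof (rule injI)
    fix x y assume eq: "M x = M y"
    then have "N (?p x) = N (?p y)" using pM by metis
    then have "?p x = ?p y" using N(2) by (simp add: inj_eq)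
    then show "x = y" using eq by (simp add: M_def)
  qed
  have surjM: "surj M" by (rule linear_inj_imp_surj[OF linM injM])
  have slab: "M x \<in> unit_slab h s \<longleftrightarrow> x \<in> unit_slab h s" for x
  proof -
    have "h i \<notin> h ` {..<s}" if "i \<in> {s..<CARD('n)}" for i
      using inj_on_image_mem_iff[of h "{..<CARD('n)}" i "{..<s}"] h that s by (auto simp: bij_betw_def)
    then show ?thesis by (auto simp: unit_slab_def qM)
  qed
  have "volS s (coord_section h s (N ` S)) = \<bar>det (matrix M)\<bar> * volS s (coord_section h s S)" if S: "compact S" for S
  proof -
    have NS: "compact (N ` S)" using S linear_continuous_on[OF linear_conv_bounded_linear[THEN iffD1, OF N(1)]]
      by (intro compact_continuous_image)
    have "{x \<in> unit_slab h s. ?p x \<in> N ` S} = M ` {x \<in> unit_slab h s. ?p x \<in> S}"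
    proof (intro set_eqI iffI)
      fix z assume z: "z \<in> {x \<in> unit_slab h s. ?p x \<in> N ` S}"
      obtain x where x: "z = M x" using surjM by (metis surjD)
      have "N (?p x) \<in> N ` S" using z pM by (simp add: x)
      then have "?p x \<in> S" using N(2) by (simp add: inj_image_mem_iff)
      then show "z \<in> M ` {x \<in> unit_slab h s. ?p x \<in> S}" using z slab by (auto simp: x)
    qed (auto simp: slab pM)
    then show ?thesis
      unfolding volS_coord_section(2)[OF h s S] volS_coord_section(2)[OF h s NS]
      using measure_linear_image[OF linM volS_coord_section(1)[OF h s S]] by simp
  qed
  moreover have "\<bar>det (matrix M)\<bar> > 0" using det_nz_iff_inj[OF linM] injM by simp
  ultimately show ?thesis by (rule that[rotated])
qed

section \<open>Consequences of the decomposition\<close>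

lemma linear_inv_of_bij:
  fixes f :: "'a::real_vector \<Rightarrow> 'b::real_vector"
  assumes f: "linear f" "bij f"
  shows "linear (inv f)"
proof (rule linearI)
  have ff: "f (inv f x) = x" for x using f(2) by (simp add: bij_is_surj surj_f_inv_f)
  show "inv f (x + y) = inv f x + inv f y" for x y
    using f by (intro inv_f_eq) (simp_all add: bij_is_inj linear_add ff)
  show "inv f (r *\<^sub>R x) = r *\<^sub>R inv f x" for r x
    using f by (intro inv_f_eq) (simp_all add: bij_is_inj linear_scale ff)
qed

locale block_frame =
  fixes U :: "(real^'n) set" and \<mu> :: "real^'n \<Rightarrow> real" and P :: "'n::finite set"
  assumes finite_contact: "finite U"
    and norm_contact: "\<And>u. u \<in> U \<Longrightarrow> norm u = 1"
    and weight_nonneg: "\<And>u. u \<in> U \<Longrightarrow> 0 \<le> \<mu> u"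
    and weight_sum: "(\<Sum>u\<in>U. \<mu> u) = real CARD('n)"
    and centred: "(\<Sum>u\<in>U. \<mu> u *\<^sub>R u) = 0"
    and frame_block: "\<And>i j. i \<in> P \<Longrightarrow> j \<in> P \<Longrightarrow> (\<Sum>u\<in>U. \<mu> u * (u $ i * u $ j)) = (if i = j then 1 else 0)"
    and trace_off_block: "(\<Sum>u\<in>U. \<mu> u * (\<Sum>i\<in>-P. (u $ i)^2)) = real (card (-P))"
begin

lemma sum_inner_zero: "(\<Sum>u\<in>U. \<mu> u * (y \<bullet> u)) = 0"
proof -
  have "(\<Sum>u\<in>U. \<mu> u * (y \<bullet> u)) = y \<bullet> (\<Sum>u\<in>U. \<mu> u *\<^sub>R u)" by (simp add: inner_sum_right)
  then show ?thesis by (simp add: centred)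
qed

lemma frame_identity:
  assumes y: "\<forall>i\<in>-P. y $ i = 0"
  shows "(\<Sum>u\<in>U. \<mu> u * (y \<bullet> u)^2) = (norm y)^2"
proof -
  have red: "y \<bullet> u = (\<Sum>i\<in>P. y $ i * u $ i)" for u
    unfolding inner_vec_def by (rule sum.mono_neutral_cong_right) (use y in auto)
  have "(\<Sum>u\<in>U. \<mu> u * (y \<bullet> u)^2) = (\<Sum>u\<in>U. \<Sum>i\<in>P. \<Sum>j\<in>P. y $ i * y $ j * (\<mu> u * (u $ i * u $ j)))"
    unfolding red power2_eq_square sum_product by (simp add: sum_distrib_left ac_simps)
  also have "\<dots> = (\<Sum>i\<in>P. \<Sum>u\<in>U. \<Sum>j\<in>P. y $ i * y $ j * (\<mu> u * (u $ i * u $ j)))" by (rule sum.swap)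
  also have "\<dots> = (\<Sum>i\<in>P. \<Sum>j\<in>P. \<Sum>u\<in>U. y $ i * y $ j * (\<mu> u * (u $ i * u $ j)))"
    by (intro sum.cong refl sum.swap)
  also have "\<dots> = (\<Sum>i\<in>P. \<Sum>j\<in>P. if i = j then y $ i * y $ j else 0)"
    unfolding sum_distrib_left[symmetric] by (intro sum.cong refl) (simp add: frame_block)
  also have "\<dots> = y \<bullet> y" unfolding red[of y] by simp
  finally show ?thesis by (simp add: power2_norm_eq_inner)
qed

text \<open>John's argument: \<open>y \<bullet> u\<close> lies between \<open>- norm y\<close> and
  \<open>1\<close>, so the products \<open>(1 - y \<bullet> u) * (norm y + y \<bullet> u)\<close>
  are nonnegative. Averaging kills the linear terms by centring. As \<open>y\<close> lies in the
  block, the frame identity there suffices.\<close>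

lemma norm_le_card:
  assumes y: "\<forall>i\<in>-P. y $ i = 0" and le: "\<And>u. u \<in> U \<Longrightarrow> y \<bullet> u \<le> 1"
  shows "norm y \<le> real CARD('n)"
proof -
  have "0 \<le> (\<Sum>u\<in>U. \<mu> u * ((1 - y \<bullet> u) * (norm y + y \<bullet> u)))"
  proof (intro sum_nonneg mult_nonneg_nonneg weight_nonneg)
    fix u assume u: "u \<in> U"
    have "\<bar>y \<bullet> u\<bar> \<le> norm y" using Cauchy_Schwarz_ineq2[of y u] norm_contact[OF u] by simp
    then show "0 \<le> norm y + y \<bullet> u" "0 \<le> 1 - y \<bullet> u" using le[OF u] by auto
  qed
  also have "\<dots> = (\<Sum>u\<in>U. norm y * \<mu> u + (1 - norm y) * (\<mu> u * (y \<bullet> u)) - \<mu> u * (y \<bullet> u)^2)"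
    by (intro sum.cong refl) (simp add: algebra_simps power2_eq_square)
  also have "\<dots> = norm y * real CARD('n) - (norm y)^2"
    by (simp add: sum.distrib sum_subtractf sum_distrib_left[symmetric] sum_inner_zero frame_identity[OF y] weight_sum)
  finally have "norm y * norm y \<le> norm y * real CARD('n)" by (simp add: power2_eq_square)
  then show ?thesis by (cases "norm y = 0") (auto simp: mult_le_cancel_left)
qed

lemma norm_le_sqrt_card:
  assumes y: "\<forall>i\<in>-P. y $ i = 0" and le: "\<And>u. u \<in> U \<Longrightarrow> \<bar>y \<bullet> u\<bar> \<le> 1"
  shows "norm y \<le> sqrt (real CARD('n))"
proof -
  have "(norm y)^2 \<le> (\<Sum>u\<in>U. \<mu> u)"
    unfolding frame_identity[OF y, symmetric]
    by (intro sum_mono mult_left_le weight_nonneg) (use le in \<open>auto simp: abs_square_le_1\<close>)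
  then show ?thesis unfolding weight_sum by (rule real_le_rsqrt)
qed

definition off_block :: "real^'n \<Rightarrow> real^'n" where
  "off_block u = (\<chi> i. if i \<in> P then 0 else u $ i)"

lemma off_block_inner: "off_block u \<bullet> u = (norm (off_block u))^2"
  unfolding power2_norm_eq_inner inner_vec_def by (intro sum.cong refl) (simp add: off_block_def)

lemma norm_off_block: "(norm (off_block u))^2 = (\<Sum>i\<in>-P. (u $ i)^2)"
  unfolding power2_norm_eq_inner inner_vec_def
  by (rule sum.mono_neutral_cong_right) (auto simp: off_block_def power2_eq_square)

lemma norm_off_block_le_1: "u \<in> U \<Longrightarrow> norm (off_block u) \<le> 1"
  using norm_cauchy_schwarz[of "off_block u" u] norm_contact[of u]
  by (cases "norm (off_block u) = 0") (auto simp: off_block_inner power2_eq_square)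

lemma off_block_sgn: "sgn (off_block u) \<bullet> u = norm (off_block u)"
  by (cases "off_block u = 0") (simp_all add: sgn_div_norm off_block_inner power2_eq_square)

lemma sgn_off_block: "\<forall>i\<in>P. sgn (off_block u) $ i = 0" "norm (sgn (off_block u)) \<le> 1"
  by (simp add: sgn_div_norm off_block_def) (simp add: norm_sgn)

text \<open>The ball is tested in the direction of the off-block part of each contact vector;
  \<open>sgn\<close> also covers a vanishing part. Centring removes the centre \<open>z\<close>.
  Replacing the length by its square is possible because it is at most \<open>1\<close>, and it
  brings in the trace condition.\<close>

lemma inradius_le:
  assumes r: "0 \<le> r" and le: "\<And>u y. u \<in> U \<Longrightarrow> \<forall>i\<in>P. y $ i = 0 \<Longrightarrow> norm y \<le> 1 \<Longrightarrow> (z + r *\<^sub>R y) \<bullet> u \<le> 1"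
  shows "r * real (card (-P)) \<le> real CARD('n)"
proof -
  have "r * real (card (-P)) = (\<Sum>u\<in>U. \<mu> u * (r * (norm (off_block u))^2)) + (\<Sum>u\<in>U. \<mu> u * (z \<bullet> u))"
    unfolding trace_off_block[symmetric] norm_off_block[symmetric] sum_inner_zero
    by (simp add: sum_distrib_left mult.left_commute)
  also have "\<dots> = (\<Sum>u\<in>U. \<mu> u * (z \<bullet> u + r * (norm (off_block u))^2))"
    by (simp add: distrib_left sum.distrib)
  also have "\<dots> \<le> (\<Sum>u\<in>U. \<mu> u * 1)"
  proof (intro sum_mono mult_left_mono weight_nonneg)
    fix u assume u: "u \<in> U"
    have "(norm (off_block u))^2 \<le> norm (off_block u)"
      using norm_off_block_le_1[OF u] by (simp add: power2_eq_square mult_left_le)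
    then have "r * (norm (off_block u))^2 \<le> r * norm (off_block u)" using r by (rule mult_left_mono)
    moreover have "z \<bullet> u + r * norm (off_block u) \<le> 1"
      using le[OF u sgn_off_block, of u] by (simp add: inner_add_left off_block_sgn)
    ultimately show "z \<bullet> u + r * (norm (off_block u))^2 \<le> 1" by simp
  qed
  finally show ?thesis by (simp add: weight_sum)
qed

lemma inradius_le_symmetric:
  assumes le: "\<And>u y. u \<in> U \<Longrightarrow> \<forall>i\<in>P. y $ i = 0 \<Longrightarrow> norm y \<le> 1 \<Longrightarrow> \<bar>(r *\<^sub>R y) \<bullet> u\<bar> \<le> 1"
  shows "r^2 * real (card (-P)) \<le> real CARD('n)"
proof -
  have "r^2 * real (card (-P)) = (\<Sum>u\<in>U. \<mu> u * (r * norm (off_block u))^2)"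
    unfolding trace_off_block[symmetric] norm_off_block[symmetric]
    by (simp add: sum_distrib_left mult.left_commute power_mult_distrib)
  also have "\<dots> \<le> (\<Sum>u\<in>U. \<mu> u * 1)"
  proof (intro sum_mono mult_left_mono weight_nonneg)
    fix u assume u: "u \<in> U"
    have "\<bar>r * norm (off_block u)\<bar> \<le> 1" using le[OF u sgn_off_block, of u] by (simp add: off_block_sgn)
    then show "(r * norm (off_block u))^2 \<le> 1" by (simp add: abs_square_le_1)
  qed
  finally show ?thesis by (simp add: weight_sum)
qed

lemma frame_coords:
  assumes h: "bij_betw h {..<CARD('n)} UNIV" and s: "s \<le> CARD('n)" and P: "P = h ` {..<s}"
  shows "(\<Sum>u\<in>U. \<mu> u * (\<Sum>a<s. u $ h a * x a)^2) = (\<Sum>a<s. (x a)^2)"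
proof -
  let ?y = "embed_vec h s x"
  have "\<forall>i\<in>-P. ?y $ i = 0"
  proof
    fix i assume i: "i \<in> -P"
    obtain a where a: "a < CARD('n)" "i = h a" using h unfolding bij_betw_def by (metis UNIV_I imageE lessThan_iff)
    then show "?y $ i = 0" using i by (auto simp: P embed_vec_nth[OF h s])
  qed
  then have "(\<Sum>u\<in>U. \<mu> u * (?y \<bullet> u)^2) = (norm ?y)^2" by (rule frame_identity)
  moreover have "?y \<bullet> u = (\<Sum>a<s. u $ h a * x a)" for u
    by (simp add: inner_embed_vec mult.commute)
  moreover have "(norm ?y)^2 = (\<Sum>a<s. (x a)^2)"
    unfolding power2_norm_eq_inner inner_embed_embed[OF h s] by (simp add: power2_eq_square)
  ultimately show ?thesis by simp
qed

end

section \<open>The theorem\<close>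

text \<open>Two coordinate maps are kept side by side: the isometry \<Phi>, in which volumes and
  radii are measured, and \<open>L = A o \<Phi>\<close>, in which \<open>E\<close> is the unit ball.
  They differ by the factor \<open>c\<close> on the orthogonal complement, so
  \<open>\<bar>c\<bar>\<close> is the radius of \<open>E\<close> there.\<close>

lemma revolution_john_position:
  fixes K :: "'a::euclidean_space set" and F :: "'a set" and A :: "'a \<Rightarrow> 'a" and E :: "'a set"
  defines "h \<equiv> Abs_bidx :: nat \<Rightarrow> 'a bidx"
  assumes K: "compact K" "convex K"
    and F: "subspace F" and s_lt: "dim F < DIM('a)"
    and A: "F_operator F A" and E_def: "E = A ` cball 0 1" and EK: "E \<subseteq> K"
    and Emax: "\<And>E'. rev_ellipsoid F E' \<Longrightarrow> E' \<subseteq> K \<Longrightarrow> measure lebesgue E' \<le> measure lebesgue E"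
  obtains \<Phi> L :: "real^'a bidx \<Rightarrow> 'a" and c U \<mu> where
    "linear \<Phi>" "bij \<Phi>" "\<And>y. norm (\<Phi> y) = norm y"
    "\<And>w. \<Phi> (embed_vec h (dim F) w) = (\<Sum>i<dim F. w i *\<^sub>R onb F i)"
    "\<And>y. \<Phi> y \<in> F \<longleftrightarrow> (\<forall>i\<in>-h ` {..<dim F}. y $ i = 0)"
    "\<And>y. \<Phi> y \<in> orthogonal_comp F \<longleftrightarrow> (\<forall>i\<in>h ` {..<dim F}. y $ i = 0)"
    "linear L" "bij L" "E = L ` cball 0 1"
    "\<And>y. L y \<in> F \<longleftrightarrow> (\<forall>i\<in>-h ` {..<dim F}. y $ i = 0)"
    "\<And>y. L y \<in> orthogonal_comp F \<longleftrightarrow> (\<forall>i\<in>h ` {..<dim F}. y $ i = 0)"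
    "c \<noteq> 0" "\<And>y. \<forall>i\<in>h ` {..<dim F}. y $ i = 0 \<Longrightarrow> L y = c *\<^sub>R \<Phi> y"
    "block_frame U \<mu> (h ` {..<dim F})"
    "\<And>u y. u \<in> U \<Longrightarrow> L y \<in> K \<Longrightarrow> y \<bullet> u \<le> 1"
proof -
  let ?G = "orthogonal_comp F" and ?P = "h ` {..<dim F}"
  have n: "CARD('a bidx) = DIM('a)" by (rule card_bidx)
  have h: "bij_betw h {..<CARD('a bidx)} UNIV" unfolding h_def n by (rule bij_betw_Abs_bidx)
  obtain \<Phi> :: "real^'a bidx \<Rightarrow> 'a" where \<Phi>: "linear \<Phi>" "bij \<Phi>" "\<And>x y. \<Phi> x \<bullet> \<Phi> y = x \<bullet> y"
    "\<And>w. \<Phi> (embed_vec h (dim F) w) = (\<Sum>i<dim F. w i *\<^sub>R onb F i)"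
    "\<And>y. \<Phi> y \<in> F \<longleftrightarrow> (\<forall>i\<in>-?P. y $ i = 0)"
    "\<And>y. \<Phi> y \<in> ?G \<longleftrightarrow> (\<forall>i\<in>?P. y $ i = 0)"
    by (rule adapted_isometry_exists[OF F h n]) (rule that)
  have norm\<Phi>: "norm (\<Phi> y) = norm y" for y by (simp add: norm_eq_sqrt_inner \<Phi>(3))
  have \<Phi>ball: "\<Phi> ` cball 0 1 = cball 0 1"
  proof (intro set_eqI iffI)
    fix x :: 'a assume x: "x \<in> cball 0 1"
    obtain y where "x = \<Phi> y" using \<Phi>(2) by (metis bij_pointE)
    then show "x \<in> \<Phi> ` cball 0 1" using x by (auto simp: norm\<Phi>)
  qed (auto simp: norm\<Phi>)
  obtain c where A': "linear A" "bij A" "A ` F \<subseteq> F" "A ` ?G \<subseteq> ?G" "c \<noteq> 0" "\<And>x. x \<in> ?G \<Longrightarrow> A x = c *\<^sub>R x"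
    using A unfolding F_operator_def by blast
  define L where "L = (\<lambda>y. A (\<Phi> y))"
  have linL: "linear L" unfolding L_def using linear_compose[OF \<Phi>(1) A'(1)] by (simp add: o_def)
  have bijL: "bij L" unfolding L_def using bij_comp[OF \<Phi>(2) A'(2)] by (simp add: o_def)
  have EL: "E = L ` cball 0 1" unfolding E_def L_def \<Phi>ball[symmetric] by (simp add: image_image)
  define p where "p = (\<lambda>y::real^'a bidx. \<chi> i. if i \<in> ?P then y $ i else 0)"
  have Lp: "L (p y) \<in> F" for y unfolding L_def using A'(3) \<Phi>(5)[of "p y"] by (auto simp: p_def)
  have Lq: "L (y - p y) \<in> ?G" for y unfolding L_def using A'(4) \<Phi>(6)[of "y - p y"] by (auto simp: p_def)
  have FG: "x = 0" if "x \<in> F" "x \<in> ?G" for x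
    using that by (auto simp: orthogonal_comp_def orthogonal_def)
  have L0: "L y = 0 \<longleftrightarrow> y = 0" for y using linL bijL by (metis bij_is_inj injD linear_0)
  have LF: "L y \<in> F \<longleftrightarrow> (\<forall>i\<in>-?P. y $ i = 0)" for y
  proof
    assume "L y \<in> F"
    then have "L y - L (p y) \<in> F" using Lp F by (simp add: subspace_diff)
    then have "L (y - p y) = 0" using FG[of "L (y - p y)"] Lq[of y] linL by (simp add: linear_diff)
    then have "y = p y" unfolding L0 by simp
    then have eq: "y $ i = p y $ i" for i by simp
    show "\<forall>i\<in>-?P. y $ i = 0"
    proof
      show "y $ i = 0" if "i \<in> -?P" for i by (subst eq) (use that in \<open>simp add: p_def\<close>)
    qed
  next
    assume "\<forall>i\<in>-?P. y $ i = 0"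
    then show "L y \<in> F" unfolding L_def using A'(3) \<Phi>(5)[of y] by auto
  qed
  have LG: "L y \<in> ?G \<longleftrightarrow> (\<forall>i\<in>?P. y $ i = 0)" for y
  proof
    assume "L y \<in> ?G"
    then have "L y - L (y - p y) \<in> ?G" by (rule subspace_diff[OF subspace_orthogonal_comp _ Lq])
    then have "L (p y) = 0" using FG[of "L (p y)"] Lp[of y] linL by (simp add: linear_diff)
    then have "p y = 0" unfolding L0 .
    then have eq: "p y $ i = 0" for i by simp
    show "\<forall>i\<in>?P. y $ i = 0"
    proof
      show "y $ i = 0" if "i \<in> ?P" for i using eq[of i] that by (simp add: p_def)
    qed
  next
    assume "\<forall>i\<in>?P. y $ i = 0"
    then show "L y \<in> ?G" unfolding L_def using A'(4) \<Phi>(6)[of y] by auto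
  qed
  have Lc: "L y = c *\<^sub>R \<Phi> y" if "\<forall>i\<in>?P. y $ i = 0" for y
    unfolding L_def using that \<Phi>(6) A'(6) by blast
  obtain \<kappa> where \<kappa>: "\<kappa> > 0" "\<And>S. compact S \<Longrightarrow> measure lebesgue (L ` S) = \<kappa> * measure lebesgue S"
    by (rule linear_bijection_scales_measure[OF linL bijL n]) (rule that)
  let ?K = "L -` K"
  define J where "J = inv L"
  have J: "L (J x) = x" "J (L y) = y" for x y
    using bijL by (auto simp: J_def bij_is_surj surj_f_inv_f bij_is_inj)
  have linJ: "linear J" unfolding J_def by (rule linear_inv_of_bij[OF linL bijL])
  have KJ: "?K = J ` K"
  proof (intro set_eqI iffI)
    show "y \<in> J ` K" if "y \<in> ?K" for y using that J(2)[of y] by (metis imageI vimageE)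
  qed (auto simp: J)
  have K0: "compact ?K" "convex ?K" "cball 0 1 \<subseteq> ?K"
  proof -
    show "compact ?K" unfolding KJ using K(1) linear_continuous_on[OF linear_conv_bounded_linear[THEN iffD1, OF linJ]]
      by (intro compact_continuous_image)
    show "convex ?K" unfolding KJ by (rule convex_linear_image[OF linJ K(2)])
    show "cball 0 1 \<subseteq> ?K" using EK EL by auto
  qed
  have P: "?P \<noteq> UNIV"
  proof
    assume "?P = UNIV"
    then have "CARD('a bidx) \<le> dim F" using card_image_le[of "{..<dim F}" h] by simp
    then show False using s_lt n by simp
  qed
  have max: "\<bar>det M\<bar> \<le> 1" if blk: "block_scalar ?P M" and det: "det M \<noteq> 0"
    and sub: "(\<lambda>x. M *v x + z) ` cball 0 1 \<subseteq> ?K" for M z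
  proof -
    obtain g where g: "\<And>i j. i \<notin> ?P \<or> j \<notin> ?P \<Longrightarrow> M $ i $ j = (if i = j then g else 0)"
      using blk unfolding block_scalar_def by blast
    have M1: "(M *v y) $ i = g * y $ i" if "i \<notin> ?P" for y i
      using that by (simp add: matrix_vector_mult_def g if_distrib[of "\<lambda>t. t * _"] cong: if_cong)
    have M2: "(M *v y) $ i = 0" if "\<forall>i\<in>?P. y $ i = 0" "i \<in> ?P" for y i
    proof -
      have "M $ i $ j * y $ j = 0" for j using that g[of i j] by (cases "j \<in> ?P") auto
      then have "(\<Sum>j\<in>UNIV. M $ i $ j * y $ j) = 0" by (intro sum.neutral) blast
      then show ?thesis by (simp add: matrix_vector_mult_def)
    qed
    have M3: "M *v y = g *\<^sub>R y" if "\<forall>i\<in>?P. y $ i = 0" for y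
      unfolding vec_eq_iff
    proof
      fix i show "(M *v y) $ i = (g *\<^sub>R y) $ i" using M1[of i y] M2[OF that, of i] that by (cases "i \<in> ?P") auto
    qed
    have bijM: "bij ((*v) M)" using det by (simp add: invertible_det_nz[symmetric] invertible_eq_bij)
    have "g \<noteq> 0"
    proof
      assume g0: "g = 0"
      obtain k where k: "k \<notin> ?P" using P by blast
      have "M *v axis k 1 = M *v 0" using k by (subst M3) (auto simp: axis_def g0)
      then have "axis k (1::real) = 0" by (rule injD[OF bij_is_inj[OF bijM]])
      then show False by (simp add: axis_eq_0_iff)
    qed
    define \<Psi> where "\<Psi> = inv \<Phi>"
    have \<Psi>: "\<Phi> (\<Psi> x) = x" "\<Psi> (\<Phi> y) = y" for x y
      using \<Phi>(2) by (auto simp: \<Psi>_def bij_is_surj surj_f_inv_f bij_is_inj)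
    have lin\<Psi>: "linear \<Psi>" unfolding \<Psi>_def by (rule linear_inv_of_bij[OF \<Phi>(1,2)])
    \<comment> \<open>A competing block scalar matrix becomes an \<open>F\<close>-operator on the
      original space. Composing with the inverse isometry on the right leaves the unit ball
      unchanged, so the image of the ball under \<open>T\<close> is that of \<open>L\<close> after
      \<open>M\<close>.\<close>
    define T where "T = (\<lambda>x. L (M *v \<Psi> x))"
    have "F_operator F T"
      unfolding F_operator_def
    proof (intro conjI exI[of _ "c * g"] ballI)
      show "linear T" unfolding T_def
        using linear_compose[OF linear_compose[OF lin\<Psi> matrix_vector_mul_linear] linL] by (simp add: o_def)
      have "bij \<Psi>" unfolding \<Psi>_def using \<Phi>(2) by (rule bij_imp_bij_inv)
      then show "bij T" unfolding T_def using bij_comp[OF bij_comp[OF _ bijM] bijL, of \<Psi>] by (simp add: o_def)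
      show "T ` F \<subseteq> F"
      proof
        fix t assume "t \<in> T ` F"
        then obtain x where x: "x \<in> F" "t = T x" by blast
        then have "\<forall>i\<in>-?P. \<Psi> x $ i = 0" using \<Phi>(5)[of "\<Psi> x"] \<Psi> by simp
        then have "\<forall>i\<in>-?P. (M *v \<Psi> x) $ i = 0" using M1 by simp
        then show "t \<in> F" unfolding x(2) T_def LF .
      qed
      have sc: "\<forall>i\<in>?P. \<Psi> x $ i = 0" "T x = (c * g) *\<^sub>R x" if "x \<in> ?G" for x
      proof -
        show z: "\<forall>i\<in>?P. \<Psi> x $ i = 0" using \<Phi>(6)[of "\<Psi> x"] \<Psi> that by simp
        have "T x = g *\<^sub>R L (\<Psi> x)" unfolding T_def M3[OF z] by (rule linear_scale[OF linL])
        then show "T x = (c * g) *\<^sub>R x" by (simp add: Lc[OF z] \<Psi> mult.commute)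
      qed
      show "T ` ?G \<subseteq> ?G" using sc(2) subspace_scale[OF subspace_orthogonal_comp] by auto
      show "c * g \<noteq> 0" using \<open>g \<noteq> 0\<close> A'(5) by simp
      show "T x = (c * g) *\<^sub>R x" if "x \<in> ?G" for x using sc(2)[OF that] .
    qed
    then have rev: "rev_ellipsoid F ((\<lambda>x. T x + L z) ` cball 0 1)" unfolding rev_ellipsoid_def by blast
    have T_eq: "(\<lambda>x. T x + L z) ` cball 0 1 = (\<lambda>x. L z + x) ` L ` (*v) M ` cball 0 1"
    proof -
      have "(\<lambda>x. T x + L z) ` cball 0 1 = (\<lambda>x. T x + L z) ` \<Phi> ` cball 0 1" by (simp only: \<Phi>ball)
      then show ?thesis by (simp add: image_image T_def \<Psi> add.commute)
    qed
    have "(\<lambda>x. T x + L z) ` cball 0 1 \<subseteq> K"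
      unfolding T_eq using sub linL by (auto simp: image_subset_iff linear_add add.commute)
    then have le: "measure lebesgue ((\<lambda>x. T x + L z) ` cball 0 1) \<le> measure lebesgue E" by (rule Emax[OF rev])
    have cM: "compact ((*v) M ` cball 0 1)"
      by (intro compact_continuous_image compact_cball linear_continuous_on linear_conv_bounded_linear[THEN iffD1] matrix_vector_mul_linear)
    have "measure lebesgue ((\<lambda>x. T x + L z) ` cball 0 1) = measure lebesgue (L ` (*v) M ` cball 0 1)"
      unfolding T_eq by (rule measure_translation)
    also have "\<dots> = \<kappa> * (\<bar>det M\<bar> * measure lebesgue (cball (0 :: real^'a bidx) 1))"
      by (simp add: \<kappa>(2)[OF cM] measure_linear_image[OF matrix_vector_mul_linear])
    finally have "\<kappa> * (\<bar>det M\<bar> * measure lebesgue (cball (0 :: real^'a bidx) 1)) \<le> \<kappa> * measure lebesgue (cball (0 :: real^'a bidx) 1)"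
      using le \<kappa>(2)[OF compact_cball, of 0 1] EL by simp
    moreover have "measure lebesgue (cball (0 :: real^'a bidx) 1) > 0" by (simp add: content_cball_pos)
    ultimately show ?thesis using \<kappa>(1) by simp
  qed
  obtain U \<mu> where J: "finite U" "\<And>u. u \<in> U \<Longrightarrow> norm u = 1" "\<And>u x. u \<in> U \<Longrightarrow> x \<in> ?K \<Longrightarrow> x \<bullet> u \<le> 1"
    "\<And>u. u \<in> U \<Longrightarrow> 0 \<le> \<mu> u" "(\<Sum>u\<in>U. \<mu> u) = real CARD('a bidx)" "(\<Sum>u\<in>U. \<mu> u *\<^sub>R u) = 0"
    "\<And>i j. i \<in> ?P \<Longrightarrow> j \<in> ?P \<Longrightarrow> (\<Sum>u\<in>U. \<mu> u * (u $ i * u $ j)) = (if i = j then 1 else 0)"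
    "(\<Sum>u\<in>U. \<mu> u * (\<Sum>i\<in>-?P. (u $ i)^2)) = real (card (-?P))"
    by (rule john_decomposition[OF K0 P]) ((rule max; assumption), rule that)
  have frame: "block_frame U \<mu> ?P" by (rule block_frame.intro) (rule J; assumption)+
  show ?thesis
    by (rule that[of \<Phi> L c U \<mu>, OF \<Phi>(1,2) norm\<Phi> \<Phi>(4-6) linL bijL EL LF LG A'(5) Lc frame]) (use J(3) in auto)
qed

text \<open>Negative radii belong to the set whose supremum is taken, since their balls are empty.
  \<open>B \<ge> 0\<close> disposes of them, and the radius \<open>0\<close> at a point of
  \<open>S\<close> shows that the set is nonempty.\<close>

lemma inrad_le:
  assumes hull: "affine hull S = V" and ne: "x\<^sub>0 \<in> S" and B: "0 \<le> B"
    and le: "\<And>r x. 0 \<le> r \<Longrightarrow> x \<in> V \<Longrightarrow> cball x r \<inter> V \<subseteq> S \<Longrightarrow> r \<le> B"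
  shows "inrad S \<le> B"
  unfolding inrad_def hull
proof (rule cSup_least)
  have "x\<^sub>0 \<in> V" using hull_inc[OF ne] hull by blast
  moreover have "cball x\<^sub>0 0 \<inter> V \<subseteq> S" using ne by auto
  ultimately show "{r. \<exists>x\<in>V. cball x r \<inter> V \<subseteq> S} \<noteq> {}" by blast
  fix r assume "r \<in> {r. \<exists>x\<in>V. cball x r \<inter> V \<subseteq> S}"
  then show "r \<le> B" using le[of r] B by (cases "0 \<le> r") auto
qed

lemma root_ratio_le:
  fixes X Y b C :: real and s :: nat
  assumes s: "1 \<le> s" and "0 \<le> X" "0 \<le> Y" "0 \<le> b" "0 \<le> C" and le: "X \<le> C ^ s * Y"
  shows "(X / b) powr (1 / s) \<le> C * (Y / b) powr (1 / s)"
proof -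
  have "X / b \<le> C ^ s * (Y / b)" using le \<open>0 \<le> b\<close> by (simp add: divide_right_mono)
  then have "(X / b) powr (1 / s) \<le> (C ^ s * (Y / b)) powr (1 / s)"
    using assms by (intro powr_mono2) auto
  also have "\<dots> = (C ^ s) powr (1 / s) * (Y / b) powr (1 / s)"
    by (rule powr_mult)
  also have "(C ^ s) powr (1 / s) = C"
    using s \<open>0 \<le> C\<close> by (cases "C = 0") (simp_all add: powr_realpow[symmetric] powr_powr)
  finally show ?thesis .
qed

text \<open>Of the \<open>s + 1\<close> half powers of \<open>s + 1\<close> in the simplex volume,
  \<open>s\<close> cancel against the square root in the constant. The last one meets the exponent
  \<open>(d - s) / (2 * (d + 1))\<close>, and \<open>1 / 2\<close> minus this is
  \<open>(s + 1) / (2 * (d + 1))\<close>.\<close>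

lemma simplex_bound_constant:
  fixes s :: nat and d :: real
  assumes s: "1 \<le> s" and d: "0 < d"
  shows "(1 / ((real s + 1) powr ((d - real s) / (2 * real s * (d + 1)))) * sqrt (d * (d + 1) / (real s * (real s + 1)))) ^ s
      * (sqrt s ^ s * sqrt (s + 1) ^ (s + 1) / fact s)
    = sqrt (d * (d + 1)) ^ s * (real s + 1) powr ((real s + 1) / (2 * (d + 1))) / fact s"
proof -
  define k where "k = real s + 1"
  have s0: "real s > 0" and k: "k > 0" using s by (auto simp: k_def)
  define e where "e = (d - real s) / (2 * (d + 1))"
  have es: "(d - real s) / (2 * real s * (d + 1)) * real s = e"
  proof -
    have "(d - real s) / (2 * real s * (d + 1)) = e / real s" by (simp add: e_def mult_ac)
    then show ?thesis using s0 by simp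
  qed
  have "(k powr ((d - real s) / (2 * real s * (d + 1)))) ^ s = k powr ((d - real s) / (2 * real s * (d + 1)) * real s)"
    using k by (simp add: powr_realpow[symmetric] powr_powr)
  then have p: "(k powr ((d - real s) / (2 * real s * (d + 1)))) ^ s = k powr e" unfolding es .
  have q: "sqrt k / k powr e = k powr ((real s + 1) / (2 * (d + 1)))"
  proof -
    have "1 / 2 - e = (real s + 1) / (2 * (d + 1))" using d by (simp add: e_def field_simps)
    then show ?thesis using powr_diff[of k "1 / 2" e] k by (simp add: powr_half_sqrt)
  qed
  have "(1 / (k powr ((d - real s) / (2 * real s * (d + 1)))) * sqrt (d * (d + 1) / (real s * k))) ^ s
      * (sqrt s ^ s * sqrt k ^ (s + 1) / fact s)
    = (1 / k powr e) * (sqrt (d * (d + 1)) ^ s / (sqrt s ^ s * sqrt k ^ s)) * (sqrt s ^ s * sqrt k ^ (s + 1) / fact s)"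
    by (simp add: power_mult_distrib power_divide p real_sqrt_divide real_sqrt_mult)
  also have "\<dots> = sqrt (d * (d + 1)) ^ s * (sqrt k / k powr e) / fact s"
    using s0 k by (simp add: field_simps)
  finally show ?thesis unfolding q by (simp add: k_def add.commute)
qed

lemma volS_simplexS_ge:
  fixes h :: "nat \<Rightarrow> 'n::{finite,wellorder}"
  assumes h: "bij_betw h {..<CARD('n)} UNIV" and s: "1 \<le> s" "Suc s \<le> CARD('n)"
  shows "sqrt s ^ s * sqrt (s + 1) ^ (s + 1) / fact s \<le> volS s (simplexS s)"
proof -
  have "regular_simplex_normals s (SOME u. regular_simplex_normals s u)"
    by (rule someI_ex[OF regular_simplex_normals_exist[OF s(1)]])
  from simplex_volume_ge[OF h s this] show ?thesis
    by (simp add: volS_def simplexS_def Let_def space_PiM Ball_def)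
qed

theorem mainTheorem4:
  fixes K :: "'a::euclidean_space set" and F :: "'a set" and A :: "'a \<Rightarrow> 'a" and E :: "'a set"
  assumes K: "convex_body K"
    and F: "subspace F" and s_lt: "dim F < DIM('a)"
    and A: "F_operator F A" and E_def: "E = A ` cball 0 1"
    and EK: "E \<subseteq> K"
    and Emax: "\<And>E'. rev_ellipsoid F E' \<Longrightarrow> E' \<subseteq> K \<Longrightarrow>
                 measure lebesgue E' \<le> measure lebesgue E"
  defines "d \<equiv> real DIM('a)" and "s \<equiv> real (dim F)"
  shows "inrad (K \<inter> orthogonal_comp F)
           \<le> d / (d - s) * ball_radius (E \<inter> orthogonal_comp F)
       \<and> (dim F \<ge> 1 \<longrightarrow>
           (subvol F (K \<inter> F) / subvol F (E \<inter> F)) powr (1 / s)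
           \<le> 1 / ((s + 1) powr ((d - s) / (2 * s * (d + 1))))
              * sqrt (d * (d + 1) / (s * (s + 1)))
              * (volS (dim F) (simplexS (dim F)) / volS (dim F) (unit_ballS (dim F))) powr (1 / s))
       \<and> E \<inter> F \<subseteq> K \<inter> F \<and> K \<inter> F \<subseteq> (\<lambda>x. d *\<^sub>R x) ` (E \<inter> F)
       \<and> (uminus ` K = K \<longrightarrow>
           inrad (K \<inter> orthogonal_comp F)
             \<le> sqrt (d / (d - s)) * ball_radius (E \<inter> orthogonal_comp F)
         \<and> (dim F \<ge> 1 \<longrightarrow>
             (subvol F (K \<inter> F) / subvol F (E \<inter> F)) powr (1 / s)
             \<le> sqrt (d / s)
                * (volS (dim F) (cubeS (dim F)) / volS (dim F) (unit_ballS (dim F))) powr (1 / s))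
         \<and> E \<inter> F \<subseteq> K \<inter> F \<and> K \<inter> F \<subseteq> (\<lambda>x. sqrt d *\<^sub>R x) ` (E \<inter> F))"
proof -
  define m where "m = dim F"
  define h where "h = (Abs_bidx :: nat \<Rightarrow> 'a bidx)"
  let ?G = "orthogonal_comp F" and ?P = "h ` {..<m}"
  have cK: "compact K" "convex K" using K by (auto simp: convex_body_def)
  obtain \<Phi> L :: "real^'a bidx \<Rightarrow> 'a" and c U \<mu> where
    \<Phi>: "linear \<Phi>" "bij \<Phi>" "\<And>y. norm (\<Phi> y) = norm y"
      "\<And>w. \<Phi> (embed_vec h m w) = (\<Sum>i<m. w i *\<^sub>R onb F i)"
      "\<And>y. \<Phi> y \<in> F \<longleftrightarrow> (\<forall>i\<in>-?P. y $ i = 0)"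
      "\<And>y. \<Phi> y \<in> ?G \<longleftrightarrow> (\<forall>i\<in>?P. y $ i = 0)"
    and L: "linear L" "bij L" "E = L ` cball 0 1"
      "\<And>y. L y \<in> F \<longleftrightarrow> (\<forall>i\<in>-?P. y $ i = 0)"
      "\<And>y. L y \<in> ?G \<longleftrightarrow> (\<forall>i\<in>?P. y $ i = 0)"
    and c: "c \<noteq> 0" and Lc: "\<And>y. \<forall>i\<in>?P. y $ i = 0 \<Longrightarrow> L y = c *\<^sub>R \<Phi> y"
    and frame: "block_frame U \<mu> ?P"
    and supp: "\<And>u y. u \<in> U \<Longrightarrow> L y \<in> K \<Longrightarrow> y \<bullet> u \<le> 1"
    by (rule revolution_john_position[OF cK F s_lt A E_def EK, folded h_def m_def]) ((rule Emax; assumption), rule that)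
  interpret block_frame U \<mu> ?P by (rule frame)
  have n: "CARD('a bidx) = DIM('a)" by (rule card_bidx)
  have h: "bij_betw h {..<CARD('a bidx)} UNIV" unfolding h_def n by (rule bij_betw_Abs_bidx)
  have m: "Suc m \<le> CARD('a bidx)" "m \<le> CARD('a bidx)" using s_lt n by (auto simp: m_def)
  have dn: "d = real CARD('a bidx)" by (simp add: d_def n)
  have sm: "s = real m" by (simp add: s_def m_def)
  have ds: "d - s > 0" "d > 0" "s \<ge> 0" using s_lt by (auto simp: d_def s_def)
  have cardP: "card ?P = m"
    using h m by (subst card_image) (auto simp: bij_betw_def intro: inj_on_subset)
  have cardQ: "real (card (-?P)) = d - s"
    using m by (simp add: Compl_eq_Diff_UNIV card_Diff_subset cardP dn sm of_nat_diff)
  have EKF: "E \<inter> F \<subseteq> K \<inter> F" using EK by blast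
  have surjL: "\<exists>y. x = L y" for x using L(2) by (metis bij_pointE)
  have surj\<Phi>: "\<exists>y. x = \<Phi> y" for x using \<Phi>(2) by (metis bij_pointE)

  \<comment> \<open>Both outer inclusions reduce to a norm bound in the coordinates of
    \<open>L\<close>.\<close>
  have scaled: "K \<inter> F \<subseteq> (\<lambda>x. R *\<^sub>R x) ` (E \<inter> F)"
    if R: "R > 0" "\<And>y. \<forall>i\<in>-?P. y $ i = 0 \<Longrightarrow> L y \<in> K \<Longrightarrow> norm y \<le> R" for R
  proof
    fix x assume x: "x \<in> K \<inter> F"
    obtain y where y: "x = L y" using surjL by blast
    then have z: "\<forall>i\<in>-?P. y $ i = 0" using x L(4) by simp
    then have "norm y \<le> R" using R(2) x y by simp
    then have "(1 / R) *\<^sub>R y \<in> cball 0 1" using R(1) by (simp add: field_simps)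
    moreover have "L ((1 / R) *\<^sub>R y) \<in> F" unfolding L(4) using z by simp
    ultimately have "L ((1 / R) *\<^sub>R y) \<in> E \<inter> F" unfolding L(3) by blast
    moreover have "x = R *\<^sub>R L ((1 / R) *\<^sub>R y)" using R(1) by (simp add: y linear_scale[OF L(1)])
    ultimately show "x \<in> (\<lambda>x. R *\<^sub>R x) ` (E \<inter> F)" by blast
  qed

  have small: "x \<in> E" if x: "x \<in> ?G" "norm x \<le> \<bar>c\<bar>" for x
  proof -
    obtain y where y: "x = \<Phi> y" using surj\<Phi> by blast
    then have z: "\<forall>i\<in>?P. y $ i = 0" using x \<Phi>(6) by simp
    have "(1 / c) *\<^sub>R y \<in> cball 0 1" using x(2) c by (simp add: y \<Phi>(3) field_simps)
    moreover have "L ((1 / c) *\<^sub>R y) = x" using z c by (subst Lc) (simp_all add: y linear_scale[OF \<Phi>(1)])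
    ultimately show ?thesis unfolding L(3) by (metis imageI)
  qed
  have G: "subspace ?G" by (rule subspace_orthogonal_comp)
  have 0: "0 \<in> K \<inter> ?G" using small[of 0] EK subspace_0[OF G] by auto
  \<comment> \<open>\<open>inrad\<close> refers to balls relative to the affine hull, which
    therefore has to be identified. The ball of radius \<open>\<bar>c\<bar>\<close> in
    \<open>E\<close> makes it the whole orthogonal complement.\<close>
  have hull: "affine hull (K \<inter> ?G) = ?G"
  proof -
    have "span (K \<inter> ?G) = ?G"
    proof
      show "span (K \<inter> ?G) \<subseteq> ?G" by (rule span_minimal[OF _ G]) simp
      show "?G \<subseteq> span (K \<inter> ?G)"
      proof
        fix x assume x: "x \<in> ?G"
        show "x \<in> span (K \<inter> ?G)"
        proof (cases "x = 0")
          case False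
          let ?y = "(\<bar>c\<bar> / norm x) *\<^sub>R x"
          have "?y \<in> K \<inter> ?G" using small[of ?y] EK subspace_scale[OF G x] False by auto
          then have "(norm x / \<bar>c\<bar>) *\<^sub>R ?y \<in> span (K \<inter> ?G)" by (intro span_scale span_base)
          then show ?thesis using c False by simp
        qed (simp add: span_zero)
      qed
    qed
    then show ?thesis using affine_hull_span_0[OF hull_inc[OF 0]] by simp
  qed
  have c_le: "\<bar>c\<bar> \<le> ball_radius (E \<inter> ?G)"
  proof -
    have "card (-?P) \<noteq> 0" using cardQ ds by linarith
    then obtain k where k: "k \<notin> ?P" by (metis ComplD card.empty equals0I)
    have z: "\<forall>i\<in>?P. (axis k 1 :: real^'a bidx) $ i = 0" using k by (auto simp: axis_def)
    have "L (axis k 1) \<in> E \<inter> ?G" unfolding L(3) using z by (auto simp: L(5) intro!: imageI)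
    moreover have "norm (L (axis k 1)) = \<bar>c\<bar>" by (simp add: Lc[OF z] \<Phi>(3))
    moreover have "bdd_above (norm ` (E \<inter> ?G))"
    proof -
      have "bounded E" using EK cK(1) compact_imp_bounded bounded_subset by blast
      then show ?thesis by (auto simp: bounded_iff bdd_above_def)
    qed
    ultimately show ?thesis unfolding ball_radius_def by (metis cSUP_upper)
  qed
  \<comment> \<open>On the orthogonal complement \<open>L\<close> is \<open>c\<close> times an
    isometry, so a ball of radius \<open>r\<close> pulls back to one of radius
    \<open>r / \<bar>c\<bar>\<close> with centre scaled by \<open>1 / c\<close>.\<close>
  have inner_ball: "((1 / c) *\<^sub>R z + (r / \<bar>c\<bar>) *\<^sub>R y) \<bullet> u \<le> 1" "L ((1 / c) *\<^sub>R z + (r / \<bar>c\<bar>) *\<^sub>R y) \<in> K"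
    if r: "0 \<le> r" and z: "\<Phi> z \<in> ?G" and sub: "cball (\<Phi> z) r \<inter> ?G \<subseteq> K"
      and u: "u \<in> U" and y: "\<forall>i\<in>?P. y $ i = 0" "norm y \<le> 1" for r z y u
  proof -
    let ?w = "(1 / c) *\<^sub>R z + (r / \<bar>c\<bar>) *\<^sub>R y"
    have z0: "\<forall>i\<in>?P. z $ i = 0" using z \<Phi>(6) by simp
    have "L ?w = \<Phi> (z + (c * r / \<bar>c\<bar>) *\<^sub>R y)"
      using z0 y(1) c by (subst Lc) (simp_all add: linear_scale[OF \<Phi>(1), symmetric] scaleR_add_right)
    then have Lw: "L ?w = \<Phi> z + (c * r / \<bar>c\<bar>) *\<^sub>R \<Phi> y"
      by (simp add: linear_add[OF \<Phi>(1)] linear_scale[OF \<Phi>(1)])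
    have "norm ((c * r / \<bar>c\<bar>) *\<^sub>R \<Phi> y) \<le> r" using r c y(2) by (simp add: \<Phi>(3) abs_mult mult_left_le)
    then have "L ?w \<in> cball (\<Phi> z) r" unfolding Lw by (simp add: dist_norm)
    moreover have "L ?w \<in> ?G" unfolding L(5) using z0 y(1) by simp
    ultimately show "L ?w \<in> K" using sub by blast
    then show "?w \<bullet> u \<le> 1" by (rule supp[OF u])
  qed
  have B0: "0 \<le> ball_radius (E \<inter> ?G)" using c_le by linarith
  have part1: "inrad (K \<inter> ?G) \<le> d / (d - s) * ball_radius (E \<inter> ?G)"
  proof (rule inrad_le[OF hull 0])
    show "0 \<le> d / (d - s) * ball_radius (E \<inter> ?G)" using B0 ds by simp
    fix r x assume r: "0 \<le> r" and x: "x \<in> ?G" "cball x r \<inter> ?G \<subseteq> K \<inter> ?G"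
    obtain z where z: "x = \<Phi> z" using surj\<Phi> by blast
    have "r / \<bar>c\<bar> * real (card (-?P)) \<le> d"
      unfolding dn by (rule inradius_le[of _ "(1 / c) *\<^sub>R z"]) (use inner_ball(1)[OF r, of z] x r in \<open>auto simp: z\<close>)
    then have "r \<le> d / (d - s) * \<bar>c\<bar>" using ds c unfolding cardQ by (simp add: field_simps)
    also have "\<dots> \<le> d / (d - s) * ball_radius (E \<inter> ?G)" using c_le ds by (intro mult_left_mono) auto
    finally show "r \<le> d / (d - s) * ball_radius (E \<inter> ?G)" .
  qed

  let ?CS = "coord_section h m"
  \<comment> \<open>\<open>N\<close> is \<open>L\<close> read in the isometric coordinates. It
    multiplies the volumes of coordinate sections by a constant \<kappa>, which cancels in the
    quotient, so the ellipsoid may be taken to be the unit ball.\<close>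
  define N where "N = (\<lambda>y. inv \<Phi> (L y))"
  have N\<Phi>: "\<Phi> (N y) = L y" for y using \<Phi>(2) by (simp add: N_def bij_is_surj surj_f_inv_f)
  have linN: "linear N" unfolding N_def
    using linear_compose[OF L(1) linear_inv_of_bij[OF \<Phi>(1,2)]] by (simp add: o_def)
  have injN: "inj N" by (rule injI) (metis N\<Phi> L(2) bij_is_inj injD)
  have N0: "(\<forall>i\<in>-?P. N y $ i = 0) \<longleftrightarrow> (\<forall>i\<in>-?P. y $ i = 0)" for y
    using \<Phi>(5)[of "N y"] L(4)[of y] by (simp add: N\<Phi>)
  obtain \<kappa> where \<kappa>: "\<kappa> > 0" "\<And>S. compact S \<Longrightarrow> volS m (?CS (N ` S)) = \<kappa> * volS m (?CS S)"
    by (rule volS_section_linear_image[OF h m(2) linN injN N0]) (rule that)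
  have onbF: "onb F i \<in> F" if "i < m" for i
    using onb_orthonormal(2)[OF F] that span_base[of "onb F i" "onb F ` {..<dim F}"] by (auto simp: m_def)
  have sub: "subvol F (L ` T \<inter> F) = volS m (?CS (N ` T))" for T
  proof -
    have "(\<Sum>i<m. w i *\<^sub>R onb F i) \<in> L ` T \<inter> F \<longleftrightarrow> embed_vec h m w \<in> N ` T" for w
    proof -
      have "(\<Sum>i<m. w i *\<^sub>R onb F i) \<in> F" using onbF F by (intro subspace_sum) (auto simp: subspace_scale)
      moreover have "\<Phi> (embed_vec h m w) \<in> L ` T \<longleftrightarrow> embed_vec h m w \<in> N ` T"
        using N\<Phi> bij_is_inj[OF \<Phi>(2)] by (auto simp: inj_eq image_iff) (metis N\<Phi> injD)+
      ultimately show ?thesis by (simp add: \<Phi>(4))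
    qed
    then show ?thesis unfolding subvol_def coord_section_def m_def[symmetric] by simp
  qed
  let ?K = "L -` K"
  have KL: "K = L ` ?K" using L(2) by (simp add: bij_is_surj surj_image_vimage_eq)
  have cK0: "compact ?K"
  proof -
    have "?K = inv L ` K" using L(2) by (rule bij_vimage_eq_inv_image)
    then show ?thesis using cK(1) linear_inv_of_bij[OF L(1,2)]
      by (simp add: compact_continuous_image linear_continuous_on linear_conv_bounded_linear)
  qed
  have ball: "?CS (cball 0 1) = unit_ballS m"
  proof -
    have "(norm (embed_vec h m w))^2 = (\<Sum>k<m. (w k)^2)" for w
      unfolding power2_norm_eq_inner inner_embed_embed[OF h m(2)] by (simp add: power2_eq_square)
    then have "norm (embed_vec h m w) \<le> 1 \<longleftrightarrow> (\<Sum>k<m. (w k)^2) \<le> 1" for w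
      by (metis norm_ge_zero one_power2 power2_le_iff_abs_le abs_norm_cancel zero_le_one)
    then show ?thesis by (simp add: coord_section_def unit_ballS_def)
  qed
  have ratio: "subvol F (K \<inter> F) / subvol F (E \<inter> F) = volS m (?CS ?K) / volS m (unit_ballS m)"
  proof -
    have "subvol F (K \<inter> F) = \<kappa> * volS m (?CS ?K)"
      using sub[of ?K] unfolding KL[symmetric] \<kappa>(2)[OF cK0] .
    moreover have "subvol F (E \<inter> F) = \<kappa> * volS m (unit_ballS m)"
      unfolding L(3) sub \<kappa>(2)[OF compact_cball] ball ..
    ultimately show ?thesis using \<kappa>(1) by simp
  qed
  have volS_le: "volS m S \<le> B" if "emeasure (PiL m) S \<le> ennreal B" "0 \<le> B" for S B
    using that by (simp add: volS_def measure_def enn2real_leI)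
  have in_space: "?CS ?K \<subseteq> space (PiL m)" by (auto simp: coord_section_def space_PiM)
  have supp': "(\<Sum>a<m. u $ h a * x a) \<le> 1" if "x \<in> ?CS ?K" "u \<in> U" for x u
    using supp[of u "embed_vec h m x"] that by (simp add: coord_section_def inner_embed_vec mult.commute)

  have part2: "(subvol F (K \<inter> F) / subvol F (E \<inter> F)) powr (1 / s)
      \<le> 1 / ((s + 1) powr ((d - s) / (2 * s * (d + 1)))) * sqrt (d * (d + 1) / (s * (s + 1)))
        * (volS m (simplexS m) / volS m (unit_ballS m)) powr (1 / s)" if m1: "1 \<le> m"
  proof -
    let ?R = "sqrt (d * (d + 1)) ^ m * (real m + 1) powr ((real m + 1) / (2 * (d + 1))) / fact m"
    let ?C = "1 / ((real m + 1) powr ((d - real m) / (2 * real m * (d + 1)))) * sqrt (d * (d + 1) / (real m * (real m + 1)))"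
    have C: "?C \<ge> 0" using ds by simp
    have "emeasure (PiL m) (?CS ?K) \<le> emeasure (PiL m) {x \<in> space (PiL m). \<forall>u\<in>U. (\<Sum>a<m. u $ h a * x a) \<le> 1}"
      by (intro emeasure_mono polytope_sets(2) finite_contact) (use in_space supp' in blast)
    also have "\<dots> \<le> ennreal ?R"
    proof (rule polytope_volume_le[OF h m1 m(1) finite_contact weight_nonneg])
      show "sum \<mu> U = d" by (simp add: weight_sum dn)
      show "real m + 1 \<le> d" using m(1) by (simp add: dn)
      show "(\<Sum>u\<in>U. \<mu> u * (\<Sum>a<m. u $ h a * x a)^2) = (\<Sum>a<m. (x a)^2)" for x
        by (rule frame_coords[OF h m(2) refl])
      show "(\<Sum>u\<in>U. \<mu> u * u $ h a) = 0" for a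
        using arg_cong[OF centred, of "\<lambda>v. v $ h a"] by simp
      show "(\<Sum>a<m. (u $ h a)^2) \<le> 1" if "u \<in> U" for u
      proof -
        have "(\<Sum>a<m. (u $ h a)^2) \<le> (\<Sum>a<m. u $ h a * u $ h a) + (\<Sum>a\<in>{m..<CARD('a bidx)}. u $ h a * u $ h a)"
          by (simp add: power2_eq_square sum_nonneg)
        also have "\<dots> = (norm u)^2"
          unfolding power2_norm_eq_inner inner_vec_def by (subst sum_over_enumeration[OF h m(2)]) simp
        finally show ?thesis using norm_contact[OF that] by simp
      qed
    qed
    finally have "volS m (?CS ?K) \<le> ?R" by (intro volS_le) (use ds in auto)
    also have "?R = ?C ^ m * (sqrt m ^ m * sqrt (m + 1) ^ (m + 1) / fact m)"
      by (rule simplex_bound_constant[OF m1 ds(2), symmetric])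
    also have "\<dots> \<le> ?C ^ m * volS m (simplexS m)"
      by (intro mult_left_mono volS_simplexS_ge[OF h m1 m(1)] zero_le_power C)
    finally have "volS m (?CS ?K) \<le> ?C ^ m * volS m (simplexS m)" .
    then show ?thesis unfolding ratio sm
      by (intro root_ratio_le[OF m1 _ _ _ C]) (simp_all add: volS_def)
  qed

  have part3: "K \<inter> F \<subseteq> (\<lambda>x. d *\<^sub>R x) ` (E \<inter> F)"
    by (rule scaled[OF ds(2)]) (use norm_le_card supp dn in auto)

  have sym: "inrad (K \<inter> ?G) \<le> sqrt (d / (d - s)) * ball_radius (E \<inter> ?G)
      \<and> (m \<ge> 1 \<longrightarrow> (subvol F (K \<inter> F) / subvol F (E \<inter> F)) powr (1 / s)
          \<le> sqrt (d / s) * (volS m (cubeS m) / volS m (unit_ballS m)) powr (1 / s))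
      \<and> K \<inter> F \<subseteq> (\<lambda>x. sqrt d *\<^sub>R x) ` (E \<inter> F)" if symK: "uminus ` K = K"
  proof (intro conjI impI)
    have Lneg: "L (- y) \<in> K" if "L y \<in> K" for y
      using that symK by (metis L(1) imageI linear_neg)
    have supp_abs: "\<bar>y \<bullet> u\<bar> \<le> 1" if "u \<in> U" "L y \<in> K" for u y
      using supp[OF that] supp[OF that(1) Lneg[OF that(2)]] by (simp add: abs_le_iff)
    show "inrad (K \<inter> ?G) \<le> sqrt (d / (d - s)) * ball_radius (E \<inter> ?G)"
    proof (rule inrad_le[OF hull 0])
      show "0 \<le> sqrt (d / (d - s)) * ball_radius (E \<inter> ?G)" using B0 ds by simp
      fix r x assume r: "0 \<le> r" and x: "x \<in> ?G" "cball x r \<inter> ?G \<subseteq> K \<inter> ?G"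
      obtain z where z: "x = \<Phi> z" using surj\<Phi> by blast
      have "\<bar>((r / \<bar>c\<bar>) *\<^sub>R y) \<bullet> u\<bar> \<le> 1" if u: "u \<in> U" and y: "\<forall>i\<in>?P. y $ i = 0" "norm y \<le> 1" for u y
      proof -
        \<comment> \<open>Opposite points of the ball give bounds for \<open>a + b\<close> and
          \<open>a - b\<close>, where \<open>a\<close> comes from the centre; together they bound
          \<open>b\<close> alone. So the centre of the ball plays no part in the symmetric
          case.\<close>
        have "\<bar>((1 / c) *\<^sub>R z + (r / \<bar>c\<bar>) *\<^sub>R y') \<bullet> u\<bar> \<le> 1" if "y' \<in> {y, - y}" for y'
          using supp_abs[OF u inner_ball(2)[OF r, of z u y']] x y u that by (auto simp: z)
        from this[of y] this[of "- y"]
        have "\<bar>z \<bullet> u / c + r / \<bar>c\<bar> * (y \<bullet> u)\<bar> \<le> 1" "\<bar>z \<bullet> u / c - r / \<bar>c\<bar> * (y \<bullet> u)\<bar> \<le> 1"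
          by (simp_all add: inner_add_left inner_diff_left)
        moreover have "\<bar>b\<bar> \<le> 1" if "\<bar>a + b\<bar> \<le> 1" "\<bar>a - b\<bar> \<le> 1" for a b :: real
          using that by linarith
        ultimately have "\<bar>r / \<bar>c\<bar> * (y \<bullet> u)\<bar> \<le> 1" by blast
        then show ?thesis by simp
      qed
      then have "(r / \<bar>c\<bar>)^2 * real (card (-?P)) \<le> d" unfolding dn by (rule inradius_le_symmetric)
      then have "(r / \<bar>c\<bar>)^2 \<le> d / (d - s)" unfolding cardQ using ds by (simp add: field_simps)
      then have "r / \<bar>c\<bar> \<le> sqrt (d / (d - s))" by (rule real_le_rsqrt)
      then have "r \<le> sqrt (d / (d - s)) * \<bar>c\<bar>" using c by (simp add: field_simps)
      also have "\<dots> \<le> sqrt (d / (d - s)) * ball_radius (E \<inter> ?G)" using c_le ds by (intro mult_left_mono) auto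
      finally show "r \<le> sqrt (d / (d - s)) * ball_radius (E \<inter> ?G)" .
    qed
    show "K \<inter> F \<subseteq> (\<lambda>x. sqrt d *\<^sub>R x) ` (E \<inter> F)"
      by (rule scaled) (use ds norm_le_sqrt_card supp_abs dn in auto)
    show "(subvol F (K \<inter> F) / subvol F (E \<inter> F)) powr (1 / s)
        \<le> sqrt (d / s) * (volS m (cubeS m) / volS m (unit_ballS m)) powr (1 / s)" if m1: "1 \<le> m"
    proof -
      have "emeasure (PiL m) (?CS ?K) \<le> emeasure (PiL m) {x \<in> space (PiL m). \<forall>u\<in>U. \<bar>\<Sum>a<m. u $ h a * x a\<bar> \<le> 1}"
      proof (rule emeasure_mono)
        show "?CS ?K \<subseteq> {x \<in> space (PiL m). \<forall>u\<in>U. \<bar>\<Sum>a<m. u $ h a * x a\<bar> \<le> 1}"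
          using in_space supp_abs by (fastforce simp: coord_section_def inner_embed_vec mult.commute)
        have "(\<lambda>x. \<Sum>a<m. u $ h a * x a) \<in> borel_measurable (PiL m)" for u :: "real^'a bidx"
          by (intro borel_measurable_sum borel_measurable_times) auto
        note [measurable] = this and [simp] = finite_contact
        show "{x \<in> space (PiL m). \<forall>u\<in>U. \<bar>\<Sum>a<m. u $ h a * x a\<bar> \<le> 1} \<in> sets (PiL m)" by measurable
      qed
      also have "\<dots> \<le> ennreal ((2 * sqrt (d / m)) ^ m)"
      proof (rule symmetric_polytope_volume_le[OF h m1 m(2) finite_contact weight_nonneg])
        show "sum \<mu> U = d" by (simp add: weight_sum dn)
        show "(\<Sum>u\<in>U. \<mu> u * (\<Sum>a<m. u $ h a * x a)^2) = (\<Sum>a<m. (x a)^2)" for x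
          by (rule frame_coords[OF h m(2) refl])
      qed
      finally have "volS m (?CS ?K) \<le> (2 * sqrt (d / m)) ^ m" by (intro volS_le) (use ds in auto)
      then have "volS m (?CS ?K) \<le> sqrt (d / m) ^ m * volS m (cubeS m)"
        by (simp add: volS_cubeS power_mult_distrib mult.commute)
      then show ?thesis unfolding ratio sm
        using ds by (intro root_ratio_le[OF m1]) (simp_all add: volS_def)
    qed
  qed
  show ?thesis using part1 part2 EKF part3 sym unfolding m_def by blast
qed

end
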